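(* For any sequence of complex numbers $\mathbf a=(a_1,a_3,a_5,\dots)$, the formal series $$\tau_{\mathrm{KdV}}(t_1,t_3,\dots)=\sum_{\lambda\in\mathrm{DP}}Q_\lambda(\mathbf a)\,Q_\lambda(2\mathbf t_B),\qquad \mathbf t_B=(t_1,t_3,t_5,\dots),$$ is a $\tau$-function of the KdV hierarchy.
   Context: Schur-$Q$ functions. Polynomials $q_i(\mathbf t_B)$ in $\mathbf t_B=(t_1,t_3,t_5,\dots)$ are defined by $\exp(\sum_{k\ge1\text{ odd}}t_kz^k)=\sum_{i\ge0}q_i(\mathbf t_B)z^i$. For integers $a>b\ge1$, $Q_{a,b}=\frac12q_aq_b+\sum_{k=1}^b(-1)^kq_{a+k}q_{b-k}$; $Q_{a,0}=\frac1{\sqrt2}q_a$ for $a\ge1$; $Q_{b,a}=-Q_{a,b}$ and $Q_{a,a}=0$. $\mathrm{DP}$ is the set of strict partitions $\lambda=(\lambda_1>\dots>\lambda_m>0)$, including the empty one; if $m$ is odd, $\lambda$ is augmented by a part $0$, and $Q_\lambda=\mathrm{Pf}(Q_{\lambda_i,\lambda_j})$ for the (augmented) partition, $Q_\emptyset=1$. $Q_\lambda(2\mathbf t_B)$ means each $t_k$ is replaced by $2t_k$, and $Q_\lambda(\mathbf a)$ is the value at $t_k=a_k$. KdV $\tau$-functions. A nonzero formal power series $\tau(t_1,t_2,t_3,\dots)$ is a KP $\tau$-function if $$\mathrm{Res}_z\ \exp\Big(\sum_{j\ge1}2z^js_j\Big)\exp\Big(-\sum_{j\ge1}\frac{z^{-j}}{j}\frac{\partial}{\partial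 s_j}\Big)\tau(\mathbf t+\mathbf s)\,\tau(\mathbf t-\mathbf s)=0,$$ where $\mathrm{Res}_z$ is the coefficient of $z^{-1}$ and $\mathbf s=(s_1,s_2,\dots)$. The KdV hierarchy is the $2$-reduction of the KP hierarchy: a KdV $\tau$-function is a KP $\tau$-function depending only on the odd times $t_1,t_3,t_5,\dots$. *)

theory Defs
  imports Complex_Main
    "HOL-Library.Poly_Mapping"
    "HOL-Computational_Algebra.Formal_Power_Series"
    "HOL-Combinatorics.Permutations"
begin

unbundle fps_syntax

section \<open>Formal power series in arbitrarily many variables\<close>

text \<open>
  A monomial in the variables of type \<^typ>\<open>'v\<close> is its finitely supported exponent function
  of type \<^typ>\<open>'v \<Rightarrow>\<^sub>0 nat\<close>.  A formal power series is an arbitrary complex-valued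
  function on monomials; a polynomial is a finitely supported one, of type
  \<^typ>\<open>('v \<Rightarrow>\<^sub>0 nat) \<Rightarrow>\<^sub>0 complex\<close>, whose ring structure is that of the library.
\<close>

typedef 'v mfps = "UNIV :: (('v \<Rightarrow>\<^sub>0 nat) \<Rightarrow> complex) set"
  morphisms mcoeff Abs_mfps ..

setup_lifting type_definition_mfps

lemma mcoeff_Abs_mfps [simp]: "mcoeff (Abs_mfps f) m = f m"
  by (simp add: Abs_mfps_inverse)

lemma mfps_eqI: "(\<And>m. mcoeff f m = mcoeff g m) \<Longrightarrow> f = g"
  by (simp add: mcoeff_inject[symmetric] fun_eq_iff)

definition msplits :: "('v \<Rightarrow>\<^sub>0 nat) \<Rightarrow> (('v \<Rightarrow>\<^sub>0 nat) \<times> ('v \<Rightarrow>\<^sub>0 nat)) set" where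
  "msplits m = {(p, q). p + q = m}"

lemma finite_msplits [simp]: "finite (msplits m)"
proof -
  let ?A = "{p. \<exists>q. p + q = m}"
  define N where "N = Max (insert 0 (Poly_Mapping.lookup m ` Poly_Mapping.keys m))"
  have N: "Poly_Mapping.lookup m x \<le> N" if "x \<in> Poly_Mapping.keys m" for x
    unfolding N_def by (rule Max_ge) (use that in auto)
  have fin: "finite {f. \<forall>x. (x \<in> Poly_Mapping.keys m \<longrightarrow> f x \<in> {..N}) \<and>
      (x \<notin> Poly_Mapping.keys m \<longrightarrow> f x = 0)}"
    by (rule finite_set_of_finite_funs) auto
  have sub: "Poly_Mapping.lookup ` ?A \<subseteq> {f. \<forall>x. (x \<in> Poly_Mapping.keys m \<longrightarrow> f x \<in> {..N}) \<and>
      (x \<notin> Poly_Mapping.keys m \<longrightarrow> f x = 0)}"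
  proof (clarsimp, intro conjI impI)
    fix p q x assume "m = p + q"
    then have le: "Poly_Mapping.lookup p x \<le> Poly_Mapping.lookup m x"
      by (simp add: lookup_add)
    show "Poly_Mapping.lookup p x \<le> N" if "x \<in> Poly_Mapping.keys (p + q)"
      using le N[of x] that \<open>m = p + q\<close> by simp
    show "Poly_Mapping.lookup p x = 0" if "x \<notin> Poly_Mapping.keys (p + q)"
      using le that \<open>m = p + q\<close> by (simp add: in_keys_iff)
  qed
  have "finite ?A"
    using finite_subset[OF sub fin] by (rule finite_imageD) (simp add: inj_on_def)
  then have "finite ((\<lambda>p. (p, m - p)) ` ?A)"
    by simp
  moreover have "msplits m \<subseteq> (\<lambda>p. (p, m - p)) ` ?A"
    by (auto simp: msplits_def)
  ultimately show ?thesis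
    by (rule finite_subset[rotated])
qed

instantiation mfps :: (type) comm_ring_1
begin

lift_definition zero_mfps :: "'a mfps" is "\<lambda>_. 0" .
lift_definition one_mfps :: "'a mfps" is "\<lambda>m. if m = 0 then 1 else 0" .
lift_definition plus_mfps :: "'a mfps \<Rightarrow> 'a mfps \<Rightarrow> 'a mfps" is "\<lambda>f g m. f m + g m" .
lift_definition minus_mfps :: "'a mfps \<Rightarrow> 'a mfps \<Rightarrow> 'a mfps" is "\<lambda>f g m. f m - g m" .
lift_definition uminus_mfps :: "'a mfps \<Rightarrow> 'a mfps" is "\<lambda>f m. - f m" .
lift_definition times_mfps :: "'a mfps \<Rightarrow> 'a mfps \<Rightarrow> 'a mfps"
  is "\<lambda>f g m. \<Sum>(p, q)\<in>msplits m. f p * g q" .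

instance
proof
  fix f g h :: "'a mfps"
  show "f * g * h = f * (g * h)"
  proof (transfer, rule ext)
    fix f g h :: "('a \<Rightarrow>\<^sub>0 nat) \<Rightarrow> complex" and m :: "'a \<Rightarrow>\<^sub>0 nat"
    have "(\<Sum>(p, c)\<in>msplits m. (\<Sum>(a, b)\<in>msplits p. f a * g b) * h c) =
          (\<Sum>x\<in>msplits m. \<Sum>y\<in>msplits (fst x). f (fst y) * g (snd y) * h (snd x))"
      by (simp add: case_prod_beta sum_distrib_right)
    also have "\<dots> = (\<Sum>(x, y)\<in>Sigma (msplits m) (\<lambda>x. msplits (fst x)).
                      f (fst y) * g (snd y) * h (snd x))"
      by (rule sum.Sigma) auto
    also have "\<dots> = (\<Sum>(x, y)\<in>Sigma (msplits m) (\<lambda>x. msplits (snd x)).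
                      f (fst x) * (g (fst y) * h (snd y)))"
      by (rule sum.reindex_bij_witness
            [where i = "\<lambda>((a, q), (b, c)). ((a + b, c), (a, b))"
               and j = "\<lambda>((p, c), (a, b)). ((a, b + c), (b, c))"])
         (auto simp: msplits_def add.assoc mult.assoc)
    also have "\<dots> = (\<Sum>x\<in>msplits m. \<Sum>y\<in>msplits (snd x). f (fst x) * (g (fst y) * h (snd y)))"
      by (rule sum.Sigma[symmetric]) auto
    also have "\<dots> = (\<Sum>(a, q)\<in>msplits m. f a * (\<Sum>(b, c)\<in>msplits q. g b * h c))"
      by (simp add: case_prod_beta sum_distrib_left)
    finally show "(\<Sum>(p, c)\<in>msplits m. (\<Sum>(a, b)\<in>msplits p. f a * g b) * h c) =
                  (\<Sum>(a, q)\<in>msplits m. f a * (\<Sum>(b, c)\<in>msplits q. g b * h c))" .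
  qed
  show "f * g = g * f"
    by (transfer, rule ext, rule sum.reindex_bij_witness[where i = prod.swap and j = prod.swap])
       (auto simp: msplits_def add.commute)
  show "1 * f = f"
  proof (transfer, rule ext)
    fix f :: "('a \<Rightarrow>\<^sub>0 nat) \<Rightarrow> complex" and m :: "'a \<Rightarrow>\<^sub>0 nat"
    have "(\<Sum>(p, q)\<in>msplits m. (if p = 0 then 1 else 0) * f q) =
          (\<Sum>(p, q)\<in>{(0 :: 'a \<Rightarrow>\<^sub>0 nat, m)}. (if p = 0 then 1 else 0) * f q)"
      by (rule sum.mono_neutral_right[OF finite_msplits]) (auto simp: msplits_def split: if_splits)
    then show "(\<Sum>(p, q)\<in>msplits m. (if p = 0 then 1 else 0) * f q) = f m"
      by simp
  qed
  show "(f + g) * h = f * h + g * h"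
    by (transfer, rule ext) (simp add: case_prod_beta distrib_right sum.distrib)
  show "(0 :: 'a mfps) \<noteq> 1"
    by transfer (auto simp: fun_eq_iff)
qed (transfer, auto simp: fun_eq_iff)+

end

definition mfps_const :: "complex \<Rightarrow> 'v mfps" where
  "mfps_const c = Abs_mfps (\<lambda>m. if m = 0 then c else 0)"

definition mfps_var :: "'v \<Rightarrow> 'v mfps" where
  "mfps_var v = Abs_mfps (\<lambda>m. if m = Poly_Mapping.single v 1 then 1 else 0)"

definition mfps_of_poly :: "(('v \<Rightarrow>\<^sub>0 nat) \<Rightarrow>\<^sub>0 complex) \<Rightarrow> 'v mfps" where
  "mfps_of_poly P = Abs_mfps (Poly_Mapping.lookup P)"

definition mfps_deriv :: "'v \<Rightarrow> 'v mfps \<Rightarrow> 'v mfps" where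
  "mfps_deriv v f = Abs_mfps (\<lambda>m. of_nat (Poly_Mapping.lookup m v + 1) *
     mcoeff f (m + Poly_Mapping.single v 1))"

definition depends_only_on :: "'v set \<Rightarrow> 'v mfps \<Rightarrow> bool" where
  "depends_only_on V f \<longleftrightarrow> (\<forall>m. mcoeff f m \<noteq> 0 \<longrightarrow> Poly_Mapping.keys m \<subseteq> V)"

text \<open>
  An infinite family may be summed formally if every monomial occurs in only finitely many of its
  members.  Without this condition \<open>formal_sum\<close> is meaningless.
\<close>

definition formally_summable :: "('i \<Rightarrow> 'v mfps) \<Rightarrow> 'i set \<Rightarrow> bool" where
  "formally_summable f I \<longleftrightarrow> (\<forall>m. finite {i \<in> I. mcoeff (f i) m \<noteq> 0})"

definition formal_sum :: "('i \<Rightarrow> 'v mfps) \<Rightarrow> 'i set \<Rightarrow> 'v mfps" where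
  "formal_sum f I = Abs_mfps (\<lambda>m. \<Sum>i | i \<in> I \<and> mcoeff (f i) m \<noteq> 0. mcoeff (f i) m)"

text \<open>
  Substitution of \<open>\<sigma> v\<close> for each variable \<open>v\<close>.  The sum is well defined for the substitutions used
  below, since a monomial of \<open>\<Prod>\<^sub>v (\<sigma> v)\<^bsup>m v\<^esup>\<close> then determines \<open>m\<close>.
\<close>

definition mfps_subst :: "('v \<Rightarrow> 'w mfps) \<Rightarrow> 'v mfps \<Rightarrow> 'w mfps" where
  "mfps_subst \<sigma> f = formal_sum (\<lambda>m. mfps_const (mcoeff f m) *
     (\<Prod>v\<in>Poly_Mapping.keys m. \<sigma> v ^ Poly_Mapping.lookup m v)) UNIV"

text \<open>
  Evaluation of a polynomial at \<open>x\<close>, with values in a ring into which \<open>C\<close> embeds the constants.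
\<close>

definition poly_eval ::
    "(complex \<Rightarrow> 'r) \<Rightarrow> ('v \<Rightarrow> 'r) \<Rightarrow> (('v \<Rightarrow>\<^sub>0 nat) \<Rightarrow>\<^sub>0 complex) \<Rightarrow> 'r::comm_ring_1" where
  "poly_eval C x P = (\<Sum>m\<in>Poly_Mapping.keys P. C (Poly_Mapping.lookup P m) *
     (\<Prod>v\<in>Poly_Mapping.keys m. x v ^ Poly_Mapping.lookup m v))"

text \<open>
  The exponential of a power series in \<open>z\<close> with zero constant term, over a ring into which \<open>C\<close>
  embeds the constants.  (The library's \<^const>\<open>fps_exp\<close> requires the coefficients to form a field.)
\<close>

definition exp_series :: "(complex \<Rightarrow> 'r) \<Rightarrow> 'r fps \<Rightarrow> 'r::comm_ring_1 fps" where
  "exp_series C F = fps_compose (Abs_fps (\<lambda>n. C (1 / fact n))) F"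


section \<open>Schur Q-functions\<close>

type_synonym poly_t = "(nat \<Rightarrow>\<^sub>0 nat) \<Rightarrow>\<^sub>0 complex"

definition poly_const :: "complex \<Rightarrow> poly_t" where
  "poly_const c = Poly_Mapping.single 0 c"

definition poly_t_var :: "nat \<Rightarrow> poly_t" where
  "poly_t_var k = Poly_Mapping.single (Poly_Mapping.single k 1) 1"

definition schur_q :: "nat \<Rightarrow> poly_t" where
  "schur_q i = exp_series poly_const (Abs_fps (\<lambda>k. if odd k then poly_t_var k else 0)) $ i"

definition schur_Q_gt :: "nat \<Rightarrow> nat \<Rightarrow> poly_t" where
  "schur_Q_gt a b =
     (if b = 0 then poly_const (1 / of_real (sqrt 2)) * schur_q a
      else poly_const (1 / 2) * schur_q a * schur_q b +
           (\<Sum>k=1..b. (-1) ^ k * schur_q (a + k) * schur_q (b - k)))"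

definition schur_Q2 :: "nat \<Rightarrow> nat \<Rightarrow> poly_t" where
  "schur_Q2 a b =
     (if a > b then schur_Q_gt a b else if a < b then - schur_Q_gt b a else 0)"

text \<open>
  Pfaffian of the skew-symmetric \<open>2n \<times> 2n\<close> matrix \<open>A\<close>, indices starting at 0.  Each perfect
  matching of \<open>{..<2n}\<close> is represented by exactly one of the permutations in the sum.
\<close>

definition pfaffian :: "nat \<Rightarrow> (nat \<Rightarrow> nat \<Rightarrow> 'r) \<Rightarrow> 'r::comm_ring_1" where
  "pfaffian n A = (\<Sum>p | p permutes {..<2 * n} \<and> (\<forall>i<n. p (2 * i) < p (2 * i + 1)) \<and>
       (\<forall>i j. i < j \<and> j < n \<longrightarrow> p (2 * i) < p (2 * j)).
     of_int (sign p) * (\<Prod>i<n. A (p (2 * i)) (p (2 * i + 1))))"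

definition DP :: "nat list set" where
  "DP = {l. sorted_wrt (>) l \<and> (\<forall>k\<in>set l. k > 0)}"

definition augment :: "nat list \<Rightarrow> nat list" where
  "augment l = (if odd (length l) then l @ [0] else l)"

definition schur_Q :: "nat list \<Rightarrow> poly_t" where
  "schur_Q l = pfaffian (length (augment l) div 2)
     (\<lambda>i j. schur_Q2 (augment l ! i) (augment l ! j))"

definition schur_Q_at :: "nat list \<Rightarrow> (nat \<Rightarrow> complex) \<Rightarrow> complex" where
  "schur_Q_at l a = poly_eval (\<lambda>c. c) a (schur_Q l)"

definition schur_Q_2t :: "nat list \<Rightarrow> poly_t" where
  "schur_Q_2t l = poly_eval poly_const (\<lambda>k. 2 * poly_t_var k) (schur_Q l)"


section \<open>The KP and KdV hierarchies\<close>

text \<open>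
  The times \<open>t\<^sub>1, t\<^sub>2, \<dots>\<close> are the variables of index at least 1.  In the bilinear identity the
  variables \<open>Inl j\<close> and \<open>Inr j\<close> stand for \<open>t\<^sub>j\<close> and \<open>s\<^sub>j\<close>.
\<close>

abbreviation t_var :: "nat \<Rightarrow> (nat + nat) mfps" where
  "t_var j \<equiv> mfps_var (Inl j)"

abbreviation s_var :: "nat \<Rightarrow> (nat + nat) mfps" where
  "s_var j \<equiv> mfps_var (Inr j)"

text \<open>
  Series in \<open>w = z\<^sup>-\<^sup>1\<close>: the operator \<open>-\<Sum>\<^sub>j (w\<^sup>j / j) \<partial>/\<partial>s\<^sub>j\<close>, and its exponential applied to a series
  independent of \<open>w\<close>.  The operator raises the order in \<open>w\<close>, so only its powers up to the \<open>n\<close>-th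
  contribute to the coefficient of \<open>w\<^sup>n\<close>.
\<close>

definition vertex_op :: "(nat + nat) mfps fps \<Rightarrow> (nat + nat) mfps fps" where
  "vertex_op G = Abs_fps (\<lambda>n. - (\<Sum>j=1..n. mfps_const (1 / of_nat j) * mfps_deriv (Inr j) (G $ (n - j))))"

definition exp_vertex_op :: "(nat + nat) mfps \<Rightarrow> (nat + nat) mfps fps" where
  "exp_vertex_op F = Abs_fps (\<lambda>n. \<Sum>k\<le>n. mfps_const (1 / fact k) * (vertex_op ^^ k) (fps_const F) $ n)"

text \<open>
  The left-hand side of the bilinear identity.  The coefficient of \<open>z\<^sup>i\<close> in the first exponential
  contains only monomials with \<open>\<Sum>\<^sub>j j m\<^sub>j = i\<close> in the \<open>s\<^sub>j\<close>, so the sum over \<open>i\<close> is well defined.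
\<close>

definition KP_residue :: "nat mfps \<Rightarrow> (nat + nat) mfps" where
  "KP_residue \<tau> =
     (let A = exp_series mfps_const (Abs_fps (\<lambda>j. if j = 0 then 0 else 2 * s_var j));
          B = exp_vertex_op (mfps_subst (\<lambda>j. t_var j + s_var j) \<tau> *
                             mfps_subst (\<lambda>j. t_var j - s_var j) \<tau>)
      in formal_sum (\<lambda>i. A $ i * B $ (i + 1)) UNIV)"

definition KP_tau :: "nat mfps \<Rightarrow> bool" where
  "KP_tau \<tau> \<longleftrightarrow> \<tau> \<noteq> 0 \<and> depends_only_on {1..} \<tau> \<and> KP_residue \<tau> = 0"

definition KdV_tau :: "nat mfps \<Rightarrow> bool" where
  "KdV_tau \<tau> \<longleftrightarrow> KP_tau \<tau> \<and> depends_only_on {k. odd k} \<tau>"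

definition tau_term :: "(nat \<Rightarrow> complex) \<Rightarrow> nat list \<Rightarrow> nat mfps" where
  "tau_term a l = mfps_const (schur_Q_at l a) * mfps_of_poly (schur_Q_2t l)"

end

theory Submission
  imports Defs
begin

text \<open>
  The series is an exponential: by the Cauchy identity for Schur Q-functions it equals
  \<open>exp (\<Sum>\<^sub>k k a\<^sub>k t\<^sub>k)\<close>, the sum over odd \<open>k\<close>.  Hence \<open>\<tau>(t + s) \<tau>(t - s)\<close> does not depend on
  \<open>s\<close>, the vertex operator fixes it, and the residue vanishes for lack of negative powers of \<open>z\<close>.

  The Cauchy identity is obtained in the infinitesimal form \<open>\<partial>\<tau>/\<partial>t\<^sub>k = k a\<^sub>k \<tau>\<close>.  Padding odd strict
  partitions by a part 0 identifies them with the finite sets \<open>I\<close> of naturals of even size, and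
  \<open>I \<mapsto> Q\<^sub>I\<close> is a Gaussian vector \<open>exp (\<onehalf> \<Sum> Q\<^sub>i\<^sub>j \<psi>\<^sub>i \<psi>\<^sub>j)\<close> of a fermionic Fock space.  On \<open>Q(2t)\<close> the
  derivative in \<open>t\<^sub>k\<close> acts as twice an operator \<open>H\<^sub>k\<close> that is bilinear in the neutral fermions, while
  \<open>Q(a)\<close> is an eigenvector of the transpose of \<open>H\<^sub>k\<close> with eigenvalue \<open>k a\<^sub>k / 2\<close>.  Both statements
  reduce to identities for the coefficients of \<open>\<onehalf> F(z) F(w) (z - w) / (z + w)\<close> with
  \<open>F(z) F(-z) = 1\<close>.
\<close>

section \<open>Expansion of the Pfaffian along its first row\<close>

text \<open>A Gaussian vector turns each annihilation operator into a combination of creation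
  operators. An operator bilinear in fermions therefore acts on it as a scalar plus a quadratic form
  in creation operators, and such a form vanishes once its matrix is symmetric, because creations
  anticommute. This is the source of the eigenvector: the identity for products of two coefficients
  supplies the symmetry, and Newton's identity evaluates the scalar. Q(a) takes values in the
  complex numbers and Q(2t) in a ring of power series, so the fermionic part is written for
  commutative rings containing 1/2, with first-order equations in place of the exponential. The
  derivative equations are enough and need not be integrated: the bilinear identity uses nothing
  else, and the constant term 1 shows that the series is nonzero. The sum over all sets is infinite,
  but Q_I(2t) is homogeneous of weight the sum of I. A single coefficient thus sees only subsets of
  {..<N} for large N. The operators cut off at N satisfy the eigenvalue equation only on sets lying
  k below the bound, which suffices for the same reason.\<close>

definition matching_perm :: "nat \<Rightarrow> (nat \<Rightarrow> nat) \<Rightarrow> bool" where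
  "matching_perm n p \<longleftrightarrow> p permutes {..<2 * n} \<and> (\<forall>i<n. p (2 * i) < p (2 * i + 1)) \<and>
       (\<forall>i j. i < j \<and> j < n \<longrightarrow> p (2 * i) < p (2 * j))"

lemma pfaffian_alt: "pfaffian n A =
    (\<Sum>p | matching_perm n p. of_int (sign p) * (\<Prod>i<n. A (p (2 * i)) (p (2 * i + 1))))"
  by (simp add: pfaffian_def matching_perm_def)

text \<open>The increasing enumeration of the naturals other than \<open>0\<close> and \<open>Suc j\<close>.\<close>

definition skip :: "nat \<Rightarrow> nat \<Rightarrow> nat" where
  "skip j i = (if i < j then Suc i else Suc (Suc i))"

text \<open>In one-line notation: 0, then \<open>Suc j\<close>, then the other indices in increasing
  order. It is a product of \<open>j\<close> adjacent transpositions, which gives the sign in the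
  first-row expansion.\<close>

definition bring :: "nat \<Rightarrow> nat \<Rightarrow> nat" where
  "bring j x = (case x of 0 \<Rightarrow> 0 | Suc 0 \<Rightarrow> Suc j | Suc (Suc i) \<Rightarrow> skip j i)"

lemma bring_simps [simp]: "bring j 0 = 0" "bring j (Suc 0) = Suc j" "bring j (Suc (Suc i)) = skip j i"
  by (simp_all add: bring_def)

lemma skip_less_iff [simp]: "skip j i < skip j l \<longleftrightarrow> i < l"
  by (auto simp: skip_def)

lemma inj_skip: "inj_on (skip j) A"
  by (auto simp: skip_def inj_on_def split: if_splits)

lemma skip_image: assumes "j < 2 * n + 1"
  shows "skip j ` {..<2 * n} = {..<2 * Suc n} - {0, Suc j}"
proof
  show "skip j ` {..<2 * n} \<subseteq> {..<2 * Suc n} - {0, Suc j}"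
    by (auto simp: skip_def split: if_splits)
  show "{..<2 * Suc n} - {0, Suc j} \<subseteq> skip j ` {..<2 * n}"
  proof
    fix x assume x: "x \<in> {..<2 * Suc n} - {0, Suc j}"
    show "x \<in> skip j ` {..<2 * n}"
    proof (cases "x < Suc j")
      case True
      then show ?thesis
        using x assms by (intro image_eqI[of _ _ "x - 1"]) (auto simp: skip_def)
    next
      case False
      then show ?thesis
        using x assms by (intro image_eqI[of _ _ "x - 2"]) (auto simp: skip_def)
    qed
  qed
qed

lemma bring_Suc: "bring (Suc j) = transpose (Suc j) (Suc (Suc j)) \<circ> bring j"
  by (rule ext) (auto simp: bring_def skip_def transpose_def split: nat.splits)

lemma bring_0: "bring 0 = id"
  by (rule ext) (auto simp: bring_def skip_def split: nat.splits)

lemma bring_permutes: "j < m \<Longrightarrow> bring j permutes {..<Suc m}"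
proof (induction j)
  case 0
  then show ?case by (simp only: bring_0 permutes_id)
next
  case (Suc j)
  then show ?case
    unfolding bring_Suc by (intro permutes_compose permutes_swap_id) auto
qed

lemma sign_bring: "sign (bring j) = (-1) ^ j"
proof (induction j)
  case 0
  then show ?case by (simp add: bring_0)
next
  case (Suc j)
  have "permutation (bring j)"
    using bring_permutes[of j "Suc j"] permutes_imp_permutation[of "{..<Suc (Suc j)}"] by auto
  with Suc show ?case
    unfolding bring_Suc by (subst sign_compose) (auto simp: sign_swap_id permutation_swap_id)
qed

text \<open>The matching that pairs 0 with \<open>Suc j\<close> and matches the other points as
  \<open>p\<close> does, transported along \<open>skip j\<close>. Composing with
  \<open>bring j\<close> lists the new pair first.\<close>

definition extend_perm :: "nat \<Rightarrow> nat \<Rightarrow> (nat \<Rightarrow> nat) \<Rightarrow> nat \<Rightarrow> nat" where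
  "extend_perm n j p = map_permutation {..<2 * n} (skip j) p \<circ> bring j"

lemma map_permutation_skip_permutes:
  assumes "p permutes {..<2 * n}" "j < 2 * n + 1"
  shows "map_permutation {..<2 * n} (skip j) p permutes ({..<2 * Suc n} - {0, Suc j})"
  using assms by (intro map_permutation_permutes) (auto simp: bij_betw_def inj_skip skip_image)

lemma extend_perm_simps:
  assumes "p permutes {..<2 * n}" "j < 2 * n + 1"
  shows "extend_perm n j p 0 = 0" "extend_perm n j p (Suc 0) = Suc j"
        "i < 2 * n \<Longrightarrow> extend_perm n j p (Suc (Suc i)) = skip j (p i)"
proof -
  note P = map_permutation_skip_permutes[OF assms]
  show "extend_perm n j p 0 = 0" "extend_perm n j p (Suc 0) = Suc j"
    using permutes_not_in[OF P] by (auto simp: extend_perm_def)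
  show "extend_perm n j p (Suc (Suc i)) = skip j (p i)" if "i < 2 * n"
    using that assms by (simp add: extend_perm_def map_permutation_apply inj_skip)
qed

lemma extend_perm_permutes:
  assumes "p permutes {..<2 * n}" "j < 2 * n + 1"
  shows "extend_perm n j p permutes {..<2 * Suc n}"
  unfolding extend_perm_def
proof (rule permutes_compose)
  show "bring j permutes {..<2 * Suc n}"
    using bring_permutes[of j "2 * n + 1"] assms by simp
  show "map_permutation {..<2 * n} (skip j) p permutes {..<2 * Suc n}"
    using map_permutation_skip_permutes[OF assms] by (rule permutes_subset) auto
qed

lemma sign_extend_perm:
  assumes "p permutes {..<2 * n}" "j < 2 * n + 1"
  shows "sign (extend_perm n j p) = (-1) ^ j * sign p"
proof -
  have 1: "permutation (map_permutation {..<2 * n} (skip j) p)"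
    using map_permutation_skip_permutes[OF assms] permutes_imp_permutation by blast
  have 2: "permutation (bring j)"
    using bring_permutes[of j "Suc j"] permutes_imp_permutation[of "{..<Suc (Suc j)}"] by auto
  have "sign (map_permutation {..<2 * n} (skip j) p) = sign p"
    using assms by (intro sign_map_permutation inj_skip) auto
  then show ?thesis
    using 1 2 by (simp add: extend_perm_def sign_compose sign_bring)
qed

lemma all_less_Suc: "(\<forall>i<Suc n. P i) \<longleftrightarrow> P 0 \<and> (\<forall>i<n. P (Suc i))"
  using less_Suc_eq_0_disj by auto

lemma matching_perm_extend:
  assumes p: "p permutes {..<2 * n}" and j: "j < 2 * n + 1"
  shows "matching_perm (Suc n) (extend_perm n j p) \<longleftrightarrow> matching_perm n p"
proof -
  note E = extend_perm_simps[OF p j]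
  have "(\<forall>i<Suc n. extend_perm n j p (2 * i) < extend_perm n j p (2 * i + 1)) \<longleftrightarrow>
        (\<forall>i<n. p (2 * i) < p (2 * i + 1))"
    by (simp add: all_less_Suc E)
  moreover have "(\<forall>i l. i < l \<and> l < Suc n \<longrightarrow> extend_perm n j p (2 * i) < extend_perm n j p (2 * l)) \<longleftrightarrow>
        (\<forall>i l. i < l \<and> l < n \<longrightarrow> p (2 * i) < p (2 * l))" (is "?L \<longleftrightarrow> ?R")
  proof
    assume L: ?L
    show ?R
    proof (intro allI impI)
      fix i l assume il: "i < l \<and> l < n"
      with L[rule_format, of "Suc i" "Suc l"] show "p (2 * i) < p (2 * l)"
        by (simp add: E)
    qed
  next
    assume R: ?R
    show ?L
    proof (intro allI impI)
      fix i l assume il: "i < l \<and> l < Suc n"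
      then obtain l' where l': "l = Suc l'" "l' < n" by (cases l) auto
      show "extend_perm n j p (2 * i) < extend_perm n j p (2 * l)"
      proof (cases i)
        case 0
        then show ?thesis using l' by (simp add: E skip_def)
      next
        case (Suc i')
        then show ?thesis using l' il R[rule_format, of i' l'] by (simp add: E)
      qed
    qed
  qed
  ultimately show ?thesis
    using p extend_perm_permutes[OF p j] by (simp add: matching_perm_def)
qed

text \<open>The value 0 cannot be the second entry of a pair, since pairs increase, nor the first
  entry of a later pair, since first entries increase.\<close>

lemma matching_perm_0: assumes "matching_perm (Suc n) p" shows "p 0 = 0"
proof -
  have P: "p permutes {..<2 * Suc n}" using assms by (simp add: matching_perm_def)
  obtain x where x: "x < 2 * Suc n" "p x = 0"
    using permutes_image[OF P] by (metis (no_types, lifting) imageE lessThan_iff zero_less_Suc nat_0_less_mult_iff zero_less_numeral)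
  show ?thesis
  proof (cases "even x")
    case True
    then obtain i where i: "x = 2 * i" by auto
    show ?thesis
    proof (rule ccontr)
      assume "p 0 \<noteq> 0"
      then have "0 < i" using i x by (cases i) auto
      then have "p (2 * 0) < p (2 * i)" using assms i x unfolding matching_perm_def by fastforce
      then show False using i x by simp
    qed
  next
    case False
    then obtain i where i: "x = 2 * i + 1" by (auto elim: oddE)
    moreover from this x have "i < Suc n" by simp
    ultimately have "p (2 * i) < p (2 * i + 1)" using assms unfolding matching_perm_def by blast
    then show ?thesis using i x by simp
  qed
qed

text \<open>The partner of 0 determines \<open>j\<close>. Undoing \<open>bring j\<close> leaves a
  permutation fixing 0 and \<open>Suc j\<close>, which pulls back along
  \<open>skip j\<close>.\<close>

lemma extend_perm_surj:
  assumes "matching_perm (Suc n) p"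
  obtains j p' where "j < 2 * n + 1" "matching_perm n p'" "p = extend_perm n j p'"
proof -
  have P: "p permutes {..<2 * Suc n}" using assms by (simp add: matching_perm_def)
  note p0 = matching_perm_0[OF assms]
  define j where "j = p 1 - 1"
  have p1: "p 1 = Suc j"
  proof -
    have "p 1 \<noteq> p 0" using permutes_inj[OF P] by (metis inj_eq one_neq_zero)
    then show ?thesis using p0 by (simp add: j_def)
  qed
  have j: "j < 2 * n + 1"
    using permutes_in_image[OF P, of 1] p1 by auto
  define q where "q = p \<circ> inv (bring j)"
  have B: "bring j permutes {..<2 * Suc n}"
    using bring_permutes[of j "2 * n + 1"] j by simp
  have Q: "q permutes {..<2 * Suc n}"
    unfolding q_def by (intro permutes_compose P permutes_inv B)
  have pq: "p = q \<circ> bring j"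
    unfolding q_def using permutes_inv_o(2)[OF B] by (simp add: comp_assoc)
  have q0: "q 0 = 0" using fun_cong[OF pq, of 0] p0 by simp
  have q1: "q (Suc j) = Suc j" using fun_cong[OF pq, of 1] p1 by simp
  have Q': "q permutes ({..<2 * Suc n} - {0, Suc j})"
    using Q q0 q1 by (auto intro: permutes_superset)
  have bij: "bij_betw (skip j) {..<2 * n} ({..<2 * Suc n} - {0, Suc j})"
    using j by (simp add: bij_betw_def inj_skip skip_image)
  define p' where "p' = map_permutation ({..<2 * Suc n} - {0, Suc j}) (inv_into {..<2 * n} (skip j)) q"
  have p'_perm: "p' permutes {..<2 * n}"
    unfolding p'_def by (intro map_permutation_permutes Q' bij_betw_inv_into bij)
  have "map_permutation {..<2 * n} (skip j) p' = q"
    unfolding p'_def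
    apply (rule map_permutation_compose_inv[OF bij_betw_inv_into[OF bij] Q'])
    using bij by (auto simp: bij_betw_inv_into_right)
  then have "p = extend_perm n j p'"
    by (simp add: extend_perm_def pq)
  with that[OF j _ this] matching_perm_extend[OF p'_perm j] assms show ?thesis by simp
qed

lemma inj_extend_perm:
  assumes "p permutes {..<2 * n}" "j < 2 * n + 1" "p' permutes {..<2 * n}" "j' < 2 * n + 1"
    and eq: "extend_perm n j p = extend_perm n j' p'"
  shows "j = j' \<and> p = p'"
proof -
  have jj: "j = j'"
    using fun_cong[OF eq, of "Suc 0"] extend_perm_simps(2)[OF assms(1,2)] extend_perm_simps(2)[OF assms(3,4)]
    by simp
  have "p i = p' i" for i
  proof (cases "i < 2 * n")
    case True
    then have "skip j (p i) = skip j (p' i)"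
      using fun_cong[OF eq, of "Suc (Suc i)"] assms jj by (simp add: extend_perm_simps)
    then show ?thesis using inj_skip[of j UNIV] by (simp add: inj_eq)
  next
    case False
    then show ?thesis
      using assms by (simp add: permutes_not_in)
  qed
  with jj show ?thesis by auto
qed

text \<open>Choosing the partner of 0 and a matching permutation of the remaining points is a
  bijection onto the matching permutations of all points, and the sign factors accordingly.\<close>

lemma pfaffian_Suc:
  "pfaffian (Suc n) A = (\<Sum>j<2 * n + 1. (-1) ^ j * A 0 (Suc j) *
      pfaffian n (\<lambda>i l. A (skip j i) (skip j l)))"
proof -
  have fin: "finite {p. matching_perm n p}"
    by (rule finite_subset[OF _ finite_permutations[of "{..<2 * n}"]]) (auto simp: matching_perm_def)
  have P: "p permutes {..<2 * n}" if "matching_perm n p" for p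
    using that by (simp add: matching_perm_def)
  have inj: "inj_on (\<lambda>(j, p). extend_perm n j p) ({..<2 * n + 1} \<times> {p. matching_perm n p})"
  proof (rule inj_onI)
    fix x y assume xy: "x \<in> {..<2 * n + 1} \<times> {p. matching_perm n p}"
        "y \<in> {..<2 * n + 1} \<times> {p. matching_perm n p}"
      and eq: "(\<lambda>(j, p). extend_perm n j p) x = (\<lambda>(j, p). extend_perm n j p) y"
    show "x = y"
      using inj_extend_perm[of "snd x" n "fst x" "snd y" "fst y"] xy eq
      by (auto simp: case_prod_beta prod_eq_iff dest!: P)
  qed
  let ?f = "\<lambda>p. of_int (sign p) * (\<Prod>i<Suc n. A (p (2 * i)) (p (2 * i + 1)))"
  have "pfaffian (Suc n) A = (\<Sum>p | matching_perm (Suc n) p. ?f p)"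
    by (rule pfaffian_alt)
  also have "{p. matching_perm (Suc n) p} =
      (\<lambda>(j, p). extend_perm n j p) ` ({..<2 * n + 1} \<times> {p. matching_perm n p})"
    using matching_perm_extend P by (auto elim!: extend_perm_surj simp del: lessThan_Suc)
  also have "(\<Sum>p\<in>\<dots>. ?f p) =
      (\<Sum>(j, p)\<in>{..<2 * n + 1} \<times> {p. matching_perm n p}. ?f (extend_perm n j p))"
    by (subst sum.reindex[OF inj]) (simp add: case_prod_beta)
  also have "\<dots> = (\<Sum>j<2 * n + 1. \<Sum>p | matching_perm n p. ?f (extend_perm n j p))"
    by (simp add: sum.cartesian_product)
  also have "\<dots> = (\<Sum>j<2 * n + 1. (-1) ^ j * A 0 (Suc j) *
      pfaffian n (\<lambda>i l. A (skip j i) (skip j l)))"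
  proof (rule sum.cong[OF refl])
    fix j assume j: "j \<in> {..<2 * n + 1}"
    have "?f (extend_perm n j p) = (-1) ^ j * A 0 (Suc j) * (of_int (sign p) *
            (\<Prod>i<n. A (skip j (p (2 * i))) (skip j (p (2 * i + 1)))))" if p: "matching_perm n p" for p
    proof -
      note E = extend_perm_simps[OF P[OF p], of j] and S = sign_extend_perm[OF P[OF p], of j]
      have "(\<Prod>i<Suc n. A (extend_perm n j p (2 * i)) (extend_perm n j p (2 * i + 1))) =
          A 0 (Suc j) * (\<Prod>i<n. A (skip j (p (2 * i))) (skip j (p (2 * i + 1))))"
        using j by (subst prod.lessThan_Suc_shift) (simp add: E)
      then show ?thesis using j by (simp add: S mult.assoc mult.left_commute)
    qed
    then show "(\<Sum>p | matching_perm n p. ?f (extend_perm n j p)) = (-1) ^ j * A 0 (Suc j) *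
      pfaffian n (\<lambda>i l. A (skip j i) (skip j l))"
      by (simp add: pfaffian_alt sum_distrib_left)
  qed
  finally show ?thesis .
qed

lemma pfaffian_0: "pfaffian 0 A = 1"
proof -
  have "{p. matching_perm 0 p} = {id}"
    by (auto simp: matching_perm_def)
  then show ?thesis by (simp add: pfaffian_alt)
qed

section \<open>Fermions on functions of finite sets\<close>

text \<open>
  A set stands for the wedge product of its elements in decreasing order, and a function for the
  vector of its coefficients.  So creation \<open>cr\<close> removes an element from the argument and
  annihilation \<open>an\<close> inserts one.
\<close>

definition sg :: "nat \<Rightarrow> nat set \<Rightarrow> 'r::comm_ring_1" where
  "sg i I = (-1) ^ card {j \<in> I. i < j}"

definition cr :: "nat \<Rightarrow> (nat set \<Rightarrow> 'r) \<Rightarrow> nat set \<Rightarrow> 'r::comm_ring_1" where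
  "cr i f I = (if i \<in> I then sg i I * f (I - {i}) else 0)"

definition an :: "nat \<Rightarrow> (nat set \<Rightarrow> 'r) \<Rightarrow> nat set \<Rightarrow> 'r::comm_ring_1" where
  "an i f I = (if i \<in> I then 0 else sg i I * f (insert i I))"

lemma sg_sg [simp]: "sg i I * sg i I = 1"
  unfolding sg_def by (metis minus_one_mult_self)

lemma sg_sg_left [simp]: "sg i I * (sg i I * x) = x"
  by (simp add: mult.assoc[symmetric])

lemma sg_insert:
  assumes "finite I" "j \<notin> I"
  shows "sg i (insert j I) = (if i < j then - sg i I else sg i I)"
proof -
  have "{x \<in> insert j I. i < x} = (if i < j then insert j {x \<in> I. i < x} else {x \<in> I. i < x})"
    by auto
  with assms show ?thesis by (simp add: sg_def)
qed

lemma sg_remove: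
  assumes "finite I" "j \<in> I"
  shows "sg i (I - {j}) = (if i < j then - sg i I else sg i I)"
proof -
  have "sg i I = (if i < j then - sg i (I - {j}) else sg i (I - {j}) :: 'a)"
    using sg_insert[of "I - {j}" j i] assms by (simp add: insert_absorb)
  then show ?thesis by simp
qed

lemma sg_top: "I \<subseteq> {..<m} \<Longrightarrow> sg m I = 1"
proof -
  assume "I \<subseteq> {..<m}"
  then have *: "{j \<in> I. m < j} = {}" by auto
  show ?thesis unfolding sg_def * by simp
qed

text \<open>With \<open>cr_cr\<close> and \<open>an_an\<close>, these are the canonical
  anticommutation relations. Finiteness is essential: \<open>card\<close> is 0 on infinite sets,
  where \<open>sg\<close> would lose its signs.\<close>

lemma an_cr:
  assumes "finite I"
  shows "an i (cr j f) I = (if i = j then f I else 0) - cr j (an i f) I"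
proof (cases "i = j")
  case True
  then show ?thesis
    by (auto simp: an_def cr_def insert_absorb sg_insert sg_remove assms)
next
  case False
  then have "insert i I - {j} = insert i (I - {j})" by auto
  with False show ?thesis
    using assms by (auto simp: an_def cr_def sg_insert sg_remove not_less)
qed

lemma cr_cr:
  assumes "finite I"
  shows "cr i (cr j f) I = - cr j (cr i f) I"
proof (cases "i = j")
  case False
  moreover have "I - {i} - {j} = I - {j} - {i}" by blast
  ultimately show ?thesis
    using assms by (auto simp: cr_def sg_remove)
qed (auto simp: cr_def)

lemma an_an:
  assumes "finite I"
  shows "an i (an j f) I = - an j (an i f) I"
proof (cases "i = j")
  case False
  then show ?thesis
    using assms by (auto simp: an_def sg_insert insert_commute)
qed (auto simp: an_def)

lemma cr_sum: "cr i (\<lambda>I. \<Sum>x\<in>X. c x * f x I) I = (\<Sum>x\<in>X. c x * cr i (f x) I)"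
  by (simp add: cr_def sum_distrib_left mult.left_commute)

lemma an_sum: "an i (\<lambda>I. \<Sum>x\<in>X. c x * f x I) I = (\<Sum>x\<in>X. c x * an i (f x) I)"
  by (simp add: an_def sum_distrib_left mult.left_commute)

lemma cr_cong: "(i \<in> I \<Longrightarrow> f (I - {i}) = g (I - {i})) \<Longrightarrow> cr i f I = cr i g I"
  by (simp add: cr_def)

lemma an_cong: "(i \<notin> I \<Longrightarrow> f (insert i I) = g (insert i I)) \<Longrightarrow> an i f I = an i g I"
  by (simp add: an_def)

text \<open>Inserting \<open>j\<close> matches the subsets without \<open>j\<close> to those with
  it; \<open>sg j\<close> counts only elements above \<open>j\<close>, so it agrees on both. The
  bound on \<open>j\<close> keeps the insertion inside the power set.\<close>

lemma cr_adjoint: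
  assumes "j < N"
  shows "(\<Sum>I\<in>Pow {..<N}. f I * cr j g I) = (\<Sum>I\<in>Pow {..<N}. an j f I * g I)"
proof -
  have "(\<Sum>I\<in>Pow {..<N}. f I * cr j g I) =
        (\<Sum>I\<in>{I \<in> Pow {..<N}. j \<in> I}. f I * (sg j I * g (I - {j})))"
    by (rule sum.mono_neutral_cong_right) (auto simp: cr_def)
  also have "\<dots> = (\<Sum>I\<in>{I \<in> Pow {..<N}. j \<notin> I}. sg j I * f (insert j I) * g I)"
    by (rule sum.reindex_bij_witness[where i = "insert j" and j = "\<lambda>I. I - {j}"])
       (use assms in \<open>auto simp: insert_absorb sg_remove finite_subset\<close>)
  also have "\<dots> = (\<Sum>I\<in>Pow {..<N}. an j f I * g I)"
    by (rule sum.mono_neutral_cong_left) (auto simp: an_def)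
  finally show ?thesis .
qed

text \<open>Exchanging the indices preserves \<open>W\<close> and negates the product of two
  creations, so the sum equals its own negative.\<close>

lemma symmetric_cr_cr_sum:
  fixes half :: "'r::comm_ring_1" and W :: "nat \<Rightarrow> nat \<Rightarrow> 'r"
  assumes "2 * half = 1" and fin: "finite I" and W: "\<And>j l. W j l = W l j"
  shows "(\<Sum>j<N. \<Sum>l<N. W j l * cr j (cr l f) I) = 0"
proof -
  define X where "X = (\<Sum>j<N. \<Sum>l<N. W j l * cr j (cr l f) I)"
  have "X = (\<Sum>l<N. \<Sum>j<N. W j l * cr j (cr l f) I)"
    unfolding X_def by (rule sum.swap)
  also have "\<dots> = - X"
    unfolding X_def sum_negf[symmetric]
  proof (intro sum.cong refl)
    fix j l
    show "W j l * cr j (cr l f) I = - (W l j * cr l (cr j f) I)"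
      by (subst cr_cr[OF fin], subst W) simp
  qed
  finally have "X = - X" .
  then have "X + X = 0" by (metis add.right_inverse)
  then have "X * (2 * half) = 0" by (metis mult.assoc mult.commute mult_2 mult_zero_left)
  then show ?thesis using assms by (simp add: X_def)
qed

text \<open>
  The first-order equations satisfied by \<open>exp (\<onehalf> \<Sum> A i j \<psi>\<^sub>i \<psi>\<^sub>j)\<close>.  The bound \<open>N\<close> only truncates the
  sum, whose terms vanish for \<open>j \<notin> I\<close>.
\<close>

definition gaussian :: "nat \<Rightarrow> (nat \<Rightarrow> nat \<Rightarrow> 'r) \<Rightarrow> (nat set \<Rightarrow> 'r::comm_ring_1) \<Rightarrow> bool" where
  "gaussian N A v \<longleftrightarrow> v {} = 1 \<and>
     (\<forall>i I. I \<subseteq> {..<N} \<longrightarrow> an i v I = (\<Sum>j<N. A i j * cr j v I))"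

lemma gaussianD:
  assumes "gaussian N A v" "I \<subseteq> {..<N}"
  shows "an i v I = (\<Sum>j<N. A i j * cr j v I)"
  using assms by (simp add: gaussian_def)

text \<open>The assumption \<open>top\<close> is a row expansion along the largest element, that is,
  the Gaussian equation for an index above all of \<open>I\<close>. The anticommutation relations
  carry it to every other index, by induction on the size of \<open>I\<close>.\<close>

lemma gaussianI:
  fixes v :: "nat set \<Rightarrow> 'r::comm_ring_1" and half :: 'r
  assumes half: "2 * half = 1"
    and skew: "\<And>i j. A i j = - A j i" and diag: "\<And>i. A i i = 0"
    and v0: "v {} = 1"
    and top: "\<And>m J. J \<subseteq> {..<m} \<Longrightarrow> v (insert m J) = (\<Sum>x\<in>J. sg x J * A m x * v (J - {x}))"
  shows "gaussian N A v"
  unfolding gaussian_def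
proof (intro conjI allI impI)
  show "v {} = 1" by (rule v0)
  have top': "an m v J = (\<Sum>j<N. A m j * cr j v J)" if "J \<subseteq> {..<m}" "J \<subseteq> {..<N}" for m J
  proof -
    have 1: "sg m J = (1 :: 'r)" "m \<notin> J" using that by (auto simp: sg_top)
    have "an m v J = (\<Sum>j\<in>J. A m j * cr j v J)"
      using 1 by (simp add: an_def cr_def top[OF that(1)] mult_ac)
    also have "\<dots> = (\<Sum>j<N. A m j * cr j v J)"
      using that by (intro sum.mono_neutral_left) (auto simp: cr_def)
    finally show ?thesis .
  qed
  fix i I
  assume "I \<subseteq> {..<N}"
  then show "an i v I = (\<Sum>j<N. A i j * cr j v I)"
  proof (induction "card I" arbitrary: i I rule: less_induct)
    case less
    have fin: "finite I" using less.prems finite_subset by blast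
    show ?case
    proof (cases "i \<in> I")
      case True
      define K where "K = I - {i}"
      have K: "I = insert i K" "i \<notin> K" "finite K" "K \<subseteq> {..<N}"
        using True fin less.prems by (auto simp: K_def)
      have "card K < card I" using K by simp
      then have cK: "card (K - {j}) < card I" for j by (rule order.strict_trans1[OF card_Diff1_le])
      have IH: "an i v (K - {j}) = (\<Sum>l<N. A i l * cr l v (K - {j}))" for j
        by (rule less.hyps[OF cK]) (use K in auto)
      have crIH: "cr j (an i v) K = cr j (\<lambda>I. \<Sum>l<N. A i l * cr l v I) K" for j
        by (rule cr_cong) (rule IH)
      \<comment> \<open>Values at \<open>I\<close> become annihilations at \<open>K\<close>, so the
        anticommutation relation can move \<open>an i\<close> past the creations. Its contraction
        has the coefficient \<open>A i i = 0\<close>, and what remains is a symmetric double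
        sum.\<close>
      have eqI: "f I = sg i K * an i f K" for f :: "nat set \<Rightarrow> 'r"
        using K(1,2) by (simp add: an_def)
      define X where "X = (\<Sum>j<N. \<Sum>l<N. A i j * A i l * cr j (cr l v) K)"
      have X0: "X = 0"
        unfolding X_def by (rule symmetric_cr_cr_sum[OF half K(3)]) simp
      have "(\<Sum>j<N. A i j * cr j v I) = (\<Sum>j<N. A i j * (sg i K * an i (cr j v) K))"
        by (rule sum.cong) (simp_all add: an_def K)
      also have "\<dots> = (\<Sum>j<N. - (sg i K * (A i j * cr j (an i v) K)))"
        using diag by (intro sum.cong) (auto simp: an_cr[OF K(3)] algebra_simps)
      also have "\<dots> = - sg i K * (\<Sum>j<N. A i j * cr j (\<lambda>I. \<Sum>l<N. A i l * cr l v I) K)"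
        by (simp add: sum_negf sum_distrib_left crIH)
      also have "\<dots> = - sg i K * X"
        by (simp add: cr_sum X_def sum_distrib_left mult.assoc)
      finally show ?thesis using X0 True by (simp add: an_def)
    next
      case False
      show ?thesis
      proof (cases "I \<subseteq> {..<i}")
        case True
        then show ?thesis using top' less.prems by blast
      next
        case nt: False
        \<comment> \<open>Now \<open>i\<close> lies below the maximum. Writing values at
          \<open>I\<close> as \<open>an m\<close> at \<open>K\<close> and exchanging
          \<open>an m\<close> with \<open>an i\<close> makes the known equation for \<open>m\<close>
          applicable at \<open>insert i K\<close>. Both sides become \<open>A i m * v K\<close> plus
          the same double sum.\<close>
        define m where "m = Max I"
        define K where "K = I - {m}"
        from nt have ne: "I \<noteq> {}" by auto
        have m: "m \<in> I" unfolding m_def using fin ne by (rule Max_in)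
        have Im: "x \<le> m" if "x \<in> I" for x using that fin by (simp add: m_def)
        obtain x where x: "x \<in> I" "i \<le> x" using nt by (metis lessThan_iff linorder_not_le subsetI)
        then have "i \<noteq> x" using False by auto
        with x Im[of x] have im: "i < m" by simp
        have K: "I = insert m K" "m \<notin> K" "finite K" "K \<subseteq> {..<N}" "i \<notin> K"
          using m fin less.prems False unfolding K_def by blast+
        have Km: "K \<subseteq> {..<m}"
        proof
          fix y assume "y \<in> K"
          then have "y \<in> I" "y \<noteq> m" by (auto simp: K_def)
          then show "y \<in> {..<m}" using Im[of y] by simp
        qed
        have sgm: "sg m K = (1 :: 'r)" using Km by (rule sg_top)
        have anm: "an m f K = f I" for f :: "nat set \<Rightarrow> 'r"
          using K(1,2) sgm by (simp add: an_def)
        have "card K < card I" using K by simp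
        then have cK: "card (K - {j}) < card I" for j by (rule order.strict_trans1[OF card_Diff1_le])
        have IH: "an i v (K - {j}) = (\<Sum>l<N. A i l * cr l v (K - {j}))" for j
          by (rule less.hyps[OF cK]) (use K in auto)
        have crIH: "cr j (an i v) K = cr j (\<lambda>I. \<Sum>l<N. A i l * cr l v I) K" for j
          by (rule cr_cong) (rule IH)
        have topi: "an m v (insert i K) = (\<Sum>j<N. A m j * cr j v (insert i K))" if "i < N"
          using top'[of "insert i K" m] that K(4) Km im by simp
        have iN: "i < N" using im m less.prems by auto
        have topK: "an m v (K - {l}) = (\<Sum>j<N. A m j * cr j v (K - {l}))" for l
          by (rule top') (use K(4) Km in blast)+
        have crtop: "cr l (an m v) K = cr l (\<lambda>I. \<Sum>j<N. A m j * cr j v I) K" for l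
          by (rule cr_cong) (rule topK)
        have "an i v I = an m (an i v) K" by (simp add: anm)
        also have "\<dots> = - an i (an m v) K" by (rule an_an) (rule K)
        also have "\<dots> = - an i (\<lambda>I. \<Sum>j<N. A m j * cr j v I) K"
          by (rule arg_cong[of _ _ uminus], rule an_cong, rule topi[OF iN])
        also have "\<dots> = - (\<Sum>j<N. A m j * (if i = j then v K else 0)) +
                            (\<Sum>j<N. A m j * cr j (an i v) K)"
          by (simp add: an_sum an_cr[OF K(3)] right_diff_distrib sum_subtractf)
        also have "(\<Sum>j<N. A m j * (if i = j then v K else 0)) = A m i * v K"
          using iN by (simp add: if_distrib cong: if_cong)
        also have "(\<Sum>j<N. A m j * cr j (an i v) K) = (\<Sum>j<N. A m j * cr j (\<lambda>I. \<Sum>l<N. A i l * cr l v I) K)"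
          by (simp add: crIH)
        also have "\<dots> = (\<Sum>j<N. \<Sum>l<N. A m j * A i l * cr j (cr l v) K)"
          by (simp add: cr_sum sum_distrib_left mult.assoc)
        finally have L: "an i v I = - (A m i * v K) + (\<Sum>j<N. \<Sum>l<N. A m j * A i l * cr j (cr l v) K)" .
        have mN: "m < N" using m less.prems by auto
        have "(\<Sum>l<N. A i l * cr l v I) = (\<Sum>l<N. A i l * an m (cr l v) K)"
          by (simp add: anm)
        also have "\<dots> = (\<Sum>l<N. A i l * (if m = l then v K else 0)) - (\<Sum>l<N. A i l * cr l (an m v) K)"
          by (simp add: an_cr[OF K(3)] right_diff_distrib sum_subtractf)
        also have "(\<Sum>l<N. A i l * (if m = l then v K else 0)) = A i m * v K"
          using mN by (simp add: if_distrib cong: if_cong)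
        also have "(\<Sum>l<N. A i l * cr l (an m v) K) = (\<Sum>l<N. A i l * cr l (\<lambda>I. \<Sum>j<N. A m j * cr j v I) K)"
          by (simp add: crtop)
        also have "\<dots> = (\<Sum>l<N. \<Sum>j<N. A i l * A m j * cr l (cr j v) K)"
          by (simp add: cr_sum sum_distrib_left mult.assoc)
        also have "\<dots> = (\<Sum>j<N. \<Sum>l<N. A i l * A m j * cr l (cr j v) K)"
          by (rule sum.swap)
        also have "\<dots> = (\<Sum>j<N. \<Sum>l<N. - (A m j * A i l * cr j (cr l v) K))"
        proof (intro sum.cong refl)
          fix j l
          show "A i l * A m j * cr l (cr j v) K = - (A m j * A i l * cr j (cr l v) K)"
            using cr_cr[OF K(3), of l j v] by simp
        qed
        finally show ?thesis
          using skew[of i m] by (simp add: L sum_negf)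
      qed
    qed
  qed
qed

text \<open>Formally, \<open>D\<close> brings down half the quadratic form of \<open>D A\<close>
  from the exponent, and as creations anticommute, half of \<open>M\<close> minus its transpose may
  be replaced by \<open>M\<close>. Leaving \<open>M\<close> free of symmetry conditions allows a
  choice shaped like \<open>lower\<close>.\<close>

lemma gaussian_derivation:
  fixes v :: "nat set \<Rightarrow> 'r::comm_ring_1"
  assumes G: "gaussian N A v"
    and D_add: "\<And>x y. D (x + y) = D x + D y" and D_mult: "\<And>x y. D (x * y) = D x * y + x * D y"
    and DA: "\<And>i j. D (A i j) = M i j - M j i"
    and I: "I \<subseteq> {..<N}"
  shows "D (v I) = (\<Sum>i<N. \<Sum>l<N. M i l * cr i (cr l v) I)"
proof -
  have D0: "D 0 = 0" using D_add[of 0 0] by simp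
  have D1: "D 1 = 0" using D_mult[of 1 1] by simp
  have D_sum: "D (sum f X) = (\<Sum>x\<in>X. D (f x))" for f :: "nat \<Rightarrow> 'r" and X
    by (induction X rule: infinite_finite_induct) (simp_all add: D0 D_add)
  have Dm1: "D (- 1) = 0"
    using D_add[of 1 "-1"] D0 D1 by simp
  have Dsg: "D (sg i J * x) = sg i J * D x" for i J x
  proof -
    have "D ((-1) ^ n) = 0" for n
    proof (induction n)
      case (Suc n)
      then show ?case using D_mult[of "-1" "(-1) ^ n"] Dm1 by simp
    qed (simp add: D1)
    then show ?thesis by (simp add: D_mult sg_def)
  qed
  have Dcr: "D (cr j v J) = cr j (\<lambda>I. D (v I)) J" for j J
    by (simp add: cr_def Dsg D0)
  show ?thesis
    using I
  proof (induction "card I" arbitrary: I rule: less_induct)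
    case less
    have fin: "finite I" using less.prems finite_subset by blast
    show ?case
    proof (cases "I = {}")
      case True
      then show ?thesis using G by (simp add: gaussian_def cr_def D1)
    next
      case False
      then obtain a where a: "a \<in> I" by auto
      define J where "J = I - {a}"
      have J: "I = insert a J" "a \<notin> J" "finite J" "J \<subseteq> {..<N}" "a < N"
        using a fin less.prems by (auto simp: J_def)
      have eq: "f I = sg a J * an a f J" for f :: "nat set \<Rightarrow> 'r"
        using J by (simp add: an_def)
      have "card J < card I" using J by simp
      then have cJ: "card (J - {j}) < card I" for j by (rule order.strict_trans1[OF card_Diff1_le])
      have IH: "D (v (J - {j})) = (\<Sum>i<N. \<Sum>l<N. M i l * cr i (cr l v) (J - {j}))" for j
        by (rule less.hyps[OF cJ]) (use J in auto)
      let ?Q = "\<lambda>I. \<Sum>i<N. \<Sum>l<N. M i l * cr i (cr l v) I"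
      have crQ: "cr j ?Q J = (\<Sum>i<N. \<Sum>l<N. M i l * cr j (cr i (cr l v)) J)" for j
        by (simp add: cr_def sum_distrib_left mult.left_commute)
      have "D (v I) = sg a J * D (an a v J)"
        by (simp add: eq[of v] Dsg)
      also have "D (an a v J) = (\<Sum>j<N. (M a j - M j a) * cr j v J) + (\<Sum>j<N. A a j * cr j (\<lambda>I. D (v I)) J)"
        by (simp add: gaussianD[OF G J(4)] D_sum D_mult DA Dcr sum.distrib)
      also have "(\<Sum>j<N. A a j * cr j (\<lambda>I. D (v I)) J) = (\<Sum>j<N. A a j * cr j ?Q J)"
        by (intro sum.cong refl arg_cong2[of _ _ _ _ "(*)"] cr_cong IH)
      also have "(\<Sum>j<N. (M a j - M j a) * cr j v J) + (\<Sum>j<N. A a j * cr j ?Q J) = an a ?Q J"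
      proof -
        \<comment> \<open>Passing \<open>an a\<close> through two creations leaves two contractions
          and the term with \<open>an a v\<close>. There the Gaussian equation produces a new
          creation, which moves to the front past two others without a sign.\<close>
        have E: "an a (cr i (cr l v)) J = (if i = a then cr l v J else 0) - (if l = a then cr i v J else 0)
            + (\<Sum>j<N. A a j * cr j (cr i (cr l v)) J)" for i l
        proof -
          have "cr i (an a (cr l v)) J = cr i (\<lambda>I. (if l = a then v I else 0) - cr l (an a v) I) J"
            by (rule cr_cong) (simp add: an_cr J)
          also have "\<dots> = (if l = a then cr i v J else 0) - cr i (cr l (an a v)) J"
            by (simp add: cr_def algebra_simps)
          also have "cr i (cr l (an a v)) J = cr i (cr l (\<lambda>I. \<Sum>j<N. A a j * cr j v I)) J"
            using J(4) by (intro cr_cong gaussianD[OF G]) auto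
          also have "\<dots> = (\<Sum>j<N. A a j * cr i (cr l (cr j v)) J)"
            by (cases "i \<in> J"; cases "l \<in> J - {i}")
              (simp_all only: cr_def if_True if_False sum_distrib_left mult.left_commute mult_zero_right sum.neutral_const)
          also have "\<dots> = (\<Sum>j<N. A a j * cr j (cr i (cr l v)) J)"
          proof (intro sum.cong refl arg_cong2[of _ _ _ _ "(*)"])
            fix j
            have "cr i (cr l (cr j v)) J = cr i (\<lambda>I. - cr j (cr l v) I) J"
              by (rule cr_cong) (simp add: cr_cr[of _ l j] J)
            also have "\<dots> = - cr i (cr j (cr l v)) J" by (simp add: cr_def)
            also have "\<dots> = cr j (cr i (cr l v)) J" using cr_cr[OF J(3), of i j "cr l v"] by simp
            finally show "cr i (cr l (cr j v)) J = cr j (cr i (cr l v)) J" .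
          qed
          finally show ?thesis by (simp add: an_cr[OF J(3)])
        qed
        have "an a ?Q J = (\<Sum>i<N. \<Sum>l<N. M i l * an a (cr i (cr l v)) J)"
          by (simp add: an_def sum_distrib_left mult.left_commute)
        also have "\<dots> = (\<Sum>i<N. \<Sum>l<N. M i l * (if i = a then cr l v J else 0))
            - (\<Sum>i<N. \<Sum>l<N. M i l * (if l = a then cr i v J else 0))
            + (\<Sum>i<N. \<Sum>l<N. \<Sum>j<N. M i l * (A a j * cr j (cr i (cr l v)) J))"
          by (simp add: E algebra_simps sum.distrib sum_subtractf sum_distrib_left)
        also have "(\<Sum>i<N. \<Sum>l<N. M i l * (if i = a then cr l v J else 0)) = (\<Sum>l<N. M a l * cr l v J)"
          by (subst sum.swap) (use J in \<open>simp add: if_distrib cong: if_cong\<close>)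
        also have "(\<Sum>i<N. \<Sum>l<N. M i l * (if l = a then cr i v J else 0)) = (\<Sum>i<N. M i a * cr i v J)"
          using J by (simp add: if_distrib cong: if_cong)
        also have "(\<Sum>i<N. \<Sum>l<N. \<Sum>j<N. M i l * (A a j * cr j (cr i (cr l v)) J)) =
            (\<Sum>j<N. \<Sum>i<N. \<Sum>l<N. M i l * (A a j * cr j (cr i (cr l v)) J))"
          by (subst sum.swap[of _ "{..<N}", symmetric]) (intro sum.cong refl sum.swap)
        also have "\<dots> = (\<Sum>j<N. A a j * cr j ?Q J)"
          by (simp add: crQ sum_distrib_left mult.left_commute)
        finally show ?thesis by (simp add: left_diff_distrib sum_subtractf)
      qed
      finally show ?thesis by (simp add: eq[of ?Q])
    qed
  qed
qed

section \<open>The two-index coefficients over the integers\<close>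

definition par :: "int \<Rightarrow> 'r::comm_ring_1" where
  "par n = (if even n then 1 else - 1)"

lemma par_add: "par (m + n) = par m * par n"
  by (auto simp: par_def)

lemma par_diff: "par (m - n) = par m * par n"
  by (auto simp: par_def)

lemma par_of_nat: "par (int n) = (-1) ^ n"
  by (simp add: par_def)

lemma par_0 [simp]: "par 0 = 1"
  by (simp add: par_def)

lemma par_par [simp]: "par n * par n = 1"
  by (simp add: par_def)

lemma par_par_left [simp]: "par n * (par n * x) = x"
  by (simp add: par_def)

text \<open>The coefficients of a series F with F(z) F(-z) = 1, together with \<open>h\<close> as
  1/2.\<close>

locale q_sequence =
  fixes q :: "nat \<Rightarrow> 'r::comm_ring_1" and h :: 'r
  assumes q_0: "q 0 = 1" and half: "2 * h = 1"
    and q_inverse: "\<And>n. n > 0 \<Longrightarrow> (\<Sum>i\<le>n. (-1) ^ i * q i * q (n - i)) = 0"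
begin

definition qz :: "int \<Rightarrow> 'r" where
  "qz n = (if n < 0 then 0 else q (nat n))"

definition wt :: "nat \<Rightarrow> 'r" where
  "wt p = (if p = 0 then h else (-1) ^ p)"

text \<open>
  The coefficient of \<open>z\<^sup>i w\<^sup>j\<close> in \<open>\<onehalf> F(z) F(w) (z - w) / (z + w)\<close>, expanded for \<open>\<bar>w\<bar> < \<bar>z\<bar>\<close>.
\<close>

definition G :: "int \<Rightarrow> int \<Rightarrow> 'r" where
  "G i j = (\<Sum>p\<le>nat j. wt p * qz (i + int p) * qz (j - int p))"

text \<open>The terms, indexed by \<open>n\<close>, of the coefficient of z^s in F(-z) F(z).\<close>

definition r :: "int \<Rightarrow> int \<Rightarrow> 'r" where
  "r s n = par n * qz n * qz (s - n)"

lemma qz_neg [simp]: "n < 0 \<Longrightarrow> qz n = 0"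
  and qz_of_nat [simp]: "qz (int m) = q m"
  by (simp_all add: qz_def)

lemma qz_diff: "i \<le> m \<Longrightarrow> qz (int m - int i) = q (m - i)"
  by (metis of_nat_diff qz_of_nat)

lemma qz_0 [simp]: "qz 0 = 1"
  by (simp add: qz_def q_0)

lemma r_sum:
  assumes "a \<le> 0" "s \<le> b"
  shows "(\<Sum>n=a..b. r s n) = (if s = 0 then 1 else 0)"
proof -
  have "(\<Sum>n=a..b. r s n) = (\<Sum>n=0..s. r s n)"
  proof (cases "s < 0")
    case True
    then have "r s n = 0" for n by (cases "n < 0") (simp_all add: r_def)
    then show ?thesis by simp
  next
    case False
    then show ?thesis
      using assms by (intro sum.mono_neutral_right) (auto simp: r_def not_le)
  qed
  also have "\<dots> = (if s = 0 then 1 else 0)"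
  proof (cases "s < 0")
    case True
    then show ?thesis by simp
  next
    case False
    then obtain m where m: "s = int m" by (metis not_less nonneg_int_cases)
    have "(\<Sum>n=0..s. r s n) = (\<Sum>i\<le>m. (-1) ^ i * q i * q (m - i))"
    proof (rule sum.reindex_bij_witness[where i = int and j = nat])
      fix n assume "n \<in> {0..s}"
      then obtain i where ni: "n = int i" "i \<le> m" using m by (metis atLeastAtMost_iff nonneg_int_cases of_nat_le_iff)
      show "(-1) ^ nat n * q (nat n) * q (m - nat n) = r s n"
      proof -
        show ?thesis using ni m by (simp add: r_def par_of_nat qz_diff)
      qed
    qed (use m in auto)
    then show ?thesis using q_inverse[of m] m by (auto simp: q_0)
  qed
  finally show ?thesis .
qed

lemma r_flip: "r s (s - n) = par s * r s n"
  by (simp add: r_def par_diff mult_ac)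

lemma G_bound:
  assumes "nat j \<le> P"
  shows "G i j = (\<Sum>p\<le>P. wt p * qz (i + int p) * qz (j - int p))"
  unfolding G_def
proof (rule sum.mono_neutral_left)
  show "\<forall>p\<in>{..P} - {..nat j}. wt p * qz (i + int p) * qz (j - int p) = 0"
  proof
    fix p assume "p \<in> {..P} - {..nat j}"
    then have "j - int p < 0" by auto
    then show "wt p * qz (i + int p) * qz (j - int p) = 0" by simp
  qed
qed (use assms in auto)

lemma G_neg_right: "j < 0 \<Longrightarrow> G i j = 0"
  by (simp add: G_def)

lemma G_0_right: "G i 0 = h * qz i"
  by (simp add: G_def wt_def)

text \<open>Setting n = j - p turns \<open>G\<close> into a partial sum of \<open>r (i + j)\<close>
  whose last term has weight 1/2. Terms at negative \<open>n\<close> vanish; the free lower limit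
  lets \<open>G i j\<close> and \<open>G j i\<close> be compared over a common range.\<close>

lemma G_eq_r:
  assumes "a \<le> 0"
  shows "G i j = par j * (h * r (i + j) j + (\<Sum>n=a..<j. r (i + j) n))"
proof (cases "j < 0")
  case True
  then have "(\<Sum>n=a..<j. r (i + j) n) = 0"
    by (intro sum.neutral) (auto simp: r_def)
  with True show ?thesis by (simp add: G_neg_right r_def)
next
  case False
  then obtain b where b: "j = int b" by (metis not_less nonneg_int_cases)
  have "(\<Sum>n=a..<j. r (i + j) n) = (\<Sum>n=0..<j. r (i + j) n)"
    using assms by (intro sum.mono_neutral_right) (auto simp: r_def)
  also have "\<dots> = (\<Sum>p<b. par j * (wt (Suc p) * qz (i + int (Suc p)) * qz (j - int (Suc p))))"
  proof (rule sum.reindex_bij_witness[where i = "\<lambda>p. int (b - Suc p)" and j = "\<lambda>n. b - Suc (nat n)"])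
    fix n assume "n \<in> {0..<j}"
    then obtain m where m: "n = int m" "m < b"
      using b by (metis atLeastLessThan_iff nonneg_int_cases of_nat_less_iff)
    define p where "p = b - Suc m"
    have bm: "b = m + Suc p" using m by (simp add: p_def)
    have 1: "b - Suc (nat n) = p" by (simp add: p_def m(1))
    have 1: "b - Suc (nat n) = p" "j - int (Suc p) = int m" "i + j - int m = i + int (Suc p)"
      using b bm 1 by simp_all
    have 2: "(-1) ^ b * (-1) ^ Suc p = ((-1) ^ m :: 'r)"
      unfolding bm by (cases "even m"; cases "even p") auto
    have "par j * (wt (Suc p) * qz (i + int (Suc p)) * qz (j - int (Suc p))) =
          ((-1) ^ b * (-1) ^ Suc p) * (qz (i + int (Suc p)) * q m)"
      unfolding 1 by (simp add: wt_def b par_of_nat mult.assoc del: of_nat_Suc power_Suc)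
    also have "\<dots> = r (i + j) n"
      unfolding 2 by (simp add: r_def m(1) 1(3) par_of_nat mult_ac del: of_nat_Suc)
    finally show "par j * (wt (Suc (b - Suc (nat n))) * qz (i + int (Suc (b - Suc (nat n)))) * qz (j - int (Suc (b - Suc (nat n))))) =
          r (i + j) n" unfolding 1(1) .
  qed (use b in auto)
  also have "\<dots> = par j * (\<Sum>p<b. wt (Suc p) * qz (i + int (Suc p)) * qz (j - int (Suc p)))"
    by (simp add: sum_distrib_left)
  finally have S: "(\<Sum>n=a..<j. r (i + j) n) =
      par j * (\<Sum>p<b. wt (Suc p) * qz (i + int (Suc p)) * qz (j - int (Suc p)))" .
  have "G i j = h * qz i * qz j + (\<Sum>p<b. wt (Suc p) * qz (i + int (Suc p)) * qz (j - int (Suc p)))"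
    by (simp add: G_def b sum.atMost_shift wt_def)
  moreover have "h * r (i + j) j = par j * (h * qz i * qz j)"
    by (simp add: r_def mult_ac)
  ultimately show ?thesis
    unfolding S by (simp only: distrib_left[symmetric] par_par_left)
qed

text \<open>The function (z - w) / (z + w) is antisymmetric, but exchanging z and w also exchanges
  the regions of expansion. The two expansions differ by a delta function at z = -w, where F(z) F(w)
  = 1. In terms of \<open>r\<close>, two complementary partial sums add up to the full sum.\<close>

lemma G_skew: "G i j + G j i = (if i + j = 0 then par i else 0)"
proof -
  define s where "s = i + j"
  \<comment> \<open>The interval from \<open>a\<close> to \<open>s - a\<close> contains the support
    of \<open>r s\<close> and is preserved by the reflection of \<open>n\<close> to
    \<open>s - n\<close>.\<close>
  define a where "a = - (\<bar>i\<bar> + \<bar>j\<bar>)"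
  have a: "a \<le> 0" "a \<le> j" "a \<le> i" "j \<le> s - a" "s \<le> s - a" by (auto simp: a_def s_def)
  have i: "i = s - j" by (simp add: s_def)
  have 1: "G i j = par j * (h * r s j + (\<Sum>n=a..<j. r s n))"
    using G_eq_r[OF a(1), of i j] by (simp add: s_def)
  have "(\<Sum>n=a..<i. r s n) = (\<Sum>n=j+1..s-a. r s (s - n))"
    by (rule sum.reindex_bij_witness[where i = "\<lambda>n. s - n" and j = "\<lambda>n. s - n"])
      (auto simp: s_def)
  also have "\<dots> = par s * (\<Sum>n=j+1..s-a. r s n)"
    by (simp add: r_flip sum_distrib_left)
  finally have "G j i = par i * (h * r s i + par s * (\<Sum>n=j+1..s-a. r s n))"
    using G_eq_r[OF a(1), of j i] by (simp add: s_def add.commute)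
  also have "r s i = par s * r s j"
    unfolding i by (rule r_flip)
  finally have 2: "G j i = par i * par s * (h * r s j + (\<Sum>n=j+1..s-a. r s n))"
    by (simp add: algebra_simps)
  have ps: "par i * par s = (par j :: 'r)"
    by (simp add: i par_diff mult.commute mult.left_commute)
  have "{a..s-a} = {a..<j} \<union> {j} \<union> {j+1..s-a}" using a by auto
  then have "(\<Sum>n=a..s-a. r s n) = (\<Sum>n=a..<j. r s n) + r s j + (\<Sum>n=j+1..s-a. r s n)"
    by (subst \<open>{a..s-a} = _\<close>, subst sum.union_disjoint, simp, simp, force, subst sum.union_disjoint, auto)
  moreover have "r s j = h * r s j + h * r s j"
    using half by (metis distrib_right mult_1_left mult_2)
  ultimately have "par j * (\<Sum>n=a..s-a. r s n) =
      par j * ((\<Sum>n=a..<j. r s n) + (h * r s j + h * r s j) + (\<Sum>n=j+1..s-a. r s n))"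
    by simp
  then have "G i j + G j i = par j * (\<Sum>n=a..s-a. r s n)"
    unfolding 1 2 ps by (simp add: algebra_simps)
  also have "\<dots> = (if s = 0 then par j else 0)"
    using r_sum[OF a(1) a(5)] by simp
  also have "\<dots> = (if i + j = 0 then par i else 0)"
    by (auto simp: s_def par_def add_eq_0_iff)
  finally show ?thesis .
qed

lemma G_neg_left: "i < 0 \<Longrightarrow> G i j = (if i + j = 0 then par i else 0)"
  using G_skew[of i j] by (simp add: G_neg_right)

text \<open>
  The product of the generating functions at \<open>(z, w)\<close> and \<open>(-z, u)\<close> is free of positive powers of
  \<open>z\<close>, because \<open>F(z) F(-z) = 1\<close>.
\<close>

lemma G_bilinear:
  assumes "k > 0" "l \<ge> 0" "m \<ge> 0"
  shows "(\<Sum>j=-m..k+l. par j * G (k - j) l * G j m) = 0"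
proof -
  have inner: "(\<Sum>j=-m..k+l. par j * qz (k - j + int p) * qz (j + int p')) = 0"
    if "p \<le> nat l" "p' \<le> nat m" for p p'
  proof -
    have "(\<Sum>j=-m..k+l. par j * qz (k - j + int p) * qz (j + int p')) =
          (\<Sum>n=-m + int p'..k + l + int p'. par (int p') * r (k + int p + int p') n)"
      by (rule sum.reindex_bij_witness[where i = "\<lambda>n. n - int p'" and j = "\<lambda>j. j + int p'"])
        (auto simp: r_def par_add algebra_simps)
    also have "\<dots> = 0"
      using r_sum[of "-m + int p'" "k + int p + int p'" "k + l + int p'"] that assms
      by (simp add: sum_distrib_left[symmetric])
    finally show ?thesis .
  qed
  have "(\<Sum>j=-m..k+l. par j * G (k - j) l * G j m) =
     (\<Sum>j=-m..k+l. \<Sum>p\<le>nat l. \<Sum>p'\<le>nat m. wt p * qz (l - int p) * wt p' * qz (m - int p') *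
        (par j * qz (k - j + int p) * qz (j + int p')))"
    by (simp add: G_def sum_distrib_left sum_distrib_right mult_ac)
  also have "\<dots> = (\<Sum>p\<le>nat l. \<Sum>j=-m..k+l. \<Sum>p'\<le>nat m. wt p * qz (l - int p) * wt p' * qz (m - int p') *
        (par j * qz (k - j + int p) * qz (j + int p')))"
    by (rule sum.swap)
  also have "\<dots> = (\<Sum>p\<le>nat l. \<Sum>p'\<le>nat m. \<Sum>j=-m..k+l. wt p * qz (l - int p) * wt p' * qz (m - int p') *
        (par j * qz (k - j + int p) * qz (j + int p')))"
    by (intro sum.cong refl sum.swap)
  also have "\<dots> = (\<Sum>p\<le>nat l. \<Sum>p'\<le>nat m. wt p * qz (l - int p) * wt p' * qz (m - int p') *
        (\<Sum>j=-m..k+l. par j * qz (k - j + int p) * qz (j + int p')))"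
    by (simp add: sum_distrib_left)
  also have "\<dots> = 0"
    by (intro sum.neutral ballI) (simp add: inner)
  finally show ?thesis .
qed

lemma sum_odd_fold:
  fixes f :: "nat \<Rightarrow> 'r"
  assumes "k = 2 * K + 1"
  shows "(\<Sum>j\<le>k. f j) = (\<Sum>j\<le>K. f j + f (k - j))"
proof -
  have "(\<Sum>j\<le>k. f j) = (\<Sum>j\<le>K. f j) + (\<Sum>j=Suc K..k. f j)"
  proof -
    have "k = K + (K + 1)" using assms by simp
    then show ?thesis using sum_up_index_split[of f K "K + 1"] by simp
  qed
  also have "(\<Sum>j=Suc K..k. f j) = (\<Sum>j\<le>K. f (k - j))"
    by (rule sum.reindex_bij_witness[where i = "\<lambda>j. k - j" and j = "\<lambda>j. k - j"])
      (use assms in auto)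
  finally show ?thesis by (simp add: sum.distrib)
qed

text \<open>In \<open>G_bilinear\<close>, an index \<open>j\<close> outside 0..k makes one first
  index negative, where \<open>G\<close> lives on the antidiagonal; only j = -m and j = k + l
  survive there. The rest is folded by exchanging \<open>j\<close> and \<open>k - j\<close>, which
  reverses the sign because \<open>k\<close> is odd.\<close>

lemma G_quadratic:
  assumes k: "k = 2 * K + 1"
  shows "(\<Sum>j\<le>K. (-1) ^ j * (G (int (k - j)) (int l) * G (int j) (int m) - G (int (k - j)) (int m) * G (int j) (int l)))
    = (if l > 0 then G (int (k + l)) (int m) else 0) - (if m > 0 then G (int (k + m)) (int l) else 0)"
proof -
  let ?f = "\<lambda>j. par j * G (int k - j) (int l) * G j (int m)"
  have "0 = (\<Sum>j=-int m..int k + int l. ?f j)"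
    using G_bilinear[of "int k" "int l" "int m"] k by simp
  also have "{-int m..int k + int l} = {-int m..<0} \<union> {0..int k} \<union> {int k<..int k + int l}"
    by auto
  also have "(\<Sum>j\<in>\<dots>. ?f j) = (\<Sum>j=-int m..<0. ?f j) + (\<Sum>j=0..int k. ?f j) + (\<Sum>j\<in>{int k<..int k + int l}. ?f j)"
    by (subst sum.union_disjoint, simp, simp, force, subst sum.union_disjoint, auto)
  also have "(\<Sum>j=-int m..<0. ?f j) = (if m > 0 then G (int (k + m)) (int l) else 0)"
  proof -
    have "(\<Sum>j=-int m..<0. ?f j) = (\<Sum>j=-int m..<0. if j = - int m then ?f (- int m) else 0)"
      by (intro sum.cong) (auto simp: G_neg_left)
    also have "\<dots> = (if m > 0 then G (int (k + m)) (int l) else 0)"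
      by (auto simp: sum.delta G_neg_left mult_ac)
    finally show ?thesis .
  qed
  also have "(\<Sum>j\<in>{int k<..int k + int l}. ?f j) = (if l > 0 then - G (int (k + l)) (int m) else 0)"
  proof -
    have "(\<Sum>j\<in>{int k<..int k + int l}. ?f j) =
        (\<Sum>j\<in>{int k<..int k + int l}. if j = int k + int l then ?f (int k + int l) else 0)"
      by (intro sum.cong) (auto simp: G_neg_left)
    also have "\<dots> = (if l > 0 then - G (int (k + l)) (int m) else 0)"
      using k by (auto simp: sum.delta G_neg_left par_def mult_ac add_ac)
    finally show ?thesis .
  qed
  also have "(\<Sum>j=0..int k. ?f j) = (\<Sum>j\<le>k. ?f (int j))"
    by (rule sum.reindex_bij_witness[where i = int and j = nat]) auto
  also have "\<dots> = (\<Sum>j\<le>K. ?f (int j) + ?f (int (k - j)))"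
    by (rule sum_odd_fold[OF k])
  also have "\<dots> = (\<Sum>j\<le>K. (-1) ^ j * (G (int (k - j)) (int l) * G (int j) (int m) - G (int (k - j)) (int m) * G (int j) (int l)))"
  proof (intro sum.cong refl)
    fix j assume "j \<in> {..K}"
    then have j: "int (k - j) = int k - int j" using k by (simp add: of_nat_diff)
    have "par (int k - int j) = - ((-1) ^ j :: 'r)"
      using k by (simp add: par_diff par_def)
    then show "?f (int j) + ?f (int (k - j)) =
      (-1) ^ j * (G (int (k - j)) (int l) * G (int j) (int m) - G (int (k - j)) (int m) * G (int j) (int l))"
      by (simp add: j par_of_nat algebra_simps)
  qed
  finally have "0 = (if m > 0 then G (int (k + m)) (int l) else 0) +
      (\<Sum>j\<le>K. (-1) ^ j * (G (int (k - j)) (int l) * G (int j) (int m) - G (int (k - j)) (int m) * G (int j) (int l)))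
      + (if l > 0 then - G (int (k + l)) (int m) else 0)" .
  moreover have "s = - x - y" if "0 = y + s + x" for x y s :: 'r
    using that by (metis add.assoc add.commute add_diff_cancel_left' diff_0)
  ultimately have "(\<Sum>j\<le>K. (-1) ^ j * (G (int (k - j)) (int l) * G (int j) (int m) - G (int (k - j)) (int m) * G (int j) (int l)))
      = - (if l > 0 then - G (int (k + l)) (int m) else 0) - (if m > 0 then G (int (k + m)) (int l) else 0)"
    by blast
  then show ?thesis by simp
qed

text \<open>Each summand is a partial sum of s(n) = (-1)^n q(n) q(k - n), so after doubling s(n) is
  counted k - 2n times. As \<open>k\<close> is odd, s(k - n) = -s(n), which redistributes these
  weights into -n at \<open>n\<close> and -(k - n) at \<open>k - n\<close>.\<close>

lemma G_trace:
  assumes k: "k = 2 * K + 1"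
  shows "2 * (\<Sum>j\<le>K. (-1) ^ j * G (int (k - j)) (int j)) =
         - (\<Sum>n\<le>k. (-1) ^ n * of_nat n * q n * q (k - n))"
proof -
  define s where "s n = (-1) ^ n * q n * q (k - n)" for n
  have rs: "r (int k) (int n) = s n" if "n \<le> k" for n
    using that by (simp add: r_def s_def par_of_nat flip: of_nat_diff)
  have s_flip: "s (k - n) = - s n" if "n \<le> K" for n
  proof -
    have "s (k - n) = r (int k) (int k - int n)"
      using rs[of "k - n"] that k by (simp add: of_nat_diff)
    then show ?thesis using rs[of n] that k by (simp add: r_flip par_def)
  qed
  have G: "(-1) ^ j * G (int (k - j)) (int j) = h * s j + (\<Sum>n<j. s n)" if "j \<le> K" for j
  proof -
    have jk: "int (k - j) + int j = int k" "j \<le> k" using that k by auto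
    have "(\<Sum>n=0..<int j. r (int k) n) = (\<Sum>n<j. s n)"
    proof (rule sum.reindex_bij_witness[where i = int and j = nat])
      fix n assume "n \<in> {0..<int j}"
      then obtain i where "n = int i" "i < j" by (metis atLeastLessThan_iff nonneg_int_cases of_nat_less_iff)
      then show "s (nat n) = r (int k) n" using rs[of i] jk(2) by simp
    qed auto
    then show ?thesis
      using G_eq_r[of 0 "int (k - j)" "int j"] jk rs[of j] by (simp add: par_of_nat[symmetric])
  qed
  have "2 * (\<Sum>j\<le>K. (-1) ^ j * G (int (k - j)) (int j)) = (\<Sum>j\<le>K. 2 * (h * s j + (\<Sum>n<j. s n)))"
    by (simp add: sum_distrib_left G)
  also have "\<dots> = (\<Sum>j\<le>K. s j) + 2 * (\<Sum>j\<le>K. \<Sum>n<j. s n)"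
    using half by (simp add: distrib_left sum.distrib sum_distrib_left mult.assoc[symmetric])
  also have "(\<Sum>j\<le>K. \<Sum>n<j. s n) = (\<Sum>n\<le>K. of_nat (K - n) * s n)"
  proof (induction K)
    case (Suc K)
    have "(\<Sum>n\<le>Suc K. of_nat (Suc K - n) * s n) = (\<Sum>n\<le>K. of_nat (K - n) * s n + s n)"
      by (simp add: Suc_diff_le algebra_simps)
    then show ?case using Suc by (simp add: sum.distrib lessThan_Suc_atMost)
  qed simp
  also have "(\<Sum>j\<le>K. s j) + 2 * (\<Sum>n\<le>K. of_nat (K - n) * s n) = (\<Sum>n\<le>K. of_nat (k - 2 * n) * s n)"
    unfolding sum_distrib_left sum.distrib[symmetric]
  proof (intro sum.cong refl)
    fix n assume "n \<in> {..K}"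
    then have "k - 2 * n = 1 + 2 * (K - n)" using k by auto
    then have "(of_nat (k - 2 * n) :: 'r) = 1 + 2 * of_nat (K - n)"
      by (simp only: of_nat_add of_nat_mult of_nat_1 of_nat_numeral)
    then show "s n + 2 * (of_nat (K - n) * s n) = of_nat (k - 2 * n) * s n"
      by (simp only: distrib_right mult_1_left mult.assoc)
  qed
  also have "\<dots> = - (\<Sum>n\<le>K. of_nat n * s n + of_nat (k - n) * s (k - n))"
    unfolding sum_negf[symmetric]
  proof (intro sum.cong refl)
    fix n assume n: "n \<in> {..K}"
    then have "(of_nat (k - 2 * n) :: 'r) = of_nat k - 2 * of_nat n" "(of_nat (k - n) :: 'r) = of_nat k - of_nat n"
      using k by (simp_all add: of_nat_diff)
    moreover have "s (k - n) = - s n" using n by (simp add: s_flip)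
    ultimately show "of_nat (k - 2 * n) * s n = - (of_nat n * s n + of_nat (k - n) * s (k - n))"
      by (simp only:) (simp add: algebra_simps)
  qed
  also have "(\<Sum>n\<le>K. of_nat n * s n + of_nat (k - n) * s (k - n)) = (\<Sum>n\<le>k. of_nat n * s n)"
    by (rule sum_odd_fold[OF k, symmetric])
  finally show ?thesis by (simp add: s_def mult_ac)
qed

end

section \<open>The operators multiplying and differentiating by a time\<close>

lemma transfer_adjoint:
  fixes f g :: "nat set \<Rightarrow> 'r::comm_ring_1"
  assumes "i < N" "j < N"
  shows "(\<Sum>I\<in>Pow {..<N}. f I * cr i (an j g) I) = (\<Sum>I\<in>Pow {..<N}. cr j (an i f) I * g I)"
    and "(\<Sum>I\<in>Pow {..<N}. f I * cr i (cr j g) I) = (\<Sum>I\<in>Pow {..<N}. an j (an i f) I * g I)"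
proof -
  have "(\<Sum>I\<in>Pow {..<N}. f I * cr i (an j g) I) = (\<Sum>I\<in>Pow {..<N}. an i f I * an j g I)"
    by (rule cr_adjoint[OF assms(1)])
  also have "\<dots> = (\<Sum>I\<in>Pow {..<N}. an j g I * an i f I)"
    by (simp add: mult.commute)
  also have "\<dots> = (\<Sum>I\<in>Pow {..<N}. g I * cr j (an i f) I)"
    by (rule cr_adjoint[OF assms(2), symmetric])
  finally show "(\<Sum>I\<in>Pow {..<N}. f I * cr i (an j g) I) = (\<Sum>I\<in>Pow {..<N}. cr j (an i f) I * g I)"
    by (simp add: mult.commute)
  show "(\<Sum>I\<in>Pow {..<N}. f I * cr i (cr j g) I) = (\<Sum>I\<in>Pow {..<N}. an j (an i f) I * g I)"
    by (simp add: cr_adjoint assms)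
qed

text \<open>
  The zero mode is \<open>\<phi>\<^sub>0 = \<rho> (\<psi>\<^sub>0 + \<partial>\<^sub>0)\<close> with \<open>\<rho>\<^sup>2 = \<onehalf>\<close>, which is where the exceptional coefficients at
  index 0 come from.
\<close>

definition edge :: "'r \<Rightarrow> nat \<Rightarrow> 'r::comm_ring_1" where
  "edge \<rho> j = (if j = 0 then \<rho> else 1)"

definition pair_coeff :: "'r \<Rightarrow> nat \<Rightarrow> 'r::comm_ring_1" where
  "pair_coeff \<rho> j = (if j = 0 then \<rho> else (-1) ^ j)"

text \<open>\<open>H\<^sub>k\<close> and its transpose for \<open>k = 2 K + 1\<close>, cut off to indices below \<open>N\<close>.\<close>

definition lower :: "'r \<Rightarrow> nat \<Rightarrow> nat \<Rightarrow> (nat set \<Rightarrow> 'r) \<Rightarrow> nat set \<Rightarrow> 'r::comm_ring_1" where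
  "lower \<rho> K N g I = (\<Sum>j<N - (2 * K + 1). edge \<rho> j * cr (j + (2 * K + 1)) (an j g) I)
     + (\<Sum>j\<le>K. pair_coeff \<rho> j * cr (2 * K + 1 - j) (cr j g) I)"

definition raise :: "'r \<Rightarrow> nat \<Rightarrow> nat \<Rightarrow> (nat set \<Rightarrow> 'r) \<Rightarrow> nat set \<Rightarrow> 'r::comm_ring_1" where
  "raise \<rho> K N f I = (\<Sum>j<N - (2 * K + 1). edge \<rho> j * cr j (an (j + (2 * K + 1)) f) I)
     + (\<Sum>j\<le>K. pair_coeff \<rho> j * an j (an (2 * K + 1 - j) f) I)"

lemma raise_lower_adjoint:
  assumes "2 * K + 1 < N"
  shows "(\<Sum>I\<in>Pow {..<N}. f I * lower \<rho> K N g I) = (\<Sum>I\<in>Pow {..<N}. raise \<rho> K N f I * g I)"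
proof -
  have "(\<Sum>I\<in>Pow {..<N}. f I * lower \<rho> K N g I) =
      (\<Sum>j<N - (2 * K + 1). edge \<rho> j * (\<Sum>I\<in>Pow {..<N}. f I * cr (j + (2 * K + 1)) (an j g) I))
     + (\<Sum>j\<le>K. pair_coeff \<rho> j * (\<Sum>I\<in>Pow {..<N}. f I * cr (2 * K + 1 - j) (cr j g) I))"
    unfolding lower_def distrib_left sum.distrib sum_distrib_left
    by (subst sum.swap, subst (2) sum.swap) (simp add: mult.left_commute)
  also have "\<dots> = (\<Sum>j<N - (2 * K + 1). edge \<rho> j * (\<Sum>I\<in>Pow {..<N}. cr j (an (j + (2 * K + 1)) f) I * g I))
     + (\<Sum>j\<le>K. pair_coeff \<rho> j * (\<Sum>I\<in>Pow {..<N}. an j (an (2 * K + 1 - j) f) I * g I))"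
    using assms by (intro arg_cong2[of _ _ _ _ "(+)"] sum.cong refl arg_cong2[of _ _ _ _ "(*)"] transfer_adjoint) auto
  also have "\<dots> = (\<Sum>I\<in>Pow {..<N}. raise \<rho> K N f I * g I)"
    unfolding raise_def distrib_right sum.distrib sum_distrib_right
    by (simp add: sum_distrib_left mult.assoc sum.swap[of _ _ "Pow {..<N}"])
  finally show ?thesis .
qed

locale schur_matrix = q_sequence +
  fixes \<rho> :: "'a"
  assumes rho_sq: "\<rho> * \<rho> = h"
begin

definition A_gt :: "nat \<Rightarrow> nat \<Rightarrow> 'a" where
  "A_gt a b = (if b = 0 then \<rho> * q a
     else h * q a * q b + (\<Sum>k=1..b. (-1) ^ k * q (a + k) * q (b - k)))"

definition A :: "nat \<Rightarrow> nat \<Rightarrow> 'a" where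
  "A a b = (if a > b then A_gt a b else if a < b then - A_gt b a else 0)"

lemma A_skew: "A i j = - A j i"
  by (simp add: A_def)

lemma A_diag [simp]: "A i i = 0"
  by (simp add: A_def)

lemma rho_rho: "\<rho> * (\<rho> * x) = h * x"
  by (simp add: rho_sq mult.assoc[symmetric])

lemma A_0_right: "i > 0 \<Longrightarrow> A i 0 = \<rho> * q i"
  and A_0_left: "i > 0 \<Longrightarrow> A 0 i = - (\<rho> * q i)"
  by (simp_all add: A_def A_gt_def)

lemma G_nat_0: "G (int i) 0 = h * q i"
  by (simp add: G_0_right)

lemma G_0_nat: "i > 0 \<Longrightarrow> G 0 (int i) = - (h * q i)"
  using G_skew[of 0 "int i"] by (simp add: G_nat_0 eq_neg_iff_add_eq_0)

text \<open>Index 0 is excluded because there \<open>A\<close> carries the factor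
  \<open>\<rho>\<close> where \<open>G\<close> carries its square \<open>h\<close>.\<close>

lemma A_eq_G:
  assumes "i > 0" "j > 0"
  shows "A i j = G (int i) (int j)"
proof -
  have gt: "A a b = G (int a) (int b)" if "a > b" "b > 0" for a b
  proof -
    have "(\<Sum>k=1..b. (-1) ^ k * q (a + k) * q (b - k)) =
        (\<Sum>p<b. wt (Suc p) * qz (int a + int (Suc p)) * qz (int b - int (Suc p)))"
    proof (rule sum.reindex_bij_witness[where i = Suc and j = "\<lambda>k. k - 1"])
      fix k assume "k \<in> {1..b}"
      then obtain p where p: "k = Suc p" "p < b" by (cases k) auto
      have "qz (int b - int (Suc p)) = q (b - Suc p)" using p by (intro qz_diff) auto
      moreover have "qz (int a + int (Suc p)) = q (a + Suc p)"
        by (metis of_nat_add qz_of_nat)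
      ultimately show "wt (Suc (k - 1)) * qz (int a + int (Suc (k - 1))) * qz (int b - int (Suc (k - 1))) =
          (-1) ^ k * q (a + k) * q (b - k)"
        by (simp add: p(1) wt_def del: of_nat_Suc power_Suc)
    qed auto
    moreover have "G (int a) (int b) = h * q a * q b +
        (\<Sum>p<b. wt (Suc p) * qz (int a + int (Suc p)) * qz (int b - int (Suc p)))"
      by (simp add: G_def sum.atMost_shift wt_def)
    ultimately show ?thesis using that by (simp add: A_def A_gt_def)
  qed
  consider "i > j" | "i < j" | "i = j" by linarith
  then show ?thesis
  proof cases
    case 1
    then show ?thesis using gt assms by simp
  next
    case 2
    have "G (int i) (int j) = - G (int j) (int i)"
      using G_skew[of "int i" "int j"] assms by (simp add: eq_neg_iff_add_eq_0)
    moreover have "A j i = G (int j) (int i)"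
      using 2 assms by (intro gt)
    ultimately show ?thesis
      using A_skew[of i j] by (simp only:)
  next
    case 3
    have "G (int i) (int i) + G (int i) (int i) = 0"
      using G_skew[of "int i" "int i"] assms by simp
    then have "2 * h * G (int i) (int i) = 0"
      by (metis distrib_left mult.commute mult.left_commute mult_2 mult_zero_right)
    then show ?thesis using 3 half by simp
  qed
qed

text \<open>This is \<open>G_quadratic\<close> for \<open>A\<close>. In the summand j = 0 the factor
  \<open>\<rho>\<close> from \<open>pair_coeff\<close> turns \<open>A 0 x\<close> into
  \<open>G 0 x\<close>. The outer index 0 needs a separate computation, and antisymmetry reduces m =
  0 to l = 0.\<close>

lemma A_quadratic:
  assumes k: "k = 2 * K + 1"
  shows "edge \<rho> l * A (l + k) m - edge \<rho> m * A (m + k) l =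
    (\<Sum>j\<le>K. pair_coeff \<rho> j * (A (k - j) l * A j m - A (k - j) m * A j l))"
proof -
  have both: ?thesis if "l > 0" "m > 0"
  proof -
    have "pair_coeff \<rho> j * (A (k - j) l * A j m - A (k - j) m * A j l) =
        (-1) ^ j * (G (int (k - j)) (int l) * G (int j) (int m) - G (int (k - j)) (int m) * G (int j) (int l))"
      if "j \<le> K" for j
    proof -
      have *: "A (k - j) x = G (int (k - j)) (int x)" if "x > 0" for x
        using \<open>j \<le> K\<close> k that by (intro A_eq_G) auto
      have **: "pair_coeff \<rho> j * A j x = (-1) ^ j * G (int j) (int x)" if "x > 0" for x
        using that by (cases "j = 0") (simp_all add: A_0_left G_0_nat pair_coeff_def rho_rho A_eq_G)
      have "pair_coeff \<rho> j * (A (k - j) l * A j m - A (k - j) m * A j l) =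
         A (k - j) l * (pair_coeff \<rho> j * A j m) - A (k - j) m * (pair_coeff \<rho> j * A j l)"
        by (simp add: algebra_simps)
      then show ?thesis
        using \<open>l > 0\<close> \<open>m > 0\<close> by (simp only: * **) (simp add: algebra_simps)
    qed
    then have "(\<Sum>j\<le>K. pair_coeff \<rho> j * (A (k - j) l * A j m - A (k - j) m * A j l)) =
       G (int (k + l)) (int m) - G (int (k + m)) (int l)"
      using G_quadratic[OF k, of l m] that by simp
    then show ?thesis
      using that by (simp add: edge_def A_eq_G add_ac)
  qed
  \<comment> \<open>For x > 0, \<open>A x 0\<close> is 2 \<rho> times \<open>G x 0\<close>, so the
    summands are 2 \<rho> times those of \<open>G_quadratic\<close>. The exception is j = 0:
    \<open>A 0 0 = 0\<close> while \<open>G 0 0 = h\<close>, whence the correction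
    \<open>\<rho> * G k m\<close>.\<close>
  have left: "edge \<rho> 0 * A (0 + k) m - edge \<rho> m * A (m + k) 0 =
    (\<Sum>j\<le>K. pair_coeff \<rho> j * (A (k - j) 0 * A j m - A (k - j) m * A j 0))" if "m > 0" for m
  proof -
    have "pair_coeff \<rho> j * (A (k - j) 0 * A j m - A (k - j) m * A j 0) =
       2 * \<rho> * ((-1) ^ j * (G (int (k - j)) (int 0) * G (int j) (int m) - G (int (k - j)) (int m) * G (int j) (int 0)))
        + (if j = 0 then \<rho> * G (int k) (int m) else 0)" if j: "j \<le> K" for j
    proof (cases "j = 0")
      case True
      have k0: "k > 0" using k by simp
      have 1: "h * (h * (q k * (q m * 2))) = h * (q k * q m)"
        using half by (metis mult.commute mult.left_commute mult_1_left)
      have 2: "2 * (h * x) = x" for x using half by (simp add: mult.assoc[symmetric])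
      have 3: "h * (2 * x) = x" for x using 2[of x] by (simp add: mult_ac)
      show ?thesis
        using k0 \<open>m > 0\<close> True
        by (simp add: pair_coeff_def A_0_right A_0_left A_eq_G G_nat_0 G_0_nat G_0_right[of 0] rho_rho
            right_diff_distrib 2 mult_ac)
           (simp add: 1 3)
    next
      case False
      have 2: "2 * \<rho> * (s * (h * x * y - z * (h * w))) = s * (\<rho> * x * y - z * (\<rho> * w))" for s x y z w
      proof -
        have "2 * \<rho> * (s * (h * x * y - z * (h * w))) = (2 * h) * (s * (\<rho> * x * y - z * (\<rho> * w)))"
          by (simp add: algebra_simps)
        then show ?thesis by (simp add: half)
      qed
      have "k - j > 0" using j k by simp
      with False show ?thesis
        using \<open>m > 0\<close>
        by (simp add: pair_coeff_def A_0_right A_eq_G G_nat_0 2 del: of_nat_diff)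
    qed
    then have "(\<Sum>j\<le>K. pair_coeff \<rho> j * (A (k - j) 0 * A j m - A (k - j) m * A j 0)) =
        2 * \<rho> * (0 - G (int (k + m)) (int 0)) + \<rho> * G (int k) (int m)"
      using G_quadratic[OF k, of 0 m] \<open>m > 0\<close>
      by (simp add: sum.distrib sum_distrib_left[symmetric])
    also have "\<dots> = - (2 * h * (\<rho> * q (k + m))) + \<rho> * G (int k) (int m)"
      by (simp add: G_0_right mult_ac flip: of_nat_add)
    finally show ?thesis
      using \<open>m > 0\<close> k half by (simp add: edge_def A_eq_G A_0_right add.commute)
  qed
  consider "l > 0" "m > 0" | "l = 0" "m > 0" | "l > 0" "m = 0" | "l = 0" "m = 0" by linarith
  then show ?thesis
  proof cases
    case 3
    have "edge \<rho> l * A (l + k) m - edge \<rho> m * A (m + k) l = - (edge \<rho> 0 * A (0 + k) l - edge \<rho> l * A (l + k) 0)"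
      using 3 by simp
    also have "\<dots> = (\<Sum>j\<le>K. - (pair_coeff \<rho> j * (A (k - j) 0 * A j l - A (k - j) l * A j 0)))"
      using left[of l] 3 by (simp add: sum_negf)
    also have "\<dots> = (\<Sum>j\<le>K. pair_coeff \<rho> j * (A (k - j) l * A j m - A (k - j) m * A j l))"
      using 3 by (simp add: algebra_simps)
    finally show ?thesis .
  qed (use both left in simp_all)
qed

lemma A_trace:
  assumes k: "k = 2 * K + 1"
  shows "2 * (\<Sum>j\<le>K. pair_coeff \<rho> j * A (k - j) j) = - (\<Sum>n\<le>k. (-1) ^ n * of_nat n * q n * q (k - n))"
proof -
  have "pair_coeff \<rho> j * A (k - j) j = (-1) ^ j * G (int (k - j)) (int j)" if "j \<le> K" for j
    using that k by (cases "j = 0") (simp_all add: pair_coeff_def A_0_right G_nat_0 rho_rho A_eq_G del: of_nat_Suc)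
  then show ?thesis using G_trace[OF k] by simp
qed

text \<open>The Gaussian equations reduce \<open>raise\<close> to the scalar of
  \<open>A_trace\<close> plus a quadratic form in creations with matrix \<open>W\<close>. The
  content of \<open>A_quadratic\<close> is that \<open>W\<close> is symmetric, so the form vanishes.
  The bound on \<open>J\<close> ensures that the cut-off drops no term of the first sum.\<close>

lemma raise_gaussian:
  assumes G: "gaussian N A u" and J: "J \<subseteq> {..<N - (2 * K + 1)}" and N: "2 * K + 1 < N"
  shows "2 * raise \<rho> K N u J = - (\<Sum>n\<le>2 * K + 1. (-1) ^ n * of_nat n * q n * q (2 * K + 1 - n)) * u J"
proof -
  define k where k: "k = 2 * K + 1"
  have JN: "J \<subseteq> {..<N}" using J by (rule order.trans) auto
  have fin: "finite J" using JN finite_subset by blast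
  define W where "W l m = edge \<rho> l * A (l + k) m - (\<Sum>j\<le>K. pair_coeff \<rho> j * (A (k - j) l * A j m))" for l m
  have W: "W l m = W m l" for l m
    using A_quadratic[OF k, of l m] by (simp add: W_def right_diff_distrib sum_subtractf algebra_simps)
  have "(\<Sum>j<N - k. edge \<rho> j * cr j (an (j + k) u) J) = (\<Sum>j<N. edge \<rho> j * cr j (an (j + k) u) J)"
    using J by (intro sum.mono_neutral_left) (auto simp: cr_def k)
  also have "\<dots> = (\<Sum>j<N. edge \<rho> j * (\<Sum>m<N. A (j + k) m * cr j (cr m u) J))"
  proof (intro sum.cong refl arg_cong2[of _ _ _ _ "(*)"])
    fix j
    have "cr j (an (j + k) u) J = cr j (\<lambda>I. \<Sum>m<N. A (j + k) m * cr m u I) J"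
      using JN by (intro cr_cong gaussianD[OF G]) auto
    then show "cr j (an (j + k) u) J = (\<Sum>m<N. A (j + k) m * cr j (cr m u) J)"
      by (simp add: cr_sum)
  qed
  finally have 1: "(\<Sum>j<N - k. edge \<rho> j * cr j (an (j + k) u) J) =
      (\<Sum>l<N. \<Sum>m<N. edge \<rho> l * A (l + k) m * cr l (cr m u) J)"
    by (simp add: sum_distrib_left mult.assoc)
  have 2: "an j (an (k - j) u) J = A (k - j) j * u J - (\<Sum>l<N. \<Sum>m<N. A (k - j) l * A j m * cr l (cr m u) J)"
    if "j \<le> K" for j
  proof -
    have jN: "j < N" using that N by simp
    have "an j (an (k - j) u) J = an j (\<lambda>I. \<Sum>l<N. A (k - j) l * cr l u I) J"
      using JN jN by (intro an_cong gaussianD[OF G]) auto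
    also have "\<dots> = (\<Sum>l<N. A (k - j) l * (if j = l then u J else 0)) - (\<Sum>l<N. A (k - j) l * cr l (an j u) J)"
      by (simp add: an_sum an_cr[OF fin] right_diff_distrib sum_subtractf)
    also have "(\<Sum>l<N. A (k - j) l * (if j = l then u J else 0)) = A (k - j) j * u J"
      using jN by (simp add: if_distrib cong: if_cong)
    also have "(\<Sum>l<N. A (k - j) l * cr l (an j u) J) = (\<Sum>l<N. A (k - j) l * (\<Sum>m<N. A j m * cr l (cr m u) J))"
    proof (intro sum.cong refl arg_cong2[of _ _ _ _ "(*)"])
      fix l
      have "cr l (an j u) J = cr l (\<lambda>I. \<Sum>m<N. A j m * cr m u I) J"
        using JN by (intro cr_cong gaussianD[OF G]) auto
      then show "cr l (an j u) J = (\<Sum>m<N. A j m * cr l (cr m u) J)"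
        by (simp add: cr_sum)
    qed
    finally show ?thesis by (simp add: sum_distrib_left mult.assoc)
  qed
  have "(\<Sum>j\<le>K. pair_coeff \<rho> j * an j (an (k - j) u) J) =
     (\<Sum>j\<le>K. pair_coeff \<rho> j * A (k - j) j) * u J
     - (\<Sum>j\<le>K. \<Sum>l<N. \<Sum>m<N. pair_coeff \<rho> j * (A (k - j) l * A j m * cr l (cr m u) J))"
    by (simp add: 2 right_diff_distrib sum_subtractf sum_distrib_left sum_distrib_right mult.assoc)
  also have "(\<Sum>j\<le>K. \<Sum>l<N. \<Sum>m<N. pair_coeff \<rho> j * (A (k - j) l * A j m * cr l (cr m u) J)) =
     (\<Sum>l<N. \<Sum>j\<le>K. \<Sum>m<N. pair_coeff \<rho> j * (A (k - j) l * A j m * cr l (cr m u) J))"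
    by (rule sum.swap)
  also have "\<dots> = (\<Sum>l<N. \<Sum>m<N. \<Sum>j\<le>K. pair_coeff \<rho> j * (A (k - j) l * A j m * cr l (cr m u) J))"
    by (intro sum.cong refl sum.swap)
  finally have "raise \<rho> K N u J = (\<Sum>j\<le>K. pair_coeff \<rho> j * A (k - j) j) * u J
      + (\<Sum>l<N. \<Sum>m<N. W l m * cr l (cr m u) J)"
    unfolding raise_def k[symmetric] 1
    by (simp add: W_def left_diff_distrib sum_subtractf sum_distrib_right mult.assoc)
  also have "(\<Sum>l<N. \<Sum>m<N. W l m * cr l (cr m u) J) = 0"
    by (rule symmetric_cr_cr_sum[OF half fin W])
  finally have "2 * raise \<rho> K N u J = (2 * (\<Sum>j\<le>K. pair_coeff \<rho> j * A (k - j) j)) * u J"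
    by (simp add: mult.assoc)
  then show ?thesis
    unfolding A_trace[OF k] unfolding k .
qed

text \<open>The derivation multiplies the generating function of \<open>G\<close> by 2 (z^k + w^k),
  that is, it shifts one index down by \<open>k\<close>. Once this is written as \<open>M\<close>
  minus its transpose, \<open>gaussian_derivation\<close> applies, and the Gaussian equation
  contracts the shifted part to the annihilators of \<open>lower\<close>.\<close>

lemma deriv_gaussian:
  assumes G: "gaussian N A v"
    and D_add: "\<And>x y. D (x + y) = D x + D y" and D_mult: "\<And>x y. D (x * y) = D x * y + x * D y"
    and Dh: "D h = 0" and Drho: "D \<rho> = 0"
    and Dq: "\<And>n. D (q n) = 2 * (if n \<ge> 2 * K + 1 then q (n - (2 * K + 1)) else 0)"
    and I: "I \<subseteq> {..<N}" and N: "2 * K + 1 < N"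
  shows "D (v I) = 2 * lower \<rho> K N v I"
proof -
  define k where k: "k = 2 * K + 1"
  \<comment> \<open>The first summand is the shifted row; the second is the antidiagonal value of
    \<open>G\<close> once the shifted index has become negative.\<close>
  define M where "M i l = 2 * (if i \<ge> k then edge \<rho> (i - k) * A (i - k) l else 0)
       + 2 * (if i + l = k \<and> i > l then pair_coeff \<rho> l else 0)" for i l
  have D0: "D 0 = 0" using D_add[of 0 0] by simp
  have D_minus: "D (- x) = - D x" for x
    using D_add[of x "- x"] D0 by (simp add: eq_neg_iff_add_eq_0 add.commute)
  have D1: "D 1 = 0" using D_mult[of 1 1] by simp
  have D_sum: "D (sum f X) = (\<Sum>x\<in>X. D (f x))" for f :: "nat \<Rightarrow> 'a" and X
    by (induction X rule: infinite_finite_induct) (simp_all add: D0 D_add)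
  have Dpow: "D ((-1) ^ n) = 0" for n
    by (cases "even n") (simp_all add: D1 D_minus)
  have Dwt: "D (wt p) = 0" for p
    by (simp add: wt_def Dh Dpow)
  have Dqz: "D (qz n) = 2 * qz (n - int k)" for n
  proof (cases "n < 0")
    case True
    then show ?thesis by (simp add: D0)
  next
    case False
    then obtain m where m: "n = int m" by (metis not_less nonneg_int_cases)
    show ?thesis
    proof (cases "m \<ge> k")
      case True
      then show ?thesis using m by (simp add: Dq k qz_diff del: of_nat_Suc of_nat_add of_nat_mult)
    next
      case False
      then show ?thesis using m by (simp add: Dq k)
    qed
  qed
  have DG: "D (G i j) = 2 * (G (i - int k) j + G i (j - int k))" for i j
  proof -
    have "D (G i j) = (\<Sum>p\<le>nat j. wt p * (2 * qz (i + int p - int k)) * qz (j - int p) +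
        wt p * qz (i + int p) * (2 * qz (j - int p - int k)))"
      by (simp add: G_def D_sum D_mult Dwt Dqz)
    also have "\<dots> = 2 * (G (i - int k) j + (\<Sum>p\<le>nat j. wt p * qz (i + int p) * qz (j - int k - int p)))"
      by (simp add: G_def sum.distrib sum_distrib_left distrib_left algebra_simps)
    also have "(\<Sum>p\<le>nat j. wt p * qz (i + int p) * qz (j - int k - int p)) = G i (j - int k)"
      by (rule G_bound[symmetric]) auto
    finally show ?thesis .
  qed
  have kpos: "k > 0" by (simp add: k)
  have DA_gt: "D (A a b) = M a b - M b a" if ab: "a > b" for a b
  proof (cases "b = 0")
    case True
    have "D (A a b) = \<rho> * (2 * (if a \<ge> k then q (a - k) else 0))"
      using ab True by (simp add: A_0_right D_mult Drho Dq k)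
    also have "\<dots> = M a b - M b a"
      using ab True kpos by (auto simp: M_def edge_def A_0_right pair_coeff_def q_0 mult_ac)
    finally show ?thesis .
  next
    case False
    then have pos: "a > 0" "b > 0" using ab by auto
    have 1: "G (int a - int k) (int b) = (if a \<ge> k then edge \<rho> (a - k) * A (a - k) b else 0)
        + (if a + b = k then pair_coeff \<rho> b else 0)"
    proof -
      consider "a > k" | "a = k" | "a < k" by linarith
      then show ?thesis
      proof cases
        case 1
        then show ?thesis using pos A_eq_G[of "a - k" b] by (simp add: edge_def of_nat_diff)
      next
        case 2
        then show ?thesis using pos by (simp add: edge_def G_0_nat A_0_left rho_rho)
      next
        case 3
        then have "int a - int k + int b = 0 \<longleftrightarrow> a + b = k" by linarith
        moreover have "par (int a - int k) = (-1) ^ b" if "a + b = k"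
          using that by (simp add: par_def flip: of_nat_diff) (auto simp: minus_one_power_iff)
        ultimately show ?thesis using 3 pos by (auto simp: G_neg_left pair_coeff_def)
      qed
    qed
    have 2: "G (int a) (int b - int k) = - (if b \<ge> k then edge \<rho> (b - k) * A (b - k) a else 0)"
    proof -
      consider "b > k" | "b = k" | "b < k" by linarith
      then show ?thesis
      proof cases
        case 1
        then have "int b - int k = int (b - k)" by simp
        then show ?thesis using 1 pos A_eq_G[of a "b - k"] A_skew[of "b - k" a] by (simp add: edge_def)
      next
        case 2
        then show ?thesis using pos by (simp add: edge_def G_nat_0 A_0_left rho_rho)
      next
        case 3
        then show ?thesis by (simp add: G_neg_right)
      qed
    qed
    have "D (A a b) = 2 * (G (int a - int k) (int b) + G (int a) (int b - int k))"
      using pos by (simp add: A_eq_G DG)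
    also have "\<dots> = M a b - M b a"
      unfolding 1 2 M_def using ab by (auto simp: algebra_simps)
    finally show ?thesis .
  qed
  have DA: "D (A a b) = M a b - M b a" for a b
  proof -
    consider "a > b" | "a < b" | "a = b" by linarith
    then show ?thesis
    proof cases
      case 2
      then show ?thesis using DA_gt[of a b] A_skew[of a b] by (simp add: D_minus)
    qed (simp_all add: DA_gt D0)
  qed
  have "D (v I) = (\<Sum>i<N. \<Sum>l<N. M i l * cr i (cr l v) I)"
    by (rule gaussian_derivation[OF G D_add D_mult DA I])
  also have "\<dots> = 2 * (\<Sum>i<N. \<Sum>l<N. (if i \<ge> k then edge \<rho> (i - k) * A (i - k) l else 0) * cr i (cr l v) I)
      + 2 * (\<Sum>i<N. \<Sum>l<N. (if i + l = k \<and> i > l then pair_coeff \<rho> l else 0) * cr i (cr l v) I)"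
    by (simp only: M_def sum_distrib_left distrib_right sum.distrib mult.assoc)
  also have "(\<Sum>i<N. \<Sum>l<N. (if i \<ge> k then edge \<rho> (i - k) * A (i - k) l else 0) * cr i (cr l v) I)
      = (\<Sum>i<N. if i \<ge> k then edge \<rho> (i - k) * cr i (an (i - k) v) I else 0)"
  proof (intro sum.cong refl)
    fix i
    have "cr i (an (i - k) v) I = cr i (\<lambda>I. \<Sum>m<N. A (i - k) m * cr m v I) I"
      using I by (intro cr_cong gaussianD[OF G]) auto
    then show "(\<Sum>l<N. (if i \<ge> k then edge \<rho> (i - k) * A (i - k) l else 0) * cr i (cr l v) I) =
       (if i \<ge> k then edge \<rho> (i - k) * cr i (an (i - k) v) I else 0)"
      by (simp add: cr_sum sum_distrib_left mult.assoc)
  qed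
  also have "\<dots> = (\<Sum>i\<in>{k..<N}. edge \<rho> (i - k) * cr i (an (i - k) v) I)"
    by (rule sum.mono_neutral_cong_right) auto
  also have "\<dots> = (\<Sum>j<N - k. edge \<rho> j * cr (j + k) (an j v) I)"
    by (rule sum.reindex_bij_witness[where i = "\<lambda>j. j + k" and j = "\<lambda>i. i - k"]) auto
  also have "(\<Sum>i<N. \<Sum>l<N. (if i + l = k \<and> i > l then pair_coeff \<rho> l else 0) * cr i (cr l v) I) =
     (\<Sum>l<N. \<Sum>i<N. (if i + l = k \<and> i > l then pair_coeff \<rho> l else 0) * cr i (cr l v) I)"
    by (rule sum.swap)
  also have "\<dots> = (\<Sum>l\<le>K. pair_coeff \<rho> l * cr (k - l) (cr l v) I)"
  proof (rule sum.mono_neutral_cong_right)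
    show "\<forall>l\<in>{..<N} - {..K}. (\<Sum>i<N. (if i + l = k \<and> i > l then pair_coeff \<rho> l else 0) * cr i (cr l v) I) = 0"
      by (auto simp: k intro!: sum.neutral)
    fix l assume l: "l \<in> {..K}"
    have "(\<Sum>i<N. (if i + l = k \<and> i > l then pair_coeff \<rho> l else 0) * cr i (cr l v) I) =
        (\<Sum>i<N. if i = k - l then pair_coeff \<rho> l * cr i (cr l v) I else 0)"
      using l by (intro sum.cong refl) (auto simp: k)
    also have "\<dots> = pair_coeff \<rho> l * cr (k - l) (cr l v) I"
      using N by (simp add: k)
    finally show "(\<Sum>i<N. (if i + l = k \<and> i > l then pair_coeff \<rho> l else 0) * cr i (cr l v) I) =
       pair_coeff \<rho> l * cr (k - l) (cr l v) I" .
  qed (use N in auto)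
  finally show ?thesis
    by (simp add: lower_def k distrib_left)
qed

end

section \<open>Specialisations of the polynomials \<open>q\<^sub>i\<close>\<close>

definition ring_hom_fun :: "('a::comm_ring_1 \<Rightarrow> 'b::comm_ring_1) \<Rightarrow> bool" where
  "ring_hom_fun f \<longleftrightarrow> f 1 = 1 \<and> (\<forall>x y. f (x + y) = f x + f y) \<and> (\<forall>x y. f (x * y) = f x * f y)"

lemma ring_hom_funD:
  assumes "ring_hom_fun f"
  shows "f 1 = 1" "f (x + y) = f x + f y" "f (x * y) = f x * f y"
    "f 0 = 0" "f (- x) = - f x" "f (x - y) = f x - f y"
proof -
  show *: "f 1 = 1" "f (x + y) = f x + f y" "f (x * y) = f x * f y" for x y
    using assms by (auto simp: ring_hom_fun_def)
  show 0: "f 0 = 0"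
    using *(2)[of 0 0] by simp
  show m: "f (- x) = - f x" for x
    using *(2)[of x "- x"] 0 by (simp add: eq_neg_iff_add_eq_0 add.commute)
  show "f (x - y) = f x - f y"
    using *(2)[of x "- y"] m by simp
qed

lemma ring_hom_fun_sum: "ring_hom_fun f \<Longrightarrow> f (sum g X) = (\<Sum>x\<in>X. f (g x))"
  by (induction X rule: infinite_finite_induct) (simp_all add: ring_hom_funD)

lemma ring_hom_fun_prod: "ring_hom_fun f \<Longrightarrow> f (prod g X) = (\<Prod>x\<in>X. f (g x))"
  by (induction X rule: infinite_finite_induct) (simp_all add: ring_hom_funD)

lemma ring_hom_fun_power: "ring_hom_fun f \<Longrightarrow> f (x ^ n) = f x ^ n"
  by (induction n) (simp_all add: ring_hom_funD)

lemma ring_hom_fun_of_nat: "ring_hom_fun f \<Longrightarrow> f (of_nat n) = of_nat n"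
  by (induction n) (simp_all add: ring_hom_funD)

lemma ring_hom_fun_numeral: "ring_hom_fun f \<Longrightarrow> f (numeral n) = numeral n"
  using ring_hom_fun_of_nat[of f "numeral n"] by simp

lemma ring_hom_fun_of_int: "ring_hom_fun f \<Longrightarrow> f (of_int n) = of_int n"
  by (cases n rule: int_cases) (simp_all add: ring_hom_funD ring_hom_fun_of_nat del: of_nat_Suc)

lemma ring_hom_fun_comp: "ring_hom_fun f \<Longrightarrow> ring_hom_fun g \<Longrightarrow> ring_hom_fun (\<lambda>x. f (g x))"
  by (simp add: ring_hom_fun_def)

lemma exp_series_nth: "exp_series C F $ n = (\<Sum>i\<le>n. C (1 / fact i) * (F ^ i) $ n)"
  by (simp add: exp_series_def fps_compose_nth atMost_atLeast0)

lemma exp_series_hom: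
  assumes h: "ring_hom_fun h" and F: "\<And>n. h (F $ n) = F' $ n" and C: "\<And>c. h (C c) = C' c"
  shows "h (exp_series C F $ n) = exp_series C' F' $ n"
proof -
  have "h ((F ^ i) $ n) = (F' ^ i) $ n" for i n
    by (induction i arbitrary: n)
      (simp_all add: ring_hom_funD[OF h] ring_hom_fun_sum[OF h] fps_mult_nth F)
  then show ?thesis
    by (simp add: exp_series_nth ring_hom_funD[OF h] ring_hom_fun_sum[OF h] C)
qed

text \<open>The ring is not assumed to be a field: reciprocals of positive integers, and of
  factorials, come through \<open>C\<close>.\<close>

locale odd_exp =
  fixes C :: "complex \<Rightarrow> 'r::comm_ring_1" and x :: "nat \<Rightarrow> 'r"
  assumes C_hom: "ring_hom_fun C"
begin

definition F :: "'r fps" where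
  "F = Abs_fps (\<lambda>k. if odd k then x k else 0)"

definition q :: "nat \<Rightarrow> 'r" where
  "q n = exp_series C F $ n"

lemma F_nth: "F $ n = (if odd n then x n else 0)"
  by (simp add: F_def)

definition E :: "'r fps" where
  "E = exp_series C F"

text \<open>
  Truncations of \<open>E\<close>: a derivation need not commute with the infinite sum, but it is local in the
  coefficients.
\<close>

definition T :: "nat \<Rightarrow> 'r fps" where
  "T M = (\<Sum>i\<le>M. fps_const (C (1 / fact i)) * F ^ i)"

lemma E_nth: "E $ n = q n"
  by (simp add: E_def q_def)

lemma T_nth: "n \<le> M \<Longrightarrow> T M $ n = q n"
proof -
  assume nM: "n \<le> M"
  have "T M $ n = (\<Sum>i\<le>M. C (1 / fact i) * (F ^ i) $ n)"
    by (simp add: T_def fps_sum_nth)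
  also have "\<dots> = (\<Sum>i\<le>n. C (1 / fact i) * (F ^ i) $ n)"
  proof (rule sum.mono_neutral_right)
    show "\<forall>i\<in>{..M} - {..n}. C (1 / fact i) * (F ^ i) $ n = 0"
      using startsby_zero_power_prefix[of F] by (auto simp: F_nth)
  qed (use nM in auto)
  finally show ?thesis by (simp add: q_def exp_series_nth)
qed

lemma T_mult_nth: "(T n * g) $ n = (E * g) $ n"
  by (simp add: fps_mult_nth T_nth E_nth)

lemma C_of_nat: "C (of_nat n) = of_nat n"
  by (rule ring_hom_fun_of_nat[OF C_hom])

lemma C_inverse_nat: "n > 0 \<Longrightarrow> of_nat n * C (1 / of_nat n) = 1"
  by (simp add: ring_hom_funD[OF C_hom, symmetric] C_of_nat[symmetric])

text \<open>The chain rule is exact for truncated exponentials at the price of one order. It is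
  applied both to the derivative in z and to a derivation acting on coefficients.\<close>

lemma derivation_T:
  assumes add: "\<And>f g. \<delta> (f + g) = \<delta> f + \<delta> g" and mult: "\<And>f g. \<delta> (f * g) = \<delta> f * g + f * \<delta> g"
    and const: "\<And>c. \<delta> (fps_const (C c)) = 0"
  shows "\<delta> (T (Suc M)) = T M * \<delta> F"
proof -
  have d0: "\<delta> 0 = 0" using add[of 0 0] by simp
  have d1: "\<delta> 1 = 0" using mult[of 1 1] by simp
  have dsum: "\<delta> (sum f X) = (\<Sum>i\<in>X. \<delta> (f i))" for f :: "nat \<Rightarrow> 'r fps" and X
    by (induction X rule: infinite_finite_induct) (simp_all add: d0 add)
  have dpow: "\<delta> (F ^ Suc i) = of_nat (Suc i) * F ^ i * \<delta> F" for i
    by (induction i) (simp_all add: mult algebra_simps)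
  have c: "fps_const (C (1 / fact (Suc i))) * of_nat (Suc i) = fps_const (C (1 / fact i))" for i
  proof -
    have "fps_const (C (1 / fact (Suc i))) * of_nat (Suc i) = fps_const (C (1 / fact (Suc i) * of_nat (Suc i)))"
      by (simp only: ring_hom_funD(3)[OF C_hom] C_of_nat fps_of_nat fps_const_mult[symmetric])
    also have "1 / fact (Suc i) * of_nat (Suc i) = (1 / fact i :: complex)"
      by (simp add: field_simps del: of_nat_Suc)
    finally show ?thesis .
  qed
  have "\<delta> (T (Suc M)) = (\<Sum>i\<le>Suc M. fps_const (C (1 / fact i)) * \<delta> (F ^ i))"
    by (simp only: T_def dsum mult const mult_zero_left add_0_left)
  also have "\<dots> = (\<Sum>i\<le>M. fps_const (C (1 / fact (Suc i))) * of_nat (Suc i) * F ^ i * \<delta> F)"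
    by (simp only: sum.atMost_Suc_shift dpow power_0 d1 mult_zero_right add_0_left mult.assoc)
  also have "\<dots> = T M * \<delta> F"
    by (simp only: c T_def sum_distrib_right)
  finally show ?thesis .
qed

lemma q_zero: "q 0 = 1"
  by (simp add: q_def exp_series_nth ring_hom_funD[OF C_hom])

lemma E_deriv: "fps_deriv E = E * fps_deriv F"
proof (rule fps_ext)
  fix n
  have "fps_deriv E $ n = fps_deriv (T (Suc n)) $ n"
    by (simp add: E_nth T_nth)
  also have "\<dots> = (T n * fps_deriv F) $ n"
    by (subst derivation_T[of fps_deriv]) simp_all
  finally show "fps_deriv E $ n = (E * fps_deriv F) $ n"
    by (simp only: T_mult_nth)
qed

text \<open>\<open>E(-z)\<close>\<close>

definition Em :: "'r fps" where
  "Em = Abs_fps (\<lambda>n. (-1) ^ n * q n)"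

lemma Em_deriv: "fps_deriv Em = - (Em * fps_deriv F)"
proof (rule fps_ext)
  fix n
  have "fps_deriv Em $ n = - ((-1) ^ n * fps_deriv E $ n)"
    by (simp add: Em_def E_nth algebra_simps)
  also have "(-1) ^ n * fps_deriv E $ n = (\<Sum>i=0..n. (-1) ^ n * (q i * fps_deriv F $ (n - i)))"
    by (simp add: E_deriv fps_mult_nth E_nth sum_distrib_left del: fps_deriv_nth)
  also have "\<dots> = (\<Sum>i=0..n. (-1) ^ i * q i * fps_deriv F $ (n - i))"
  proof (intro sum.cong refl)
    fix i assume "i \<in> {0..n}"
    then have "(-1) ^ n = ((-1) ^ i * (-1) ^ (n - i) :: 'r)"
      by (simp flip: power_add)
    then show "(-1) ^ n * (q i * fps_deriv F $ (n - i)) = (-1) ^ i * q i * fps_deriv F $ (n - i)"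
      by (cases "even (n - i)") (simp_all add: F_nth)
  qed
  also have "\<dots> = (Em * fps_deriv F) $ n"
    by (simp add: fps_mult_nth Em_def)
  finally show "fps_deriv Em $ n = (- (Em * fps_deriv F)) $ n"
    by simp
qed

text \<open>The logarithmic derivatives cancel, so the product has derivative 0; as positive
  integers are invertible through \<open>C\<close>, it equals its constant term.\<close>

lemma E_Em: "E * Em = 1"
proof (rule fps_ext)
  fix n
  have "fps_deriv (E * Em) = 0"
    by (simp add: E_deriv Em_deriv algebra_simps)
  then have d: "of_nat (Suc m) * (E * Em) $ Suc m = 0" for m
    by (metis Suc_eq_plus1 fps_deriv_nth fps_zero_nth)
  show "(E * Em) $ n = 1 $ n"
  proof (cases n)
    case 0
    then show ?thesis by (simp add: E_nth Em_def q_zero)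
  next
    case (Suc m)
    have "(of_nat (Suc m) * C (1 / of_nat (Suc m))) * (E * Em) $ Suc m = 0"
      using d[of m] by (metis mult.assoc mult.commute mult_zero_left)
    then show ?thesis using C_inverse_nat[of "Suc m"] Suc by simp
  qed
qed

lemma q_sequence: "q_sequence q (C (1 / 2))"
proof
  show "q 0 = 1" by (rule q_zero)
  show "2 * C (1 / 2) = 1" using C_inverse_nat[of 2] by simp
  fix n :: nat assume "n > 0"
  have "(\<Sum>i\<le>n. (-1) ^ i * q i * q (n - i)) = (Em * E) $ n"
    by (simp add: fps_mult_nth E_nth Em_def atMost_atLeast0)
  also have "\<dots> = 0" using \<open>n > 0\<close> by (simp add: mult.commute E_Em)
  finally show "(\<Sum>i\<le>n. (-1) ^ i * q i * q (n - i)) = 0" .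
qed

text \<open>The sum is a coefficient of \<open>fps_deriv Em * E\<close>, which equals
  \<open>- fps_deriv F\<close> because \<open>E * Em = 1\<close>.\<close>

lemma newton:
  assumes "odd k"
  shows "(\<Sum>n\<le>k. (-1) ^ n * of_nat n * q n * q (k - n)) = - (of_nat k * x k)"
proof -
  obtain m where m: "k = Suc m" using assms by (cases k) auto
  have "(\<Sum>n\<le>k. (-1) ^ n * of_nat n * q n * q (k - n)) =
        (\<Sum>n\<le>m. fps_deriv Em $ n * E $ (m - n))"
    unfolding m by (subst sum.atMost_Suc_shift) (simp add: Em_def E_nth mult_ac)
  also have "\<dots> = (fps_deriv Em * E) $ m"
    by (simp only: fps_mult_nth atMost_atLeast0)
  also have "fps_deriv Em * E = - (E * Em * fps_deriv F)"
    by (simp add: Em_deriv mult_ac)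
  also have "\<dots> $ m = - (of_nat k * x k)"
    using assms m by (simp add: E_Em F_nth)
  finally show ?thesis .
qed

lemma derivation_q:
  assumes D_add: "\<And>x y. D (x + y) = D x + D y" and D_mult: "\<And>x y. D (x * y) = D x * y + x * D y"
    and DC: "\<And>c. D (C c) = 0" and k: "odd k" and Dx: "\<And>j. odd j \<Longrightarrow> D (x j) = (if j = k then d else 0)"
  shows "D (q n) = d * (if n \<ge> k then q (n - k) else 0)"
proof -
  have D0: "D 0 = 0" using D_add[of 0 0] by simp
  have D_sum: "D (sum f X) = (\<Sum>x\<in>X. D (f x))" for f :: "nat \<Rightarrow> 'r" and X
    by (induction X rule: infinite_finite_induct) (simp_all add: D0 D_add)
  define \<delta> where "\<delta> f = Abs_fps (\<lambda>n. D (f $ n))" for f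
  have "\<delta> (T (Suc n)) = T n * \<delta> F"
  proof (rule derivation_T)
    show "\<delta> (f + g) = \<delta> f + \<delta> g" for f g
      by (rule fps_ext) (simp add: \<delta>_def D_add)
    show "\<delta> (f * g) = \<delta> f * g + f * \<delta> g" for f g
      by (rule fps_ext) (simp add: \<delta>_def D_sum D_mult fps_mult_nth sum.distrib)
    show "\<delta> (fps_const (C c)) = 0" for c
      by (rule fps_ext) (simp add: \<delta>_def DC D0)
  qed
  moreover have "\<delta> F = fps_const d * fps_X ^ k"
    by (rule fps_ext) (use k in \<open>auto simp: \<delta>_def F_nth Dx D0 fps_X_power_nth\<close>)
  ultimately have "\<delta> (T (Suc n)) $ n = (E * (fps_const d * fps_X ^ k)) $ n"
    by (simp only: T_mult_nth)
  also have "\<dots> = d * (E * fps_X ^ k) $ n"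
    by (simp add: mult.left_commute[of E])
  finally show ?thesis
    by (simp add: \<delta>_def T_nth fps_X_power_mult_right_nth E_nth)
qed

end

section \<open>Polynomial evaluation and the embedding into power series are ring
  homomorphisms\<close>

lemma poly_eval_superset:
  assumes "C 0 = 0" "finite S" "Poly_Mapping.keys P \<subseteq> S"
  shows "poly_eval C x P = (\<Sum>m\<in>S. C (Poly_Mapping.lookup P m) * (\<Prod>v\<in>Poly_Mapping.keys m. x v ^ Poly_Mapping.lookup m v))"
  unfolding poly_eval_def using assms
  by (intro sum.mono_neutral_left) (auto simp: in_keys_iff)

lemma monomial_value_add:
  fixes x :: "'v \<Rightarrow> 'r::comm_ring_1"
  shows "(\<Prod>v\<in>Poly_Mapping.keys (m + n). x v ^ Poly_Mapping.lookup (m + n) v) =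
    (\<Prod>v\<in>Poly_Mapping.keys m. x v ^ Poly_Mapping.lookup m v) * (\<Prod>v\<in>Poly_Mapping.keys n. x v ^ Poly_Mapping.lookup n v)"
proof -
  define S where "S = Poly_Mapping.keys m \<union> Poly_Mapping.keys n"
  have *: "(\<Prod>v\<in>Poly_Mapping.keys p. x v ^ Poly_Mapping.lookup p v) = (\<Prod>v\<in>S. x v ^ Poly_Mapping.lookup p v)"
    if "Poly_Mapping.keys p \<subseteq> S" for p
    using that by (intro prod.mono_neutral_left) (auto simp: S_def in_keys_iff)
  have "Poly_Mapping.keys (m + n) \<subseteq> S" unfolding S_def by (rule Poly_Mapping.keys_add)
  then show ?thesis
    using *[of m] *[of n] *[of "m + n"] by (simp add: S_def lookup_add power_add prod.distrib)
qed

lemma poly_mapping_sum_single: "P = (\<Sum>m\<in>Poly_Mapping.keys P. Poly_Mapping.single m (Poly_Mapping.lookup P m))"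
proof (rule poly_mapping_eqI)
  fix k
  show "Poly_Mapping.lookup P k = Poly_Mapping.lookup (\<Sum>m\<in>Poly_Mapping.keys P. Poly_Mapping.single m (Poly_Mapping.lookup P m)) k"
    by (simp add: lookup_sum lookup_single when_def in_keys_iff)
qed

lemma poly_eval_single:
  assumes "C 0 = 0"
  shows "poly_eval C x (Poly_Mapping.single m c) = C c * (\<Prod>v\<in>Poly_Mapping.keys m. x v ^ Poly_Mapping.lookup m v)"
  using assms by (simp add: poly_eval_def)

lemma poly_eval_hom:
  fixes x :: "'v \<Rightarrow> 'r::comm_ring_1"
  assumes C: "ring_hom_fun C"
  shows "ring_hom_fun (poly_eval C x)"
proof -
  note C' = ring_hom_funD[OF C]
  have add: "poly_eval C x (P + Q) = poly_eval C x P + poly_eval C x Q" for P Q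
    using poly_eval_superset[of C "Poly_Mapping.keys P \<union> Poly_Mapping.keys Q" P x]
      poly_eval_superset[of C "Poly_Mapping.keys P \<union> Poly_Mapping.keys Q" Q x]
      poly_eval_superset[of C "Poly_Mapping.keys P \<union> Poly_Mapping.keys Q" "P + Q" x]
      Poly_Mapping.keys_add[of P Q]
    by (simp add: lookup_add C' distrib_right sum.distrib)
  have zero: "poly_eval C x 0 = 0" by (simp add: poly_eval_def)
  have esum: "poly_eval C x (sum f X) = (\<Sum>i\<in>X. poly_eval C x (f i))" for f :: "('v \<Rightarrow>\<^sub>0 nat) \<Rightarrow> _" and X
    by (induction X rule: infinite_finite_induct) (simp_all add: zero add)
  have mult: "poly_eval C x (P * Q) = poly_eval C x P * poly_eval C x Q" for P Q
  proof -
    let ?s = "\<lambda>P m. Poly_Mapping.single m (Poly_Mapping.lookup P m)"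
    have "poly_eval C x (P * Q) = poly_eval C x ((\<Sum>m\<in>Poly_Mapping.keys P. ?s P m) * (\<Sum>n\<in>Poly_Mapping.keys Q. ?s Q n))"
      by (simp only: poly_mapping_sum_single[symmetric])
    also have "\<dots> = (\<Sum>m\<in>Poly_Mapping.keys P. \<Sum>n\<in>Poly_Mapping.keys Q. poly_eval C x (?s P m * ?s Q n))"
      by (simp add: sum_product esum)
    also have "\<dots> = poly_eval C x P * poly_eval C x Q"
      by (simp add: sum_product mult_single poly_eval_single C' monomial_value_add poly_eval_def[of C x P] poly_eval_def[of C x Q] mult_ac)
    finally show ?thesis .
  qed
  have "poly_eval C x 1 = 1"
    using poly_eval_single[of C x 0 1] by (simp add: C')
  then show ?thesis
    by (simp add: ring_hom_fun_def add mult)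
qed

lemma poly_eval_const: "ring_hom_fun C \<Longrightarrow> poly_eval C x (poly_const c) = C c"
  by (simp add: poly_const_def poly_eval_single ring_hom_funD)

lemma poly_eval_var: "ring_hom_fun C \<Longrightarrow> poly_eval C x (poly_t_var k) = x k"
  by (simp add: poly_t_var_def poly_eval_single ring_hom_funD)

lemma poly_const_hom: "ring_hom_fun poly_const"
  by (simp add: ring_hom_fun_def poly_const_def single_add mult_single)

lemma mfps_of_poly_hom: "ring_hom_fun mfps_of_poly"
proof -
  have mult: "mfps_of_poly (P * Q) = mfps_of_poly P * mfps_of_poly Q" for P Q :: "('a \<Rightarrow>\<^sub>0 nat) \<Rightarrow>\<^sub>0 complex"
  proof (rule mfps_eqI)
    fix m
    have "mcoeff (mfps_of_poly P * mfps_of_poly Q) m =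
        (\<Sum>(p, q)\<in>msplits m. Poly_Mapping.lookup P p * Poly_Mapping.lookup Q q)"
      by (simp add: times_mfps.rep_eq mfps_of_poly_def)
    also have "\<dots> = (\<Sum>(p, q)\<in>Poly_Mapping.keys P \<times> Poly_Mapping.keys Q.
        if p + q = m then Poly_Mapping.lookup P p * Poly_Mapping.lookup Q q else 0)"
      by (rule sum.mono_neutral_cong)
        (use finite_msplits[of m] in \<open>auto simp: msplits_def in_keys_iff split: if_splits\<close>)
    also have "\<dots> = Poly_Mapping.lookup ((\<Sum>p\<in>Poly_Mapping.keys P. Poly_Mapping.single p (Poly_Mapping.lookup P p)) *
        (\<Sum>q\<in>Poly_Mapping.keys Q. Poly_Mapping.single q (Poly_Mapping.lookup Q q))) m"
      by (simp add: sum_product mult_single lookup_sum lookup_single when_def sum.cartesian_product case_prod_beta)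
    also have "\<dots> = mcoeff (mfps_of_poly (P * Q)) m"
      by (simp only: poly_mapping_sum_single[symmetric]) (simp add: mfps_of_poly_def)
    finally show "mcoeff (mfps_of_poly (P * Q)) m = mcoeff (mfps_of_poly P * mfps_of_poly Q) m" by simp
  qed
  have add: "mfps_of_poly (P + Q) = mfps_of_poly P + mfps_of_poly Q" for P Q :: "('a \<Rightarrow>\<^sub>0 nat) \<Rightarrow>\<^sub>0 complex"
    by (rule mfps_eqI) (simp add: mfps_of_poly_def plus_mfps.rep_eq lookup_add)
  have "mfps_of_poly 1 = (1 :: 'a mfps)"
    by (rule mfps_eqI) (simp add: mfps_of_poly_def one_mfps.rep_eq lookup_one when_def)
  then show ?thesis by (simp add: ring_hom_fun_def mult add)
qed

lemma mfps_of_poly_const: "mfps_of_poly (poly_const c) = mfps_const c"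
  by (rule mfps_eqI) (simp add: mfps_of_poly_def poly_const_def mfps_const_def lookup_single when_def)

lemma mfps_of_poly_var: "mfps_of_poly (poly_t_var k) = mfps_var k"
  by (rule mfps_eqI) (simp add: mfps_of_poly_def poly_t_var_def mfps_var_def lookup_single when_def)

lemma mfps_const_hom: "ring_hom_fun (mfps_const :: complex \<Rightarrow> nat mfps)"
  using ring_hom_fun_comp[OF mfps_of_poly_hom poly_const_hom] by (simp add: mfps_of_poly_const)

section \<open>Series whose logarithm is linear\<close>

lemma mcoeff_zero [simp]: "mcoeff 0 m = 0"
  by (simp add: zero_mfps.rep_eq)

lemma mcoeff_one: "mcoeff 1 m = (if m = 0 then 1 else 0)"
  by (simp add: one_mfps.rep_eq)

lemma mcoeff_add [simp]: "mcoeff (f + g) m = mcoeff f m + mcoeff g m"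
  by (simp add: plus_mfps.rep_eq)

lemma mcoeff_minus [simp]: "mcoeff (f - g) m = mcoeff f m - mcoeff g m"
  by (simp add: minus_mfps.rep_eq)

lemma mcoeff_uminus [simp]: "mcoeff (- f) m = - mcoeff f m"
  by (simp add: uminus_mfps.rep_eq)

lemma mcoeff_mult: "mcoeff (f * g) m = (\<Sum>(p, q)\<in>msplits m. mcoeff f p * mcoeff g q)"
  by (simp add: times_mfps.rep_eq)

lemma mcoeff_sum: "mcoeff (sum f X) m = (\<Sum>x\<in>X. mcoeff (f x) m)"
  by (induction X rule: infinite_finite_induct) simp_all

lemma mcoeff_const: "mcoeff (mfps_const c) m = (if m = 0 then c else 0)"
  by (simp add: mfps_const_def)

lemma mcoeff_var: "mcoeff (mfps_var v) m = (if m = Poly_Mapping.single v 1 then 1 else 0)"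
  by (simp add: mfps_var_def)

lemma mcoeff_const_mult [simp]:
  fixes f :: "'v mfps"
  shows "mcoeff (mfps_const c * f) m = c * mcoeff f m"
proof -
  have "mcoeff (mfps_const c * f) m = (\<Sum>(p, q)\<in>{(0, m)}. mcoeff (mfps_const c :: 'v mfps) p * mcoeff f q)"
    unfolding mcoeff_mult
    by (rule sum.mono_neutral_right[OF finite_msplits]) (auto simp: msplits_def mcoeff_const split: if_splits)
  then show ?thesis by (simp add: mcoeff_const)
qed

lemma mcoeff_mult_nonzeroE:
  assumes "mcoeff (f * g) m \<noteq> 0"
  obtains p q where "m = p + q" "mcoeff f p \<noteq> 0" "mcoeff g q \<noteq> 0"
proof -
  from assms obtain x where "x \<in> msplits m" "(case x of (p, q) \<Rightarrow> mcoeff f p * mcoeff g q) \<noteq> 0"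
    unfolding mcoeff_mult by (meson sum.not_neutral_contains_not_neutral)
  then show ?thesis using that by (auto simp: msplits_def)
qed

lemma mcoeff_deriv: "mcoeff (mfps_deriv v f) m = of_nat (Poly_Mapping.lookup m v + 1) * mcoeff f (m + Poly_Mapping.single v 1)"
  by (simp add: mfps_deriv_def)

lemma mfps_deriv_add: "mfps_deriv v (f + g) = mfps_deriv v f + mfps_deriv v g"
  by (rule mfps_eqI) (simp add: mcoeff_deriv algebra_simps)

lemma add_single_neq_zero [simp]: "m + Poly_Mapping.single v (Suc 0) \<noteq> 0"
proof
  assume "m + Poly_Mapping.single v (Suc 0) = 0"
  then have "Poly_Mapping.lookup (m + Poly_Mapping.single v (Suc 0)) v = Poly_Mapping.lookup 0 v"
    by (simp only:)
  then show False by (simp add: lookup_add)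
qed

lemma mfps_deriv_const [simp]: "mfps_deriv v (mfps_const c) = 0"
  by (rule mfps_eqI) (auto simp: mcoeff_deriv mcoeff_const)

lemma mfps_deriv_zero [simp]: "mfps_deriv v 0 = 0"
  by (rule mfps_eqI) (auto simp: mcoeff_deriv)

lemma mfps_deriv_one [simp]: "mfps_deriv v 1 = 0"
  by (rule mfps_eqI) (auto simp: mcoeff_deriv mcoeff_one)

lemma mfps_deriv_var: "mfps_deriv v (mfps_var w) = (if v = w then 1 else 0)"
proof (rule mfps_eqI)
  fix m :: "'a \<Rightarrow>\<^sub>0 nat"
  have "m + Poly_Mapping.single v 1 = Poly_Mapping.single w 1 \<longleftrightarrow> v = w \<and> m = 0"
  proof
    assume eq: "m + Poly_Mapping.single v 1 = Poly_Mapping.single w 1"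
    have "Poly_Mapping.lookup (m + Poly_Mapping.single v 1) v = Poly_Mapping.lookup (Poly_Mapping.single w 1) v"
      by (simp only: eq)
    then have "v = w" by (auto simp: lookup_add lookup_single when_def split: if_splits)
    with eq show "v = w \<and> m = 0" by simp
  qed simp
  then show "mcoeff (mfps_deriv v (mfps_var w)) m = mcoeff (if v = w then 1 else 0) m"
    by (auto simp: mcoeff_deriv mcoeff_var mcoeff_one)
qed

text \<open>The exponent of \<open>v\<close> in a product monomial is the sum of those in its
  factors, which splits the coefficient into two halves, one for each summand of the Leibniz
  rule.\<close>

lemma mfps_deriv_mult: "mfps_deriv v (f * g) = mfps_deriv v f * g + f * mfps_deriv v g"
proof (rule mfps_eqI)
  fix m
  let ?e = "Poly_Mapping.single v 1"
  let ?l = "\<lambda>p. Poly_Mapping.lookup p v"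
  have half: "(\<Sum>(p, q)\<in>msplits (m + ?e). of_nat (?l p) * mcoeff f p * mcoeff g q) = mcoeff (mfps_deriv v f * g) m" for f g :: "'a mfps"
  proof -
    have "(\<Sum>(p, q)\<in>msplits (m + ?e). of_nat (?l p) * mcoeff f p * mcoeff g q) =
        (\<Sum>(p, q)\<in>{(p, q) \<in> msplits (m + ?e). ?l p > 0}. of_nat (?l p) * mcoeff f p * mcoeff g q)"
      by (rule sum.mono_neutral_right) (auto simp: finite_msplits)
    also have "\<dots> = (\<Sum>(p, q)\<in>msplits m. of_nat (?l p + 1) * mcoeff f (p + ?e) * mcoeff g q)"
    proof (rule sum.reindex_bij_witness[where i = "\<lambda>(p, q). (p + ?e, q)" and j = "\<lambda>(p, q). (p - ?e, q)"])
      fix x assume "x \<in> {(p, q) \<in> msplits (m + ?e). ?l p > 0}"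
      then obtain p q where x: "x = (p, q)" "p + q = m + ?e" "?l p > 0" by (auto simp: msplits_def)
      have p: "p - ?e + ?e = p"
        using x(3) by (intro poly_mapping_eqI) (auto simp: lookup_add lookup_minus lookup_single when_def)
      have "(p - ?e + q) + ?e = m + ?e" using p x(2) by (metis add.assoc add.commute)
      then have "p - ?e + q = m" by simp
      then show "(case x of (p, q) \<Rightarrow> (p - ?e, q)) \<in> msplits m"
        using x(1) by (simp add: msplits_def)
      show "(case case x of (p, q) \<Rightarrow> (p - ?e, q) of (p, q) \<Rightarrow> (p + ?e, q)) = x"
        using x(1) p by simp
      have "?l (p - ?e) + 1 = ?l p" using x(3) by (simp add: lookup_minus)
      then show "(case case x of (p, q) \<Rightarrow> (p - ?e, q) of (p, q) \<Rightarrow> of_nat (?l p + 1) * mcoeff f (p + ?e) * mcoeff g q) =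
         (case x of (p, q) \<Rightarrow> of_nat (?l p) * mcoeff f p * mcoeff g q)"
        by (simp only: x(1) prod.case p)
    next
      fix y assume "y \<in> msplits m"
      then obtain p q where y: "y = (p, q)" "p + q = m" by (auto simp: msplits_def)
      have "p + ?e + q = m + ?e" using y(2) by (metis add.assoc add.commute)
      then show "(case y of (p, q) \<Rightarrow> (p + ?e, q)) \<in> {(p, q) \<in> msplits (m + ?e). ?l p > 0}"
        using y(1) by (simp add: msplits_def lookup_add)
      show "(case case y of (p, q) \<Rightarrow> (p + ?e, q) of (p, q) \<Rightarrow> (p - ?e, q)) = y"
        using y(1) by simp
    qed
    also have "\<dots> = mcoeff (mfps_deriv v f * g) m"
      by (simp add: mcoeff_mult mcoeff_deriv)
    finally show ?thesis .
  qed
  have "mcoeff (mfps_deriv v (f * g)) m =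
      (\<Sum>(p, q)\<in>msplits (m + ?e). of_nat (?l (m + ?e)) * (mcoeff f p * mcoeff g q))"
    by (simp add: mcoeff_deriv mcoeff_mult sum_distrib_left case_prod_beta lookup_add)
  also have "\<dots> = (\<Sum>(p, q)\<in>msplits (m + ?e). of_nat (?l p) * mcoeff f p * mcoeff g q + of_nat (?l q) * mcoeff g q * mcoeff f p)"
  proof (intro sum.cong refl)
    fix x assume "x \<in> msplits (m + ?e)"
    then obtain p q where x: "x = (p, q)" "p + q = m + ?e" by (auto simp: msplits_def)
    show "(case x of (p, q) \<Rightarrow> of_nat (?l (m + ?e)) * (mcoeff f p * mcoeff g q)) =
      (case x of (p, q) \<Rightarrow> of_nat (?l p) * mcoeff f p * mcoeff g q + of_nat (?l q) * mcoeff g q * mcoeff f p)"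
      by (simp only: x(2)[symmetric] x(1) prod.case lookup_add of_nat_add) (simp add: algebra_simps)
  qed
  also have "\<dots> = (\<Sum>(p, q)\<in>msplits (m + ?e). of_nat (?l p) * mcoeff f p * mcoeff g q)
      + (\<Sum>(p, q)\<in>msplits (m + ?e). of_nat (?l q) * mcoeff g q * mcoeff f p)"
    by (simp add: case_prod_beta sum.distrib)
  also have "(\<Sum>(p, q)\<in>msplits (m + ?e). of_nat (?l q) * mcoeff g q * mcoeff f p) =
      (\<Sum>(p, q)\<in>msplits (m + ?e). of_nat (?l p) * mcoeff g p * mcoeff f q)"
    by (rule sum.reindex_bij_witness[where i = prod.swap and j = prod.swap])
       (auto simp: msplits_def add.commute)
  finally show "mcoeff (mfps_deriv v (f * g)) m = mcoeff (mfps_deriv v f * g + f * mfps_deriv v g) m"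
    by (simp only: half mcoeff_add mult.commute[of f "mfps_deriv v g"])
qed

section \<open>The substitutions t + s and t - s\<close>

definition merge :: "('v + 'v \<Rightarrow>\<^sub>0 nat) \<Rightarrow> ('v \<Rightarrow>\<^sub>0 nat)" where
  "merge M = Abs_poly_mapping (\<lambda>v. Poly_Mapping.lookup M (Inl v) + Poly_Mapping.lookup M (Inr v))"

lemma lookup_merge: "Poly_Mapping.lookup (merge M) v = Poly_Mapping.lookup M (Inl v) + Poly_Mapping.lookup M (Inr v)"
proof -
  have "finite (Inl -` Poly_Mapping.keys M \<union> Inr -` Poly_Mapping.keys M)"
    by (intro finite_UnI finite_vimageI) auto
  then have "finite {v. Poly_Mapping.lookup M (Inl v) + Poly_Mapping.lookup M (Inr v) \<noteq> 0}"
    by (rule finite_subset[rotated]) (auto simp: in_keys_iff)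
  then show ?thesis by (simp add: merge_def lookup_Abs_poly_mapping)
qed

lemma merge_add: "merge (M + M') = merge M + merge M'"
  by (rule poly_mapping_eqI) (simp add: lookup_merge lookup_add)

lemma merge_zero: "merge 0 = 0"
  by (rule poly_mapping_eqI) (simp add: lookup_merge)

lemma merge_single: "merge (Poly_Mapping.single (Inl v) n) = Poly_Mapping.single v n"
  "merge (Poly_Mapping.single (Inr v) n) = Poly_Mapping.single v n"
  by (rule poly_mapping_eqI, simp add: lookup_merge lookup_single when_def)+

text \<open>Replacing t_j by t_j + \<epsilon> s_j preserves the joint degree in each pair t_j, s_j.
  Hence only the monomial \<open>merge M\<close> contributes to the coefficient at \<open>M\<close>,
  and the formal sum in \<open>mfps_subst\<close> collapses to one term.\<close>

definition supported_over :: "('v \<Rightarrow>\<^sub>0 nat) \<Rightarrow> ('v + 'v) mfps \<Rightarrow> bool" where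
  "supported_over m f \<longleftrightarrow> (\<forall>M. mcoeff f M \<noteq> 0 \<longrightarrow> merge M = m)"

lemma supported_over_mult: "supported_over m f \<Longrightarrow> supported_over n g \<Longrightarrow> supported_over (m + n) (f * g)"
  by (auto simp: supported_over_def merge_add elim!: mcoeff_mult_nonzeroE)

lemma supported_over_one: "supported_over 0 1"
  by (auto simp: supported_over_def mcoeff_one merge_zero)

lemma supported_over_power:
  assumes "supported_over (Poly_Mapping.single v 1) f"
  shows "supported_over (Poly_Mapping.single v n) (f ^ n)"
proof (induction n)
  case (Suc n)
  from supported_over_mult[OF assms this] show ?case
    by (simp add: single_add[symmetric])
qed (simp add: supported_over_one)

lemma supported_over_prod:
  assumes "\<And>v. v \<in> X \<Longrightarrow> supported_over (m v) (f v)"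
  shows "supported_over (sum m X) (prod f X)"
  using assms
  by (induction X rule: infinite_finite_induct) (auto simp: supported_over_one intro: supported_over_mult)

definition shift_var :: "complex \<Rightarrow> nat \<Rightarrow> (nat + nat) mfps" where
  "shift_var \<epsilon> j = mfps_var (Inl j) + mfps_const \<epsilon> * mfps_var (Inr j)"

definition monomial_at :: "('v \<Rightarrow> 'r) \<Rightarrow> ('v \<Rightarrow>\<^sub>0 nat) \<Rightarrow> 'r::comm_ring_1" where
  "monomial_at \<sigma> m = (\<Prod>v\<in>Poly_Mapping.keys m. \<sigma> v ^ Poly_Mapping.lookup m v)"

lemma supported_over_monomial: "supported_over m (monomial_at (shift_var \<epsilon>) m)"
proof -
  have "supported_over (\<Sum>v\<in>Poly_Mapping.keys m. Poly_Mapping.single v (Poly_Mapping.lookup m v)) (monomial_at (shift_var \<epsilon>) m)"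
    unfolding monomial_at_def
    by (intro supported_over_prod supported_over_power)
      (auto simp: supported_over_def shift_var_def mcoeff_var merge_single split: if_splits)
  then show ?thesis by (simp only: poly_mapping_sum_single[symmetric])
qed

lemma mcoeff_subst_shift:
  "mcoeff (mfps_subst (shift_var \<epsilon>) f) M = mcoeff f (merge M) * mcoeff (monomial_at (shift_var \<epsilon>) (merge M)) M"
proof -
  let ?t = "\<lambda>m. mcoeff f m * mcoeff (monomial_at (shift_var \<epsilon>) m) M"
  have "mcoeff (mfps_subst (shift_var \<epsilon>) f) M = (\<Sum>m | ?t m \<noteq> 0. ?t m)"
    by (simp add: mfps_subst_def formal_sum_def monomial_at_def)
  also have "\<dots> = (\<Sum>m\<in>{merge M}. ?t m)"
    using supported_over_monomial[of _ \<epsilon>] unfolding supported_over_def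
    by (intro sum.mono_neutral_left) auto
  finally show ?thesis by simp
qed

lemma deriv_shift_var: "mfps_deriv (Inr j) (shift_var \<epsilon> v) = (if v = j then mfps_const \<epsilon> else 0)"
  by (auto simp: shift_var_def mfps_deriv_add mfps_deriv_mult mfps_deriv_var)

lemma mfps_deriv_power: "mfps_deriv w (f ^ Suc n) = of_nat (Suc n) * f ^ n * mfps_deriv w f"
  by (induction n) (simp_all add: mfps_deriv_mult algebra_simps)

lemma deriv_monomial_shift:
  "mfps_deriv (Inr j) (monomial_at (shift_var \<epsilon>) (m + Poly_Mapping.single j 1)) =
     mfps_const \<epsilon> * (of_nat (Poly_Mapping.lookup m j + 1) * monomial_at (shift_var \<epsilon>) m)"
proof -
  let ?\<sigma> = "shift_var \<epsilon>" and ?e = "Poly_Mapping.single j (1::nat)"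
  define X where "X = Poly_Mapping.keys m - {j}"
  define R where "R = (\<Prod>v\<in>X. ?\<sigma> v ^ Poly_Mapping.lookup m v)"
  have split: "monomial_at ?\<sigma> p = ?\<sigma> j ^ Poly_Mapping.lookup p j * (\<Prod>v\<in>X. ?\<sigma> v ^ Poly_Mapping.lookup p v)"
    if "Poly_Mapping.keys p \<subseteq> insert j X" for p
  proof -
    have "monomial_at ?\<sigma> p = (\<Prod>v\<in>insert j X. ?\<sigma> v ^ Poly_Mapping.lookup p v)"
      unfolding monomial_at_def using that by (intro prod.mono_neutral_left) (auto simp: X_def in_keys_iff)
    also have "\<dots> = ?\<sigma> j ^ Poly_Mapping.lookup p j * (\<Prod>v\<in>X. ?\<sigma> v ^ Poly_Mapping.lookup p v)"
      by (rule prod.insert) (auto simp: X_def)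
    finally show ?thesis .
  qed
  have "mfps_deriv (Inr j) (?\<sigma> v ^ n) = 0" if "v \<noteq> j" for v n
    using that by (cases n) (simp_all add: mfps_deriv_power deriv_shift_var del: power_Suc)
  then have R: "mfps_deriv (Inr j) (\<Prod>v\<in>Y. ?\<sigma> v ^ Poly_Mapping.lookup m v) = 0" if "j \<notin> Y" for Y
    using that by (induction Y rule: infinite_finite_induct) (auto simp: mfps_deriv_mult)
  have m: "monomial_at ?\<sigma> m = ?\<sigma> j ^ Poly_Mapping.lookup m j * R"
    unfolding R_def by (rule split) (auto simp: X_def)
  have "monomial_at ?\<sigma> (m + ?e) = ?\<sigma> j ^ Poly_Mapping.lookup (m + ?e) j * (\<Prod>v\<in>X. ?\<sigma> v ^ Poly_Mapping.lookup (m + ?e) v)"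
    by (rule split) (use Poly_Mapping.keys_add[of m ?e] in \<open>auto simp: X_def\<close>)
  also have "(\<Prod>v\<in>X. ?\<sigma> v ^ Poly_Mapping.lookup (m + ?e) v) = R"
    unfolding R_def by (rule prod.cong) (auto simp: X_def lookup_add lookup_single)
  finally have "monomial_at ?\<sigma> (m + ?e) = ?\<sigma> j ^ Suc (Poly_Mapping.lookup m j) * R"
    by (simp add: lookup_add)
  then have "mfps_deriv (Inr j) (monomial_at ?\<sigma> (m + ?e)) = mfps_deriv (Inr j) (?\<sigma> j ^ Suc (Poly_Mapping.lookup m j)) * R"
    using R[of X] by (simp add: mfps_deriv_mult R_def X_def del: power_Suc)
  then show ?thesis
    by (simp add: mfps_deriv_power deriv_shift_var m mult_ac del: power_Suc)
qed

lemma mcoeff_of_nat_mult: "mcoeff (of_nat n * f) m = of_nat n * mcoeff f m"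
  by (induction n) (simp_all add: distrib_right)

lemma deriv_subst_shift:
  "mfps_deriv (Inr j) (mfps_subst (shift_var \<epsilon>) f) = mfps_const \<epsilon> * mfps_subst (shift_var \<epsilon>) (mfps_deriv j f)"
proof (rule mfps_eqI)
  fix M
  let ?E = "Poly_Mapping.single (Inr j) (1::nat)" and ?e = "Poly_Mapping.single j (1::nat)"
  have "of_nat (Poly_Mapping.lookup M (Inr j) + 1) * mcoeff (monomial_at (shift_var \<epsilon>) (merge M + ?e)) (M + ?E) =
      mcoeff (mfps_deriv (Inr j) (monomial_at (shift_var \<epsilon>) (merge M + ?e))) M"
    by (simp add: mcoeff_deriv)
  also have "\<dots> = \<epsilon> * of_nat (Poly_Mapping.lookup (merge M) j + 1) * mcoeff (monomial_at (shift_var \<epsilon>) (merge M)) M"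
    by (simp only: deriv_monomial_shift mcoeff_const_mult mcoeff_of_nat_mult mult.assoc)
  finally have eq: "of_nat (Poly_Mapping.lookup M (Inr j) + 1) * mcoeff (monomial_at (shift_var \<epsilon>) (merge M + ?e)) (M + ?E) = \<dots>" .
  have "mcoeff (mfps_deriv (Inr j) (mfps_subst (shift_var \<epsilon>) f)) M = mcoeff f (merge M + ?e) *
      (of_nat (Poly_Mapping.lookup M (Inr j) + 1) * mcoeff (monomial_at (shift_var \<epsilon>) (merge M + ?e)) (M + ?E))"
    by (simp only: mcoeff_deriv mcoeff_subst_shift merge_add merge_single mult_ac)
  also have "\<dots> = mcoeff (mfps_const \<epsilon> * mfps_subst (shift_var \<epsilon>) (mfps_deriv j f)) M"
    unfolding eq by (simp only: mcoeff_const_mult mcoeff_deriv mcoeff_subst_shift mult_ac)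
  finally show "mcoeff (mfps_deriv (Inr j) (mfps_subst (shift_var \<epsilon>) f)) M =
      mcoeff (mfps_const \<epsilon> * mfps_subst (shift_var \<epsilon>) (mfps_deriv j f)) M" .
qed

lemma subst_const_mult:
  "mfps_subst (shift_var \<epsilon>) (mfps_const c * f) = mfps_const c * mfps_subst (shift_var \<epsilon>) f"
  by (rule mfps_eqI) (simp add: mcoeff_subst_shift)

text \<open>Differentiating f(t + s) f(t - s) in s_j gives \<open>b j\<close> once with each sign,
  so the product is annihilated by the vertex operator. Its exponential then has no positive power
  of 1/z, while the residue uses only the coefficients \<open>i + 1\<close>.\<close>

lemma KP_residue_zero:
  assumes "\<And>j. mfps_deriv j f = mfps_const (b j) * f"
  shows "KP_residue f = 0"
proof -
  have plus: "(\<lambda>j. t_var j + s_var j) = shift_var 1" and minus: "(\<lambda>j. t_var j - s_var j) = shift_var (- 1)"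
    by (auto simp: shift_var_def fun_eq_iff intro!: mfps_eqI)
  define P where "P = mfps_subst (shift_var 1) f * mfps_subst (shift_var (- 1)) f"
  have dP: "mfps_deriv (Inr j) P = 0" for j
  proof -
    have 1: "mfps_const 1 * g = g" "mfps_const (- 1) * g = - g" for g :: "(nat + nat) mfps"
      by (rule mfps_eqI, simp)+
    have "mfps_deriv (Inr j) P = (mfps_const (b j) * mfps_subst (shift_var 1) f) * mfps_subst (shift_var (- 1)) f
        + mfps_subst (shift_var 1) f * - (mfps_const (b j) * mfps_subst (shift_var (- 1)) f)"
      unfolding P_def mfps_deriv_mult deriv_subst_shift assms subst_const_mult 1 ..
    then show ?thesis by (simp add: mult_ac)
  qed
  have v0: "vertex_op 0 = 0"
    by (rule fps_ext) (simp add: vertex_op_def)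
  have "vertex_op (fps_const P) $ n = 0" for n
  proof -
    have "mfps_deriv (Inr j) (fps_const P $ i) = 0" for i j
      by (cases "i = 0") (simp_all add: dP)
    then show ?thesis
      by (simp only: vertex_op_def fps_nth_Abs_fps mult_zero_right sum.neutral_const minus_zero)
  qed
  then have v1: "vertex_op (fps_const P) = 0"
    by (intro fps_ext) simp
  have vk: "(vertex_op ^^ Suc k) (fps_const P) = 0" for k
    by (induction k) (simp_all add: v0 v1)
  have "exp_vertex_op P $ Suc n = 0" for n
  proof -
    have "(vertex_op ^^ k) (fps_const P) $ Suc n = 0" for k
    proof (cases k)
      case (Suc i)
      show ?thesis unfolding Suc vk by simp
    qed simp
    then show ?thesis by (simp add: exp_vertex_op_def)
  qed
  then show ?thesis
    by (intro mfps_eqI) (simp add: KP_residue_def Let_def plus minus P_def[symmetric] formal_sum_def)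
qed

section \<open>Schur Q-functions indexed by finite sets\<close>

definition desc :: "nat set \<Rightarrow> nat list" where
  "desc I = rev (sorted_list_of_set I)"

lemma desc_props:
  assumes "finite I"
  shows "sorted_wrt (>) (desc I)" "set (desc I) = I" "length (desc I) = card I" "distinct (desc I)"
  using assms by (simp_all add: desc_def sorted_wrt_rev)

lemma desc_set:
  assumes "sorted_wrt (>) xs"
  shows "desc (set xs) = xs"
proof -
  have "sorted_wrt (<) (rev xs)" using assms by (simp add: sorted_wrt_rev)
  then have "sorted_list_of_set (set (rev xs)) = rev xs"
    by (meson strict_sorted_iff sorted_list_of_set.idem_if_sorted_distinct)
  then show ?thesis by (simp add: desc_def)
qed

lemma desc_insert:
  assumes "J \<subseteq> {..<m}"
  shows "desc (insert m J) = m # desc J"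
proof -
  have fin: "finite J" using assms finite_subset by blast
  have "sorted_wrt (>) (m # desc J)"
    using desc_props(1,2)[OF fin] assms by auto
  then show ?thesis using desc_set[of "m # desc J"] desc_props(2)[OF fin] by simp
qed

lemma desc_remove:
  assumes "finite J" "j < card J"
  shows "desc (J - {desc J ! j}) = take j (desc J) @ drop (Suc j) (desc J)"
proof -
  let ?xs = "desc J"
  note P = desc_props[OF assms(1)]
  have xs: "?xs = take j ?xs @ ?xs ! j # drop (Suc j) ?xs"
    using assms P by (simp add: id_take_nth_drop)
  have s: "sorted_wrt (>) (take j ?xs @ ?xs ! j # drop (Suc j) ?xs)" and d: "distinct (take j ?xs @ ?xs ! j # drop (Suc j) ?xs)"
    using P xs by auto
  have "set (take j ?xs @ drop (Suc j) ?xs) = set (take j ?xs @ ?xs ! j # drop (Suc j) ?xs) - {?xs ! j}"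
    using d by auto
  also have "\<dots> = J - {?xs ! j}" using xs P by simp
  finally have "set (take j ?xs @ drop (Suc j) ?xs) = J - {?xs ! j}" .
  moreover have "sorted_wrt (>) (take j ?xs @ drop (Suc j) ?xs)"
    using s by (simp add: sorted_wrt_append)
  ultimately show ?thesis using desc_set by metis
qed

lemma sg_desc_nth:
  assumes "finite J" "j < card J"
  shows "sg (desc J ! j) J = (-1) ^ j"
proof -
  let ?xs = "desc J"
  note P = desc_props[OF assms(1)]
  have xs: "?xs = take j ?xs @ ?xs ! j # drop (Suc j) ?xs"
    using assms P by (simp add: id_take_nth_drop)
  have s: "sorted_wrt (>) (take j ?xs @ ?xs ! j # drop (Suc j) ?xs)"
    using P xs by auto
  have "J = set (take j ?xs @ ?xs ! j # drop (Suc j) ?xs)" using xs P by metis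
  then have "{x \<in> J. ?xs ! j < x} = {x \<in> set (take j ?xs @ ?xs ! j # drop (Suc j) ?xs). ?xs ! j < x}"
    by metis
  also have "\<dots> = set (take j ?xs)"
    using s by (auto simp: sorted_wrt_append)
  finally have "card {x \<in> J. ?xs ! j < x} = card (set (take j ?xs))" by simp
  also have "\<dots> = j" using P assms by (simp add: distinct_card)
  finally show ?thesis by (simp add: sg_def)
qed

text \<open>The value 0 on sets of odd size makes the row expansion \<open>pf_top\<close> hold for
  every \<open>J\<close>.\<close>

definition pf :: "(nat \<Rightarrow> nat \<Rightarrow> 'r) \<Rightarrow> nat set \<Rightarrow> 'r::comm_ring_1" where
  "pf B I = (if even (card I) then pfaffian (card I div 2) (\<lambda>i j. B (desc I ! i) (desc I ! j)) else 0)"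

lemma pfaffian_cong:
  assumes "\<And>i j. i < 2 * n \<Longrightarrow> j < 2 * n \<Longrightarrow> A i j = B i j"
  shows "pfaffian n A = pfaffian n B"
  unfolding pfaffian_alt
proof (intro sum.cong refl arg_cong2[of _ _ _ _ "(*)"] prod.cong)
  fix p i assume "p \<in> {p. matching_perm n p}" "i \<in> {..<n}"
  then have p: "p permutes {..<2 * n}" and i: "i < n" by (auto simp: matching_perm_def)
  have "p x < 2 * n" if "x < 2 * n" for x
    using permutes_in_image[OF p, of x] that by simp
  then show "A (p (2 * i)) (p (2 * i + 1)) = B (p (2 * i)) (p (2 * i + 1))"
    using i by (intro assms) auto
qed

text \<open>\<open>pfaffian_Suc\<close> in terms of sets: deleting the entry at position
  \<open>j\<close> of the decreasing list removes one element, and \<open>j\<close> larger elements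
  precede it. If \<open>card J\<close> is even, both sides vanish by parity.\<close>

lemma pf_top:
  assumes J: "J \<subseteq> {..<m}"
  shows "pf B (insert m J) = (\<Sum>x\<in>J. sg x J * B m x * pf B (J - {x}))"
proof -
  have fin: "finite J" using J finite_subset by blast
  have mJ: "m \<notin> J" using J by auto
  show ?thesis
  proof (cases "odd (card J)")
    case False
    then have "pf B (J - {x}) = 0" if "x \<in> J" for x
      using that fin by (auto simp: pf_def card_Diff_singleton card_gt_0_iff)
    then show ?thesis using False fin mJ by (simp add: pf_def)
  next
    case True
    then obtain n where n: "card J = 2 * n + 1" by (elim oddE)
    note P = desc_props[OF fin]
    let ?xs = "desc J"
    have "pf B (insert m J) = pfaffian (Suc n) (\<lambda>i j. B ((m # ?xs) ! i) ((m # ?xs) ! j))"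
      using fin mJ n J by (simp add: pf_def desc_insert)
    also have "\<dots> = (\<Sum>j<2 * n + 1. (-1) ^ j * B m (?xs ! j) *
       pfaffian n (\<lambda>i l. B ((m # ?xs) ! skip j i) ((m # ?xs) ! skip j l)))"
      by (simp add: pfaffian_Suc)
    also have "\<dots> = (\<Sum>j<2 * n + 1. sg (?xs ! j) J * B m (?xs ! j) * pf B (J - {?xs ! j}))"
    proof (intro sum.cong refl)
      fix j assume "j \<in> {..<2 * n + 1}"
      then have j: "j < card J" by (simp add: n)
      then have mem: "?xs ! j \<in> J" using P by (metis nth_mem)
      have c: "card (J - {?xs ! j}) = 2 * n" using mem fin n by simp
      have nth: "(m # ?xs) ! skip j i = (take j ?xs @ drop (Suc j) ?xs) ! i" if "i < 2 * n" for i
        using that n P(3) j by (auto simp: skip_def nth_append)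
      have "pf B (J - {?xs ! j}) = pfaffian n (\<lambda>i l. B ((m # ?xs) ! skip j i) ((m # ?xs) ! skip j l))"
        unfolding pf_def c desc_remove[OF fin j] using nth by (simp, intro pfaffian_cong) simp
      then show "(-1) ^ j * B m (?xs ! j) * pfaffian n (\<lambda>i l. B ((m # ?xs) ! skip j i) ((m # ?xs) ! skip j l)) =
          sg (?xs ! j) J * B m (?xs ! j) * pf B (J - {?xs ! j})"
        by (simp only: sg_desc_nth[OF fin j])
    qed
    also have "\<dots> = (\<Sum>x\<in>J. sg x J * B m x * pf B (J - {x}))"
    proof (rule sum.reindex_bij_betw)
      show "bij_betw ((!) ?xs) {..<2 * n + 1} J"
        using bij_betw_nth[OF P(4), of "{..<2 * n + 1}" J] P n by simp
    qed
    finally show ?thesis .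
  qed
qed

lemma pf_empty: "pf B {} = 1"
  by (simp add: pf_def pfaffian_0)

lemma gaussian_pf:
  fixes B :: "nat \<Rightarrow> nat \<Rightarrow> 'r::comm_ring_1" and half :: 'r
  assumes "2 * half = 1" "\<And>i j. B i j = - B j i" "\<And>i. B i i = 0"
  shows "gaussian N B (pf B)"
  by (rule gaussianI[OF assms pf_empty pf_top])

text \<open>Evaluation at a and substitution of 2t are both ring homomorphisms on the polynomials in
  t, so one locale makes both families Gaussian.\<close>

locale schur_eval =
  fixes h :: "poly_t \<Rightarrow> 'r::comm_ring_1"
  assumes h_hom: "ring_hom_fun h"
begin

definition hc :: "complex \<Rightarrow> 'r" where "hc c = h (poly_const c)"
definition hx :: "nat \<Rightarrow> 'r" where "hx k = h (poly_t_var k)"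

lemma hc_hom: "ring_hom_fun hc"
  unfolding hc_def using ring_hom_fun_comp[OF h_hom poly_const_hom] .

sublocale odd_exp hc hx
  by standard (rule hc_hom)

lemma h_schur_q: "h (schur_q n) = q n"
  unfolding schur_q_def q_def
  by (rule exp_series_hom[OF h_hom]) (simp_all add: F_def hx_def hc_def ring_hom_funD[OF h_hom])

sublocale schur_matrix q "hc (1 / 2)" "hc (1 / of_real (sqrt 2))"
proof -
  interpret q_sequence q "hc (1 / 2)" by (rule q_sequence)
  show "schur_matrix q (hc (1 / 2)) (hc (1 / of_real (sqrt 2)))"
  proof
    have "1 / complex_of_real (sqrt 2) * (1 / complex_of_real (sqrt 2)) = 1 / 2"
      by (simp flip: of_real_mult)
    then show "hc (1 / of_real (sqrt 2)) * hc (1 / of_real (sqrt 2)) = hc (1 / 2)"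
      by (simp only: ring_hom_funD(3)[OF hc_hom, symmetric])
  qed
qed

lemma h_schur_Q2: "h (schur_Q2 i j) = A i j"
proof -
  note H = ring_hom_funD[OF h_hom]
  have "h (schur_Q_gt a b) = A_gt a b" for a b
    by (simp add: schur_Q_gt_def A_gt_def H h_schur_q ring_hom_fun_sum[OF h_hom] ring_hom_fun_power[OF h_hom] flip: hc_def)
  then show ?thesis by (simp add: schur_Q2_def A_def H)
qed

lemma h_schur_Q:
  assumes "l \<in> DP"
  shows "h (schur_Q l) = pf A (set (augment l))"
proof -
  have "sorted_wrt (>) (augment l)"
    using assms by (auto simp: DP_def augment_def sorted_wrt_append)
  then have d: "desc (set (augment l)) = augment l" by (rule desc_set)
  then have c: "card (set (augment l)) = length (augment l)"
    using desc_props(3)[of "set (augment l)"] by simp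
  have "even (length (augment l))" by (simp add: augment_def)
  then show ?thesis
    by (simp add: pf_def c d schur_Q_def pfaffian_def ring_hom_fun_sum[OF h_hom] ring_hom_funD[OF h_hom]
        ring_hom_fun_prod[OF h_hom] ring_hom_fun_of_int[OF h_hom] h_schur_Q2)
qed

lemma gaussian_A: "gaussian N A (pf A)"
  by (rule gaussian_pf[OF half A_skew A_diag])

end

section \<open>The Cauchy identity\<close>

definition wdeg :: "(nat \<Rightarrow>\<^sub>0 nat) \<Rightarrow> nat" where
  "wdeg m = (\<Sum>k\<in>Poly_Mapping.keys m. k * Poly_Mapping.lookup m k)"

lemma wdeg_add: "wdeg (m + n) = wdeg m + wdeg n"
proof -
  define S where "S = Poly_Mapping.keys m \<union> Poly_Mapping.keys n"
  have *: "wdeg p = (\<Sum>k\<in>S. k * Poly_Mapping.lookup p k)" if "Poly_Mapping.keys p \<subseteq> S" for p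
    unfolding wdeg_def using that by (intro sum.mono_neutral_left) (auto simp: S_def in_keys_iff)
  show ?thesis
    using *[of m] *[of n] *[of "m + n"] Poly_Mapping.keys_add[of m n]
    by (simp add: S_def lookup_add sum.distrib distrib_left)
qed

lemma wdeg_0 [simp]: "wdeg 0 = 0"
  by (simp add: wdeg_def)

lemma wdeg_single [simp]: "wdeg (Poly_Mapping.single k n) = k * n"
  by (simp add: wdeg_def)

text \<open>The weight makes the series summable; the restriction to odd times, carried along with
  it, gives the reduction from KP to KdV.\<close>

definition graded :: "nat \<Rightarrow> nat mfps \<Rightarrow> bool" where
  "graded d f \<longleftrightarrow> (\<forall>m. mcoeff f m \<noteq> 0 \<longrightarrow> wdeg m = d \<and> Poly_Mapping.keys m \<subseteq> {k. odd k})"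

lemma graded_0 [simp]: "graded d 0"
  by (simp add: graded_def)

lemma graded_1: "graded 0 1"
  by (simp add: graded_def mcoeff_one)

lemma graded_add: "graded d f \<Longrightarrow> graded d g \<Longrightarrow> graded d (f + g)"
  unfolding graded_def by (metis add.right_neutral mcoeff_add)

lemma graded_uminus: "graded d f \<Longrightarrow> graded d (- f)"
  by (simp add: graded_def)

lemma graded_const: "graded 0 (mfps_const c)"
  by (simp add: graded_def mcoeff_const)

lemma graded_mult:
  assumes "graded d f" "graded e g"
  shows "graded (d + e) (f * g)"
  unfolding graded_def
proof (intro allI impI)
  fix m assume "mcoeff (f * g) m \<noteq> 0"
  then obtain p q where "m = p + q" "mcoeff f p \<noteq> 0" "mcoeff g q \<noteq> 0"
    by (rule mcoeff_mult_nonzeroE)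
  moreover from this have "wdeg p = d" "wdeg q = e" "Poly_Mapping.keys p \<union> Poly_Mapping.keys q \<subseteq> {k. odd k}"
    using assms unfolding graded_def by blast+
  ultimately show "wdeg m = d + e \<and> Poly_Mapping.keys m \<subseteq> {k. odd k}"
    using order.trans[OF Poly_Mapping.keys_add[of p q]] by (simp add: wdeg_add)
qed

lemma graded_scale: "graded 0 c \<Longrightarrow> graded d f \<Longrightarrow> graded d (c * f)"
  using graded_mult[of 0 c d f] by simp

lemma graded_sum: "(\<And>x. x \<in> X \<Longrightarrow> graded d (f x)) \<Longrightarrow> graded d (sum f X)"
  by (induction X rule: infinite_finite_induct) (auto intro: graded_add)

lemma graded_minus_one_power: "graded 0 ((-1) ^ n)"
  by (cases "even n") (simp_all add: graded_1 graded_uminus)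

lemma graded_var: "odd k \<Longrightarrow> graded k (mfps_var k)"
  by (simp add: graded_def mcoeff_var)

text \<open>In \<open>pf_top\<close> the factor \<open>B m x\<close> has weight
  \<open>m + x\<close>, exactly the elements missing from the remaining set.\<close>

lemma graded_pf:
  assumes B: "\<And>i j. graded (i + j) (B i j)" and "finite I"
  shows "graded (\<Sum>I) (pf B I)"
  using \<open>finite I\<close>
proof (induction "card I" arbitrary: I rule: less_induct)
  case less
  show ?case
  proof (cases "I = {}")
    case True
    then show ?thesis by (simp add: pf_empty graded_1)
  next
    case False
    define m where "m = Max I"
    define J where "J = I - {m}"
    have m: "m \<in> I" using False less.prems by (simp add: m_def)
    have I: "I = insert m J" "m \<notin> J" "finite J" using m less.prems by (auto simp: J_def)
    have J: "J \<subseteq> {..<m}"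
    proof
      fix y assume "y \<in> J"
      then have "y \<in> I" "y \<noteq> m" by (auto simp: J_def)
      then show "y \<in> {..<m}" using Max_ge[OF less.prems, of y] by (simp add: m_def)
    qed
    have "graded (\<Sum>I) (sg x J * B m x * pf B (J - {x}))" if x: "x \<in> J" for x
    proof -
      have "card (J - {x}) < card I"
        by (rule order.strict_trans1[OF card_Diff1_le]) (simp add: I)
      then have "graded (\<Sum>(J - {x})) (pf B (J - {x}))"
        using I by (intro less.hyps) auto
      then have "graded (0 + (m + x) + \<Sum>(J - {x})) (sg x J * B m x * pf B (J - {x}))"
        by (intro graded_mult B) (simp_all add: sg_def graded_minus_one_power)
      moreover have "0 + (m + x) + \<Sum>(J - {x}) = \<Sum>I"
        using I x by (simp add: sum.remove[of J x])
      ultimately show ?thesis by simp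
    qed
    then show ?thesis
      unfolding I(1) pf_top[OF J] by (rule graded_sum) (simp add: I(1))
  qed
qed

lemma poly_eval_const_hom_2t: "ring_hom_fun (\<lambda>P. mfps_of_poly (poly_eval poly_const (\<lambda>k. 2 * poly_t_var k) P))"
  by (rule ring_hom_fun_comp[OF mfps_of_poly_hom poly_eval_hom[OF poly_const_hom]])

interpretation Qt: schur_eval "\<lambda>P. mfps_of_poly (poly_eval poly_const (\<lambda>k. 2 * poly_t_var k) P)"
  by standard (rule poly_eval_const_hom_2t)

lemma Qt_hc: "Qt.hc c = mfps_const c"
  by (simp add: Qt.hc_def poly_eval_const poly_const_hom mfps_of_poly_const)

lemma graded_hc: "graded 0 (Qt.hc c)"
  by (simp add: Qt_hc graded_const)

lemma Qt_hx: "Qt.hx k = 2 * mfps_var k"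
  by (simp add: Qt.hx_def poly_eval_var poly_const_hom mfps_of_poly_var
      ring_hom_funD[OF mfps_of_poly_hom] ring_hom_fun_numeral[OF mfps_of_poly_hom])

lemma graded_q: "graded n (Qt.q n)"
proof -
  have 2: "graded 0 (2 :: nat mfps)"
    using graded_add[OF graded_1 graded_1] by simp
  have F: "graded n (Qt.F $ n)" for n
    by (simp add: Qt.F_nth Qt_hx graded_scale[OF 2] graded_var)
  have "graded n ((Qt.F ^ i) $ n)" for i n
  proof (induction i arbitrary: n)
    case 0
    then show ?case by (simp add: graded_1)
  next
    case (Suc i)
    have "graded n (Qt.F $ j * (Qt.F ^ i) $ (n - j))" if "j \<in> {0..n}" for j
      using graded_mult[OF F[of j] Suc[of "n - j"]] that by simp
    then show ?case
      by (auto simp: fps_mult_nth intro!: graded_sum)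
  qed
  then show ?thesis
    unfolding Qt.q_def exp_series_nth Qt_hc by (intro graded_sum graded_scale[OF graded_const])
qed

lemma graded_A: "graded (i + j) (Qt.A i j)"
proof -
  have gt: "graded (a + b) (Qt.A_gt a b)" for a b
  proof (cases "b = 0")
    case True
    then show ?thesis
      unfolding Qt.A_gt_def by (simp add: graded_scale[OF graded_hc] graded_q)
  next
    case False
    have "graded (a + b) ((-1) ^ k * Qt.q (a + k) * Qt.q (b - k))" if "k \<in> {1..b}" for k
      using graded_mult[OF graded_scale[OF graded_minus_one_power[of k] graded_q[of "a + k"]] graded_q[of "b - k"]] that
      by simp
    moreover have "graded (a + b) (Qt.hc (1 / 2) * Qt.q a * Qt.q b)"
      by (intro graded_mult graded_scale[OF graded_hc] graded_q)
    ultimately show ?thesis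
      using False unfolding Qt.A_gt_def by (auto intro!: graded_add graded_sum)
  qed
  show ?thesis
    using gt[of i j] gt[of j i] by (auto simp: Qt.A_def graded_uminus add.commute)
qed

definition Qt_pf :: "nat set \<Rightarrow> nat mfps" where "Qt_pf = pf Qt.A"

lemma graded_Qt_pf: "finite I \<Longrightarrow> graded (\<Sum>I) (Qt_pf I)"
  unfolding Qt_pf_def by (rule graded_pf[OF graded_A])

lemma deriv_Qt_pf:
  assumes "I \<subseteq> {..<N}" "2 * K + 1 < N"
  shows "mfps_deriv (2 * K + 1) (Qt_pf I) = 2 * lower (mfps_const (1 / of_real (sqrt 2))) K N Qt_pf I"
proof -
  let ?D = "mfps_deriv (2 * K + 1)"
  have q: "?D (Qt.q n) = 2 * (if n \<ge> 2 * K + 1 then Qt.q (n - (2 * K + 1)) else 0)" for n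
  proof (rule Qt.derivation_q)
    fix j :: nat
    have "?D 2 = ?D (1 + 1)" by simp
    also have "\<dots> = 0" unfolding mfps_deriv_add by simp
    finally show "?D (Qt.hx j) = (if j = 2 * K + 1 then 2 else 0)"
      by (simp add: Qt_hx mfps_deriv_mult mfps_deriv_var)
  qed (simp_all add: mfps_deriv_add mfps_deriv_mult Qt_hc)
  show ?thesis
    using Qt.deriv_gaussian[OF Qt.gaussian_A[of N] mfps_deriv_add mfps_deriv_mult _ _ q assms]
    by (simp add: Qt_pf_def Qt_hc)
qed

text \<open>Since strict partitions have positive parts, membership of 0 records odd length.
  Conversely, evenness of the set tells whether the list of its positive elements must be
  augmented.\<close>

lemma DP_augment_bij:
  "bij_betw (\<lambda>l. set (augment l)) DP {I. finite I \<and> even (card I)}"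
proof (rule bij_betwI[where g = "\<lambda>I. desc (I - {0})"])
  have sorted: "sorted_wrt (>) (augment l)" if "l \<in> DP" for l
    using that by (auto simp: DP_def augment_def sorted_wrt_append)
  show "(\<lambda>l. set (augment l)) \<in> DP \<rightarrow> {I. finite I \<and> even (card I)}"
  proof
    fix l assume "l \<in> DP"
    then have "card (set (augment l)) = length (augment l)"
      using desc_props(3)[of "set (augment l)"] desc_set[OF sorted] by simp
    then show "set (augment l) \<in> {I. finite I \<and> even (card I)}"
      by (simp add: augment_def)
  qed
  show "(\<lambda>I. desc (I - {0})) \<in> {I. finite I \<and> even (card I)} \<rightarrow> DP"
  proof
    fix I :: "nat set" assume "I \<in> {I. finite I \<and> even (card I)}"
    then have "finite (I - {0})" by simp
    from desc_props[OF this] show "desc (I - {0}) \<in> DP" by (simp add: DP_def)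
  qed
  show "desc (set (augment l) - {0}) = l" if "l \<in> DP" for l
  proof -
    have "set (augment l) - {0} = set l" using that by (auto simp: DP_def augment_def)
    then show ?thesis using that by (simp add: desc_set DP_def)
  qed
  show "set (augment (desc (I - {0}))) = I" if "I \<in> {I. finite I \<and> even (card I)}" for I
  proof -
    have fin: "finite (I - {0})" "finite I" and ev: "even (card I)" using that by auto
    note P = desc_props[OF fin(1)]
    show ?thesis
    proof (cases "0 \<in> I")
      case True
      then have "card I = Suc (card (I - {0}))" by (rule card.remove[OF fin(2)])
      then have "odd (card (I - {0}))" using ev by simp
      then show ?thesis using P True by (auto simp: augment_def)
    next
      case False
      then have "I - {0} = I" by auto
      then show ?thesis using P ev by (simp add: augment_def)
    qed
  qed
qed

section \<open>The series and its logarithmic derivatives\<close>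

context
  fixes a :: "nat \<Rightarrow> complex"
begin

interpretation Qa: schur_eval "poly_eval (\<lambda>c. c) a"
  by standard (rule poly_eval_hom, simp add: ring_hom_fun_def)

lemma id_hom: "ring_hom_fun (\<lambda>c :: complex. c)"
  by (simp add: ring_hom_fun_def)

lemma Qa_hc: "Qa.hc c = c"
  by (simp add: Qa.hc_def poly_eval_const id_hom)

lemma Qa_hx: "Qa.hx k = a k"
  by (simp add: Qa.hx_def poly_eval_var id_hom)

definition Qa_pf :: "nat set \<Rightarrow> complex" where "Qa_pf = pf Qa.A"

lemma tau_term_eq:
  assumes "l \<in> DP"
  shows "tau_term a l = mfps_const (Qa_pf (set (augment l))) * Qt_pf (set (augment l))"
  using Qa.h_schur_Q[OF assms] Qt.h_schur_Q[OF assms]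
  by (simp add: tau_term_def schur_Q_at_def schur_Q_2t_def Qa_pf_def Qt_pf_def)

lemma raise_Qa_pf:
  assumes "J \<subseteq> {..<N - (2 * K + 1)}" "2 * K + 1 < N"
  shows "2 * raise (1 / of_real (sqrt 2)) K N Qa_pf J = of_nat (2 * K + 1) * a (2 * K + 1) * Qa_pf J"
proof -
  have o: "odd (2 * K + 1)" by simp
  have "2 * raise (Qa.hc (1 / of_real (sqrt 2))) K N (pf Qa.A) J =
      - (- (of_nat (2 * K + 1) * Qa.hx (2 * K + 1))) * pf Qa.A J"
    using Qa.raise_gaussian[OF Qa.gaussian_A[of N] assms] unfolding Qa.newton[OF o] .
  then show ?thesis
    unfolding Qa_pf_def Qa_hx Qa_hc by (simp only: minus_minus)
qed

definition term_set :: "nat \<Rightarrow> nat set set" where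
  "term_set d = {I. finite I \<and> \<Sum>I = d}"

lemma term_set_subset: "term_set d \<subseteq> Pow {..d}"
proof
  fix I assume "I \<in> term_set d"
  then have "finite I" "\<Sum>I = d" by (auto simp: term_set_def)
  then have "x \<le> d" if "x \<in> I" for x using member_le_sum[of x I "\<lambda>x. x"] that by auto
  then show "I \<in> Pow {..d}" by auto
qed

lemma Qt_pf_nonzero: "finite I \<Longrightarrow> mcoeff (Qt_pf I) m \<noteq> 0 \<Longrightarrow> I \<in> term_set (wdeg m)"
  using graded_Qt_pf[of I] by (auto simp: graded_def term_set_def)

lemma tau_term_support:
  assumes "l \<in> DP" "mcoeff (tau_term a l) m \<noteq> 0"
  shows "set (augment l) \<in> term_set (wdeg m)"
  using assms Qt_pf_nonzero[of "set (augment l)" m] by (auto simp: tau_term_eq)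

lemma tau_summable: "formally_summable (tau_term a) DP"
  unfolding formally_summable_def
proof
  fix m
  have "finite (term_set (wdeg m))"
    by (rule finite_subset[OF term_set_subset]) simp
  then have "finite {l \<in> DP. set (augment l) \<in> term_set (wdeg m)}"
    using DP_augment_bij finite_inverse_image_gen[of "term_set (wdeg m)" "\<lambda>l. set (augment l)" DP]
    by (simp add: bij_betw_def)
  then show "finite {l \<in> DP. mcoeff (tau_term a l) m \<noteq> 0}"
    by (rule finite_subset[rotated]) (use tau_term_support in auto)
qed

text \<open>Only sets with sum \<open>wdeg m\<close> contribute, and they lie below
  \<open>N\<close>; sets of odd size enter with value 0. The freedom in \<open>N\<close> allows one
  index set for a coefficient and for the higher one that enters its derivative.\<close>

lemma mcoeff_tau:
  assumes "wdeg m < N"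
  shows "mcoeff (formal_sum (tau_term a) DP) m = (\<Sum>I\<in>Pow {..<N}. Qa_pf I * mcoeff (Qt_pf I) m)"
proof -
  let ?t = "\<lambda>I. Qa_pf I * mcoeff (Qt_pf I) m"
  have t: "mcoeff (tau_term a l) m = ?t (set (augment l))" if "l \<in> DP" for l
    using that by (simp add: tau_term_eq)
  have "mcoeff (formal_sum (tau_term a) DP) m = (\<Sum>l | l \<in> DP \<and> mcoeff (tau_term a l) m \<noteq> 0. ?t (set (augment l)))"
    unfolding formal_sum_def mcoeff_Abs_mfps by (rule sum.cong) (auto simp: t)
  also have "\<dots> = (\<Sum>I\<in>{I. finite I \<and> even (card I) \<and> ?t I \<noteq> 0}. ?t I)"
  proof (rule sum.reindex_bij_betw)
    show "bij_betw (\<lambda>l. set (augment l)) {l. l \<in> DP \<and> mcoeff (tau_term a l) m \<noteq> 0}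
        {I. finite I \<and> even (card I) \<and> ?t I \<noteq> 0}"
      unfolding bij_betw_def
    proof
      note B = DP_augment_bij[unfolded bij_betw_def]
      show "inj_on (\<lambda>l. set (augment l)) {l. l \<in> DP \<and> mcoeff (tau_term a l) m \<noteq> 0}"
        by (rule inj_on_subset[OF B[THEN conjunct1]]) auto
      have "(\<lambda>l. set (augment l)) ` {l. l \<in> DP \<and> mcoeff (tau_term a l) m \<noteq> 0} =
          {I \<in> (\<lambda>l. set (augment l)) ` DP. ?t I \<noteq> 0}"
        using t by auto
      then show "(\<lambda>l. set (augment l)) ` {l. l \<in> DP \<and> mcoeff (tau_term a l) m \<noteq> 0} =
          {I. finite I \<and> even (card I) \<and> ?t I \<noteq> 0}"
        unfolding B[THEN conjunct2] by auto
    qed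
  qed
  also have "\<dots> = (\<Sum>I\<in>Pow {..<N}. ?t I)"
  proof (rule sum.mono_neutral_left)
    show "{I. finite I \<and> even (card I) \<and> ?t I \<noteq> 0} \<subseteq> Pow {..<N}"
    proof
      fix I assume "I \<in> {I. finite I \<and> even (card I) \<and> ?t I \<noteq> 0}"
      then have "I \<in> term_set (wdeg m)" by (intro Qt_pf_nonzero) auto
      then have "I \<subseteq> {..wdeg m}" using term_set_subset by blast
      then show "I \<in> Pow {..<N}" using assms by auto
    qed
    show "\<forall>I\<in>Pow {..<N} - {I. finite I \<and> even (card I) \<and> ?t I \<noteq> 0}. ?t I = 0"
    proof
      fix I assume "I \<in> Pow {..<N} - {I. finite I \<and> even (card I) \<and> ?t I \<noteq> 0}"
      moreover from this have "finite I" using finite_subset[of I "{..<N}"] by auto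
      moreover have "Qa_pf I = 0" if "odd (card I)"
        using that unfolding Qa_pf_def pf_def by simp
      ultimately show "?t I = 0" by auto
    qed
  qed simp
  finally show ?thesis .
qed

lemma graded_tau:
  assumes "mcoeff (formal_sum (tau_term a) DP) m \<noteq> 0"
  shows "Poly_Mapping.keys m \<subseteq> {k. odd k}"
proof -
  have "(\<Sum>I\<in>Pow {..<Suc (wdeg m)}. Qa_pf I * mcoeff (Qt_pf I) m) \<noteq> 0"
    using assms mcoeff_tau[of m "Suc (wdeg m)"] by simp
  then obtain I where "I \<in> Pow {..<Suc (wdeg m)}" "mcoeff (Qt_pf I) m \<noteq> 0"
    by (metis (no_types, lifting) mult_zero_right sum.neutral)
  then show ?thesis
    using graded_Qt_pf[of I] finite_subset[of I] unfolding graded_def by blast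
qed

text \<open>For odd \<open>k\<close> the derivative acts on Q(2t) as \<open>lower\<close>,
  adjointness moves it to Q(a) as \<open>raise\<close>, and there it is a scalar. For even
  \<open>k\<close> both sides vanish, since only odd times occur.\<close>

lemma deriv_tau:
  "mfps_deriv k (formal_sum (tau_term a) DP) =
     mfps_const (if odd k then of_nat k * a k else 0) * formal_sum (tau_term a) DP" (is "_ = _ * ?S")
proof (rule mfps_eqI)
  fix m
  show "mcoeff (mfps_deriv k ?S) m = mcoeff (mfps_const (if odd k then of_nat k * a k else 0) * ?S) m"
  proof (cases "odd k")
    case False
    have "k \<in> Poly_Mapping.keys (m + Poly_Mapping.single k 1)"
      by (simp add: in_keys_iff lookup_add)
    then have "mcoeff ?S (m + Poly_Mapping.single k 1) = 0"
      using graded_tau[of "m + Poly_Mapping.single k 1"] False by blast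
    then show ?thesis using False by (simp add: mcoeff_deriv)
  next
    case True
    then obtain K where K: "k = 2 * K + 1" by (elim oddE)
    \<comment> \<open>Larger than the weight \<open>wdeg m + k\<close> of the differentiated
      monomial, with \<open>N - k = wdeg m + 1\<close>, so that the sets contributing at
      \<open>m\<close> stay clear of the cut-off.\<close>
    define N where "N = Suc (wdeg m + k)"
    define \<rho> where "\<rho> = (1 / of_real (sqrt 2) :: complex)"
    have kN: "2 * K + 1 < N" using K by (simp add: N_def)
    \<comment> \<open>Adjointness pairs two functions with values in one ring, so the numbers Q(a)
      become constant series.\<close>
    let ?U = "\<lambda>I. mfps_const (Qa_pf I) :: nat mfps"
    have hom: "ring_hom_fun (mfps_const :: complex \<Rightarrow> nat mfps)" by (rule mfps_const_hom)
    note H = ring_hom_funD[OF hom]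
    have csg: "mfps_const (sg i I) = (sg i I :: nat mfps)" for i I
      by (simp add: sg_def ring_hom_fun_power[OF hom] H)
    have can: "an i (\<lambda>I. mfps_const (f I)) I = (mfps_const (an i f I) :: nat mfps)"
      and ccr: "cr i (\<lambda>I. mfps_const (f I)) I = (mfps_const (cr i f I) :: nat mfps)" for i I and f :: "nat set \<Rightarrow> complex"
      by (simp_all add: an_def cr_def H csg)
    have an': "an i (\<lambda>I. mfps_const (f I)) = (\<lambda>I. mfps_const (an i f I) :: nat mfps)" for i and f :: "nat set \<Rightarrow> complex"
      by (rule ext) (rule can)
    have cedge: "edge (mfps_const \<rho>) j = (mfps_const (edge \<rho> j) :: nat mfps)"
      and cpair: "pair_coeff (mfps_const \<rho>) j = (mfps_const (pair_coeff \<rho> j) :: nat mfps)" for j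
      by (simp_all add: edge_def pair_coeff_def H ring_hom_fun_power[OF hom])
    have raiseU: "raise (mfps_const \<rho>) K N ?U I = mfps_const (raise \<rho> K N Qa_pf I)" for I
      by (simp add: raise_def an' ccr cedge cpair H ring_hom_fun_sum[OF hom])
    have two: "mcoeff (2 * f) x = 2 * mcoeff f x" for f :: "nat mfps" and x
      using mcoeff_of_nat_mult[of 2 f x] by simp
    have "mcoeff (mfps_deriv k ?S) m = of_nat (Poly_Mapping.lookup m k + 1) *
        (\<Sum>I\<in>Pow {..<N}. Qa_pf I * mcoeff (Qt_pf I) (m + Poly_Mapping.single k 1))"
      unfolding mcoeff_deriv by (subst mcoeff_tau[of _ N]) (simp_all add: wdeg_add N_def)
    also have "\<dots> = (\<Sum>I\<in>Pow {..<N}. mcoeff (?U I * mfps_deriv k (Qt_pf I)) m)"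
      by (simp add: mcoeff_deriv sum_distrib_left mult_ac)
    also have "\<dots> = 2 * mcoeff (\<Sum>I\<in>Pow {..<N}. ?U I * lower (mfps_const \<rho>) K N Qt_pf I) m"
      unfolding mcoeff_sum sum_distrib_left
    proof (intro sum.cong refl)
      fix I assume "I \<in> Pow {..<N}"
      then have "mfps_deriv k (Qt_pf I) = 2 * lower (mfps_const \<rho>) K N Qt_pf I"
        unfolding K \<rho>_def using kN by (intro deriv_Qt_pf) auto
      then show "mcoeff (?U I * mfps_deriv k (Qt_pf I)) m = 2 * mcoeff (?U I * lower (mfps_const \<rho>) K N Qt_pf I) m"
        by (simp add: two)
    qed
    also have "(\<Sum>I\<in>Pow {..<N}. ?U I * lower (mfps_const \<rho>) K N Qt_pf I) =
        (\<Sum>I\<in>Pow {..<N}. raise (mfps_const \<rho>) K N ?U I * Qt_pf I)"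
      using kN by (intro raise_lower_adjoint) auto
    also have "2 * mcoeff \<dots> m = (\<Sum>I\<in>Pow {..<N}. 2 * raise \<rho> K N Qa_pf I * mcoeff (Qt_pf I) m)"
      by (simp add: raiseU mcoeff_sum sum_distrib_left mult.assoc)
    also have "\<dots> = (\<Sum>I\<in>Pow {..<N}. of_nat k * a k * Qa_pf I * mcoeff (Qt_pf I) m)"
    proof (intro sum.cong refl)
      fix I assume I: "I \<in> Pow {..<N}"
      show "2 * raise \<rho> K N Qa_pf I * mcoeff (Qt_pf I) m = of_nat k * a k * Qa_pf I * mcoeff (Qt_pf I) m"
      \<comment> \<open>The eigenvalue equation is available only for sets below
        \<open>N - k\<close>; any other set has coefficient 0 at \<open>m\<close>.\<close>
      proof (cases "mcoeff (Qt_pf I) m = 0")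
        case False
        then have "I \<subseteq> {..wdeg m}"
          using Qt_pf_nonzero[of I m] I term_set_subset[of "wdeg m"] finite_subset[of I "{..<N}"] by auto
        then have "I \<subseteq> {..<N - (2 * K + 1)}" using K by (auto simp: N_def)
        then show ?thesis using raise_Qa_pf[of I N K] kN unfolding \<rho>_def K by simp
      qed simp
    qed
    also have "\<dots> = of_nat k * a k * mcoeff ?S m"
      by (subst mcoeff_tau[of m N]) (simp_all add: N_def sum_distrib_left mult.assoc)
    finally show ?thesis using True by simp
  qed
qed

lemma mcoeff_tau_0: "mcoeff (formal_sum (tau_term a) DP) 0 = 1"
proof -
  \<comment> \<open>Weight 0 permits N = 1, where the only nonempty set {0} has odd size and
    contributes nothing.\<close>
  have "Pow {..<Suc 0} = {{}, {0 :: nat}}" by auto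
  then show ?thesis
    by (subst mcoeff_tau[of 0 1]) (simp_all add: Qa_pf_def Qt_pf_def pf_empty mcoeff_one, simp add: pf_def)
qed

end

theorem theorem1p6:
  fixes a :: "nat \<Rightarrow> complex"
  shows "formally_summable (tau_term a) DP \<and> KdV_tau (formal_sum (tau_term a) DP)"
proof
  let ?S = "formal_sum (tau_term a) DP"
  have odd: "depends_only_on {k. odd k} ?S"
    using graded_tau by (simp add: depends_only_on_def)
  moreover have "{k :: nat. odd k} \<subseteq> {1..}"
    by (auto intro: Suc_leI odd_pos)
  ultimately have "depends_only_on {1..} ?S"
    unfolding depends_only_on_def by (meson order.trans)
  moreover have "?S \<noteq> 0"
    using mcoeff_tau_0[of a] by auto
  moreover have "KP_residue ?S = 0"
    by (rule KP_residue_zero[OF deriv_tau])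
  ultimately show "KdV_tau ?S"
    using odd by (simp add: KdV_tau_def KP_tau_def)
qed (rule tau_summable)

end
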